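(* Fix a small $\delta>0$ and a positive integer $m$, and let $w_{m,j}(\mu,z)$ ($j=0,\pm1$) be the asymptotic solutions, with associated relative errors $\tilde\eta_{2m+2}$, $\eta_{2m+2}$, described in the context. As $\mu\to\infty$ with $\lambda=\kappa/\mu\in[0,1-\delta]$, and for $z\in\mathbb C^+$, $$M_{\kappa,\mu}(\mu z)=\frac{2\sqrt\pi\,(1-\lambda)^{\mu}\,\Gamma(2\mu+1)}{\mu^{\kappa-\frac16}(1-\lambda^2)^{(\mu+\kappa)/2}\,\Gamma(\mu-\kappa+\frac12)}\exp\left\{\tfrac12\left(\mu-\kappa+\tfrac13\right)\pi i+\kappa-\sum_{s=0}^{m}\frac{\hat E^+_{2s+1}(\infty)}{\mu^{2s+1}}\right\}\{1+\delta^+_{2m+2}(\mu)\}^{-1}w_{m,-1}(\mu,z),$$ $$W_{\kappa,\mu}(\mu z)=2\sqrt\pi\,\mu^{\kappa+\frac16}(1-\lambda^2)^{\kappa/2}\left(\frac{1+\lambda}{1-\lambda}\right)^{\mu/2}\exp\left\{\tfrac12(\kappa-\mu)\pi i-\kappa+\sum_{s=0}^{m}\frac{\hat E^+_{2s+1}(\infty)}{\mu^{2s+1}}\right\}\{1+\delta^-_{2m+2}(\mu)\}^{-1}w_{m,0}(\mu,z),$$ and $$W_{-\kappa,\mu}\left(\mu ze^{-\pi i}\right)=\frac{2\sqrt\pi\,(1-\lambda)^{\mu}}{\mu^{\kappa-\frac16}(1-\lambda^2)^{(\mu+\kappa)/2}}\exp\left\{\tfrac12\left(\mu+\kappa-\tfrac13\right)\pi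 i+\kappa-\sum_{s=0}^{m}\frac{\hat E^+_{2s+1}(\infty)}{\mu^{2s+1}}\right\}\{1+\delta^+_{2m+2}(\mu)\}^{-1}w_{m,1}(\mu,z),$$ where $\delta^{\pm}_{2m+2}(\mu)$ are independent of $z$ (the same $\delta^+_{2m+2}(\mu)$ in the first and third formulas) and $$|\delta^{\pm}_{2m+2}(\mu)|\le\max\{|\tilde\eta_{2m+2}(\mu,\infty)|,|\eta_{2m+2}(\mu,\infty)|\}\left[1+\exp\left\{\pm2\sum_{s=0}^{m}\frac{\hat E^+_{2s+1}(\infty)}{\mu^{2s+1}}\right\}\right].$$ Here $\mu$ is assumed to be sufficiently large that $|\delta^{\pm}_{2m+2}(\mu)|<1$.
   Context: $M_{\kappa,\mu}$ and $W_{\kappa,\mu}$ are the Whittaker functions, solutions of $y''=\left(\frac{\mu^2-1/4}{z^2}-\frac{\kappa}{z}+\frac14\right)y$, with $M_{\kappa,\mu}(z)\sim z^{\mu+1/2}$ as $z\to0$ and $W_{\kappa,\mu}(z)\sim z^\kappa e^{-z/2}$ as $z\to\infty$, $|\arg z|\le\frac32\pi-\delta$. Here $\mu>0$, $\kappa=\lambda\mu$ are real, $\mathbb C^+=\{z\ne0:0\le\arg z\le\pi\}$, and $\delta$ is an arbitrary small positive constant. The functions $M_{\kappa,\mu}(\mu z)$, $W_{\kappa,\mu}(\mu z)$, $W_{-\kappa,\mu}(\mu ze^{-\pi i})$ satisfy $$\frac{d^2w}{dz^2}=\left\{\mu^2f(z)+g(z)\right\}w,\qquad f(z)=\frac{z^2-4\lambda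 z+4}{4z^2},\quad g(z)=-\frac1{4z^2}.\qquad( * )$$ **Variables.** The turning point in the upper half plane is $z^+=2\lambda+2i\sqrt{1-\lambda^2}$. Let $Z=(z^2-4\lambda z+4)^{1/2}$ and $$\xi^+=\tfrac23\zeta^{3/2}=\int_{z^+}^zf^{1/2}(t)\,dt=\tfrac12Z-\lambda\ln\left\{\tfrac12(Z+z-2\lambda)\right\}-\ln\left(\frac{Z-\lambda z+2}{z}\right)+\tfrac12(1+\lambda)\ln(1-\lambda^2)-\tfrac12(1-\lambda)\pi i.$$ Three level curves $\Re\,\xi^+=0$ emanate from $z^+$ and divide $\mathbb C^+$ into regions $S_{-1}$ (bounded, with $0$ on its boundary), $S_0$ (containing the end $+\infty$ of the positive axis) and $S_1$ (containing the end $\infty e^{\pi i}$ of the negative axis); $\gamma_2$ is the curve separating $S_{-1}$ from $S_1$. $Z$, $\xi^+$, $(z/Z)^{1/2}$ are the branches continuous in $\mathbb C^+\setminus\gamma_2$ with $Z>0$, $(z/Z)^{1/2}>0$ and the logarithms real for $z\in(0,\infty)$; then $\Re\,\xi^+\to+\infty$ as $\Re z\to+\infty$. The variable $\zeta$ is analytic in $z\in\mathbb C^+$, with $\zeta=2^{-2/3}(1-\lambda^2)^{1/6}e^{i\theta^+}(z-z^+)+\mathcal O((z-z^+)^2)$ as $z\to z^+$, $\theta^+=\frac13\arcsin(2\lambda^2-1)$; fractional powers of $\zeta$ are those consistent with $\xi^+=\frac23\zeta^{3/2}$ ($\zeta^{1/2},\zeta^{1/4}$ principal, cut along $\gamma_2$).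 **Coefficients.** $$\hat F_1(z)=-\frac{z(z^3-16z+4\lambda^2z+16\lambda)}{2Z^6},\quad \hat F_2=-\frac zZ\hat F_1',\quad \hat F_{s+1}=-\frac zZ\hat F_s'-\frac12\sum_{j=1}^{s-1}\hat F_j\hat F_{s-j}\ (s\ge2),\quad \hat E_s(z)=\frac12\int_\infty^z\frac{Z(t)\hat F_s(t)}{t}\,dt.$$ One has $\hat F_s(z)=zZ^{-3s-3}p_{2s+1}(z)$ with $p_{2s+1}$ a polynomial of degree $2s+1$. Write $p^{(e)}_{4k+3}(\tau)$ for the even part in $\tau$ of $p_{4k+3}(\tau+2\lambda)$. Then $\hat E^+_{2k}(z)=\hat E_{2k}(z)$ ($k\ge1$), and for $k\ge0$ $$\hat E^+_{2k+1}(z)=\hat E_{2k+1}(z)+\hat E^+_{2k+1}(\infty),\qquad \hat E^+_{2k+1}(\infty)=\frac1{8(1-\lambda^2)}\int_0^1\frac{p^{(e)}_{4k+3}(b\tilde Z(b))}{\tilde Z(b)^{6k+2}}\,db,\quad \tilde Z(b)=2\left(\frac{1-\lambda^2}{1-b^2}\right)^{1/2}$$ (this choice makes $(z-z^+)^{1/2}\hat E^+_{2k+1}(z)$ meromorphic at $z^+$; e.g. $\hat E_1^+(\infty)=\frac{\lambda}{24(1-\lambda^2)}$). Let $a_1=a_2=\frac5{72}$, $\tilde a_1=\tilde a_2=-\frac7{72}$, with both $b_s=a_s$ and $b_s=\tilde a_s$ satisfying $b_{s+1}=\frac12(s+1)b_s+\frac12\sum_{j=1}^{s-1}b_jb_{s-j}$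 ($s\ge2$), and $$\mathcal E_s(z)=\hat E^+_s(z)+(-1)^s\frac{a_s}{s(\xi^+)^s},\qquad \tilde{\mathcal E}_s(z)=\hat E^+_s(z)+(-1)^s\frac{\tilde a_s}{s(\xi^+)^s}.$$ **Asymptotic solutions.** Let $\mathrm{Ai}_j(x)=\mathrm{Ai}(xe^{-2\pi ij/3})$ and $\mathrm{Ai}_j'(x)=\frac{d}{dx}\mathrm{Ai}_j(x)$ ($j=0,\pm1$). The functions $$w_{m,j}(\mu,z)=\mathrm{Ai}_j(\mu^{2/3}\zeta)\,\mathcal A_{2m+2}(\mu,z)+\mathrm{Ai}'_j(\mu^{2/3}\zeta)\,\mathcal B_{2m+2}(\mu,z)\quad(j=0,\pm1)$$ are solutions of $( * )$, with $w_{m,-1}$ recessive as $z\to0$, $w_{m,0}$ recessive as $z\to+\infty$, and $w_{m,1}$ recessive as $z\to\infty e^{\pi i}$. The coefficient functions $\mathcal A_{2m+2},\mathcal B_{2m+2}$ (independent of $j$) are analytic in $z\in\mathbb C^+$ and, with $\phi(z)=(z/Z)^{1/2}\zeta^{1/4}$ (removable singularity at $z^+$), possess the asymptotic expansions $$\mathcal A_{2m+2}(\mu,z)=\phi(z)\exp\left\{\sum_{s=1}^m\frac{\tilde{\mathcal E}_{2s}(z)}{\mu^{2s}}\right\}\cosh\left\{\sum_{s=0}^m\frac{\tilde{\mathcal E}_{2s+1}(z)}{\mu^{2s+1}}\right\}\{1+\tilde\eta_{2m+2}(\mu,z)\},$$ $$\mathcal B_{2m+2}(\mu,z)=\frac{\phi(z)}{\mu^{1/3}\zeta^{1/2}}\exp\left\{\sum_{s=1}^m\frac{\mathcal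 E_{2s}(z)}{\mu^{2s}}\right\}\sinh\left\{\sum_{s=0}^m\frac{\mathcal E_{2s+1}(z)}{\mu^{2s+1}}\right\}\{1+\eta_{2m+2}(\mu,z)\},$$ where the relative errors $\tilde\eta_{2m+2}(\mu,z)$ and $\eta_{2m+2}(\mu,z)$ are $\mathcal O(\mu^{-2m-2})$ as $\mu\to\infty$, $\lambda\in[0,1-\delta]$, uniformly for $z\in\mathbb C^+$. (The coefficients $\mathcal E_{2s},\tilde{\mathcal E}_{2s}$ are not analytic at $z^+$, so these two expansions are not used directly for computation at or near $z^+$, where $\mathcal A_{2m+2},\mathcal B_{2m+2}$ are nevertheless analytic.) $\tilde\eta_{2m+2}(\mu,\infty)$ and $\eta_{2m+2}(\mu,\infty)$ denote the limiting values as $\Re z\to+\infty$. The existence of $w_{m,j}$ with these properties is taken as given (it is supplied by the general theory of turning point expansions). *)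

theory Defs
  imports "HOL-Complex_Analysis.Complex_Analysis" "HOL-Library.Landau_Symbols"
    "HOL-Computational_Algebra.Polynomial"
begin

text \<open>
  Whittaker functions live on the Riemann surface of the logarithm.  They are represented by
  entire functions \<open>y\<close> of \<open>t = ln z\<close>: the value at the point \<open>z\<close> of the surface with
  \<open>ln z = t\<close> is \<open>y t\<close>.  Multiplying \<open>z\<close> by \<open>exp (- \<pi> i)\<close> is subtracting \<open>\<pi> i\<close>
  from \<open>t\<close>, and the second derivative with respect to \<open>z\<close> is \<open>(y'' - y') / exp (2 t)\<close>.
\<close>

definition whittaker_solution :: "real \<Rightarrow> real \<Rightarrow> (complex \<Rightarrow> complex) \<Rightarrow> bool" where
  "whittaker_solution kappa mu y \<longleftrightarrow>
     y holomorphic_on UNIV \<and>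
     (\<forall>t. (deriv (deriv y) t - deriv y t) / exp t ^ 2 =
        ((of_real mu ^ 2 - 1/4) / exp t ^ 2 - of_real kappa / exp t + 1/4) * y t)"

definition is_whittaker_M :: "real \<Rightarrow> real \<Rightarrow> (complex \<Rightarrow> complex) \<Rightarrow> bool" where
  "is_whittaker_M kappa mu y \<longleftrightarrow>
     whittaker_solution kappa mu y \<and>
     ((\<lambda>t. y t / exp ((of_real mu + 1/2) * t)) \<longlongrightarrow> 1) (filtercomap Re at_bot)"

definition is_whittaker_W :: "real \<Rightarrow> real \<Rightarrow> (complex \<Rightarrow> complex) \<Rightarrow> bool" where
  "is_whittaker_W kappa mu y \<longleftrightarrow>
     whittaker_solution kappa mu y \<and>
     (\<forall>d>0. ((\<lambda>t. y t / exp (of_real kappa * t - exp t / 2)) \<longlongrightarrow> 1)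
        (inf (filtercomap Re at_top) (principal {t. \<bar>Im t\<bar> \<le> 3/2 * pi - d})))"

text \<open>
  \<open>Ai x\<close> is \<open>1 / (2 \<pi> i)\<close> times the integral of \<open>exp (t^3 / 3 - x t)\<close> along the two rays
  from \<open>\<infinity> exp (- \<pi> i / 3)\<close> to \<open>0\<close> and from \<open>0\<close> to \<open>\<infinity> exp (\<pi> i / 3)\<close>;
  on both rays \<open>t^3 = - r^3\<close>.
\<close>

definition airy_ray :: "complex \<Rightarrow> complex \<Rightarrow> complex" where
  "airy_ray w x = integral {0..} (\<lambda>r::real. w * exp (- of_real (r ^ 3) / 3 - x * (of_real r * w)))"

definition Ai :: "complex \<Rightarrow> complex" where
  "Ai x = (airy_ray (cis (pi / 3)) x - airy_ray (cis (- pi / 3)) x) / (2 * of_real pi * \<i>)"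

definition Ai_rot :: "int \<Rightarrow> complex \<Rightarrow> complex" where
  "Ai_rot j x = Ai (x * exp (- 2 * of_real pi * \<i> * of_int j / 3))"

definition Cplus :: "complex set" where
  "Cplus = {z. z \<noteq> 0 \<and> 0 \<le> Arg z \<and> Arg z \<le> pi}"

definition f_LG :: "real \<Rightarrow> complex \<Rightarrow> complex" where
  "f_LG lam z = (z ^ 2 - 4 * of_real lam * z + 4) / (4 * z ^ 2)"

definition g_LG :: "complex \<Rightarrow> complex" where
  "g_LG z = - 1 / (4 * z ^ 2)"

definition LG_solution :: "real \<Rightarrow> real \<Rightarrow> (complex \<Rightarrow> complex) \<Rightarrow> bool" where
  "LG_solution mu lam w \<longleftrightarrow>
     w analytic_on Cplus \<and>
     (\<forall>z\<in>Cplus. deriv (deriv w) z = (of_real (mu ^ 2) * f_LG lam z + g_LG z) * w z)"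

definition recessive :: "complex filter \<Rightarrow> real \<Rightarrow> real \<Rightarrow> (complex \<Rightarrow> complex) \<Rightarrow> bool" where
  "recessive F mu lam w \<longleftrightarrow>
     LG_solution mu lam w \<and> (\<exists>z\<in>Cplus. w z \<noteq> 0) \<and>
     (\<forall>v. LG_solution mu lam v \<and> \<not> (\<exists>c. \<forall>z\<in>Cplus. v z = c * w z) \<longrightarrow>
        ((\<lambda>z. w z / v z) \<longlongrightarrow> 0) F)"

definition at_zero_end :: "complex filter" where
  "at_zero_end = at 0 within Cplus"

definition at_right_end :: "complex filter" where
  "at_right_end = filtermap of_real at_top"

definition at_left_end :: "complex filter" where
  "at_left_end = filtermap (\<lambda>x::real. - of_real x) at_top"

definition Re_to_infinity :: "complex filter" where
  "Re_to_infinity = inf (filtercomap Re at_top) (principal Cplus)"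

definition zplus :: "real \<Rightarrow> complex" where
  "zplus lam = 2 * of_real lam + 2 * \<i> * of_real (sqrt (1 - lam ^ 2))"

definition thetaplus :: "real \<Rightarrow> real" where
  "thetaplus lam = arcsin (2 * lam ^ 2 - 1) / 3"

text \<open>
  The branches belonging to one value of \<open>\<lambda>\<close>: \<open>\<zeta>\<close>, \<open>Z\<close>, the two logarithms in the closed form
  of \<open>\<xi>\<close>, \<open>(z / Z)^(1/2)\<close>, and the regions \<open>S_(-1)\<close>, \<open>S_0\<close>, \<open>S_1\<close>.
\<close>

record branches =
  zeta :: "complex \<Rightarrow> complex"
  Zrt :: "complex \<Rightarrow> complex"
  logA :: "complex \<Rightarrow> complex"
  logB :: "complex \<Rightarrow> complex"
  qrt :: "complex \<Rightarrow> complex"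
  Sm1 :: "complex set"
  S0 :: "complex set"
  S1 :: "complex set"

definition xi :: "branches \<Rightarrow> complex \<Rightarrow> complex" where
  "xi V z = 2/3 * zeta V z powr (3/2)"

definition level_curves :: "branches \<Rightarrow> complex set" where
  "level_curves V = {z\<in>Cplus. Re (xi V z) = 0}"

definition gamma2 :: "branches \<Rightarrow> complex set" where
  "gamma2 V = Cplus \<inter> closure (Sm1 V) \<inter> closure (S1 V)"

definition cut_plane :: "branches \<Rightarrow> complex set" where
  "cut_plane V = Cplus - gamma2 V"

text \<open>
  \<open>Z\<close> is required to be analytic, not merely continuous, on the cut plane (that is, in a
  neighbourhood of each of its points), so that derivatives at the boundary points on the real
  axis make sense.  The values of the other fields off the cut plane are irrelevant, except that
  \<open>\<zeta>\<close> is analytic on all of \<open>Cplus\<close>.  Differentiating the closed form of \<open>\<xi>\<close> gives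
  \<open>Z / (2 z)\<close>, the square root of \<open>f_LG\<close>, and \<open>\<zeta>\<close> vanishes at \<open>zplus\<close>; so \<open>\<xi>\<close> is the integral
  of that square root from \<open>zplus\<close>.
\<close>

definition turning_point_branches :: "real \<Rightarrow> branches \<Rightarrow> bool" where
  "turning_point_branches lam V \<longleftrightarrow>
     zeta V analytic_on Cplus \<and>
     (\<lambda>z. zeta V z - of_real (2 powr (-2/3) * (1 - lam ^ 2) powr (1/6)) * cis (thetaplus lam)
            * (z - zplus lam)) \<in> O[at (zplus lam)](\<lambda>z. (z - zplus lam) ^ 2) \<and>
     components (Cplus - level_curves V) = {Sm1 V, S0 V, S1 V} \<and>
     bounded (Sm1 V) \<and> 0 \<in> frontier (Sm1 V) \<and>
     (\<forall>\<^sub>F z in at_right_end. z \<in> S0 V) \<and> (\<forall>\<^sub>F z in at_left_end. z \<in> S1 V) \<and>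
     Zrt V analytic_on cut_plane V \<and>
     continuous_on (cut_plane V) (logA V) \<and>
     continuous_on (cut_plane V) (logB V) \<and>
     continuous_on (cut_plane V) (qrt V) \<and>
     (\<forall>z\<in>cut_plane V.
        Zrt V z ^ 2 = z ^ 2 - 4 * of_real lam * z + 4 \<and>
        exp (logA V z) = (Zrt V z + z - 2 * of_real lam) / 2 \<and>
        exp (logB V z) = (Zrt V z - of_real lam * z + 2) / z \<and>
        qrt V z ^ 2 = z / Zrt V z \<and>
        xi V z = Zrt V z / 2 - of_real lam * logA V z - logB V z
          + of_real ((1 + lam) * ln (1 - lam ^ 2) / 2) - of_real ((1 - lam) * pi / 2) * \<i>) \<and>
     (\<forall>x::real. x > 0 \<longrightarrow>
        Zrt V (of_real x) \<in> \<real> \<and> Re (Zrt V (of_real x)) > 0 \<and>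
        qrt V (of_real x) \<in> \<real> \<and> Re (qrt V (of_real x)) > 0 \<and>
        logA V (of_real x) \<in> \<real> \<and> logB V (of_real x) \<in> \<real>)"

definition phi :: "branches \<Rightarrow> complex \<Rightarrow> complex" where
  "phi V z = qrt V z * zeta V z powr (1/4)"

lemmas [fundef_cong] = sum.cong

fun Fhat :: "real \<Rightarrow> branches \<Rightarrow> nat \<Rightarrow> complex \<Rightarrow> complex" where
  "Fhat lam V 0 = (\<lambda>z. 0)"
| "Fhat lam V (Suc 0) = (\<lambda>z. - z * (z ^ 3 - 16 * z + 4 * of_real (lam ^ 2) * z + 16 * of_real lam)
      / (2 * Zrt V z ^ 6))"
| "Fhat lam V (Suc (Suc s)) = (\<lambda>z. - z / Zrt V z * deriv (Fhat lam V (Suc s)) z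
      - (\<Sum>j = 1..s. Fhat lam V j z * Fhat lam V (Suc s - j) z) / 2)"

text \<open>The integral from infinity to \<open>z\<close> within \<open>D\<close>: limit of the integrals from \<open>R\<close> to \<open>z\<close>
  along any admissible paths as \<open>R\<close> tends to infinity along the positive axis.\<close>

definition integral_from_infinity ::
    "complex set \<Rightarrow> (complex \<Rightarrow> complex) \<Rightarrow> complex \<Rightarrow> complex" where
  "integral_from_infinity D g z = (THE I. \<forall>p :: real \<Rightarrow> real \<Rightarrow> complex.
     (\<forall>R>0. valid_path (p R) \<and> path_image (p R) \<subseteq> D \<and>
            pathstart (p R) = of_real R \<and> pathfinish (p R) = z) \<longrightarrow>
     ((\<lambda>R. contour_integral (p R) g) \<longlongrightarrow> I) at_top)"

definition Ehat :: "real \<Rightarrow> branches \<Rightarrow> nat \<Rightarrow> complex \<Rightarrow> complex" where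
  "Ehat lam V s z =
     integral_from_infinity (cut_plane V) (\<lambda>t. Zrt V t * Fhat lam V s t / t) z / 2"

text \<open>\<open>p_hat lam V s\<close> is the polynomial denoted \<open>p\<close> with index \<open>2 s + 1\<close>; hence
  \<open>p\<close> with index \<open>4 k + 3\<close> is \<open>p_hat lam V (2 * k + 1)\<close>.\<close>

definition p_hat :: "real \<Rightarrow> branches \<Rightarrow> nat \<Rightarrow> real poly" where
  "p_hat lam V s = (THE p. \<forall>z\<in>cut_plane V.
     Fhat lam V s z = z * poly (map_poly of_real p) z / Zrt V z ^ (3 * s + 3))"

definition p_even :: "real \<Rightarrow> branches \<Rightarrow> nat \<Rightarrow> real \<Rightarrow> real" where
  "p_even lam V k tau = (poly (p_hat lam V (2 * k + 1)) (tau + 2 * lam)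
      + poly (p_hat lam V (2 * k + 1)) (- tau + 2 * lam)) / 2"

definition Ztilde :: "real \<Rightarrow> real \<Rightarrow> real" where
  "Ztilde lam b = 2 * sqrt ((1 - lam ^ 2) / (1 - b ^ 2))"

text \<open>\<open>Ehat_inf lam V k\<close> is the limit at infinity of the coefficient with index \<open>2 k + 1\<close>.\<close>

definition Ehat_inf :: "real \<Rightarrow> branches \<Rightarrow> nat \<Rightarrow> real" where
  "Ehat_inf lam V k = 1 / (8 * (1 - lam ^ 2)) *
     integral {0..1} (\<lambda>b. p_even lam V k (b * Ztilde lam b) / Ztilde lam b ^ (6 * k + 2))"

definition Ehat_plus :: "real \<Rightarrow> branches \<Rightarrow> nat \<Rightarrow> complex \<Rightarrow> complex" where
  "Ehat_plus lam V s z =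
     (if even s then Ehat lam V s z else Ehat lam V s z + of_real (Ehat_inf lam V (s div 2)))"

fun airy_coeff :: "real \<Rightarrow> nat \<Rightarrow> real" where
  "airy_coeff b 0 = 0"
| "airy_coeff b (Suc 0) = b"
| "airy_coeff b (Suc (Suc 0)) = b"
| "airy_coeff b (Suc (Suc (Suc r))) =
     real (r + 3) / 2 * airy_coeff b (Suc (Suc r))
     + (\<Sum>j = 1..Suc r. airy_coeff b j * airy_coeff b (Suc (Suc r) - j)) / 2"

definition Ecal_gen :: "real \<Rightarrow> real \<Rightarrow> branches \<Rightarrow> nat \<Rightarrow> complex \<Rightarrow> complex" where
  "Ecal_gen b lam V s z =
     Ehat_plus lam V s z + (-1) ^ s * of_real (airy_coeff b s) / (of_nat s * xi V z ^ s)"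

abbreviation Ecal :: "real \<Rightarrow> branches \<Rightarrow> nat \<Rightarrow> complex \<Rightarrow> complex" where
  "Ecal \<equiv> Ecal_gen (5/72)"

abbreviation Ecal_tilde :: "real \<Rightarrow> branches \<Rightarrow> nat \<Rightarrow> complex \<Rightarrow> complex" where
  "Ecal_tilde \<equiv> Ecal_gen (-7/72)"

definition odd_sum_inf :: "nat \<Rightarrow> real \<Rightarrow> real \<Rightarrow> branches \<Rightarrow> real" where
  "odd_sum_inf m mu lam V = (\<Sum>s = 0..m. Ehat_inf lam V s / mu ^ (2 * s + 1))"

definition A_approx :: "nat \<Rightarrow> real \<Rightarrow> real \<Rightarrow> branches \<Rightarrow> complex \<Rightarrow> complex" where
  "A_approx m mu lam V z =
     phi V z * exp (\<Sum>s = 1..m. Ecal_tilde lam V (2 * s) z / of_real mu ^ (2 * s))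
       * cosh (\<Sum>s = 0..m. Ecal_tilde lam V (2 * s + 1) z / of_real mu ^ (2 * s + 1))"

definition B_approx :: "nat \<Rightarrow> real \<Rightarrow> real \<Rightarrow> branches \<Rightarrow> complex \<Rightarrow> complex" where
  "B_approx m mu lam V z =
     phi V z / (of_real (mu powr (1/3)) * zeta V z powr (1/2))
       * exp (\<Sum>s = 1..m. Ecal lam V (2 * s) z / of_real mu ^ (2 * s))
       * sinh (\<Sum>s = 0..m. Ecal lam V (2 * s + 1) z / of_real mu ^ (2 * s + 1))"

definition w_airy :: "real \<Rightarrow> branches \<Rightarrow> (complex \<Rightarrow> complex) \<Rightarrow> (complex \<Rightarrow> complex) \<Rightarrow>
    int \<Rightarrow> complex \<Rightarrow> complex" where
  "w_airy mu V A B j z =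
     Ai_rot j (of_real (mu powr (2/3)) * zeta V z) * A z
     + deriv (Ai_rot j) (of_real (mu powr (2/3)) * zeta V z) * B z"

text \<open>
  \<open>A mu lam\<close>, \<open>B mu lam\<close> are the coefficient functions, \<open>eta_t mu lam\<close> and \<open>eta mu lam\<close> their
  relative errors with limits \<open>eta_t_inf mu lam\<close>, \<open>eta_inf mu lam\<close>, for \<open>mu \<ge> mu1\<close> and
  \<open>lam \<in> {0..1-d}\<close>.

  \<open>Dom lam\<close> is the set on which the two expansions and the uniform error bound are assumed to
  hold.  Uniform validity on all of \<open>Cplus\<close> off the cut is the instance
  \<open>Dom lam = cut_plane (V lam)\<close>.  Read literally that instance fails near \<open>zplus\<close>, where the
  exponents are singular while \<open>A\<close> and \<open>B\<close> are analytic, and near zeros of the hyperbolic sine,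
  where no relative error for \<open>B\<close> can be uniformly small.  Therefore only a set
  containing all points of \<open>Cplus\<close> with sufficiently large real part is required.
\<close>

definition asymptotic_solutions ::
  "real \<Rightarrow> nat \<Rightarrow> real \<Rightarrow> (real \<Rightarrow> branches) \<Rightarrow> (real \<Rightarrow> complex set) \<Rightarrow>
   (real \<Rightarrow> real \<Rightarrow> complex \<Rightarrow> complex) \<Rightarrow> (real \<Rightarrow> real \<Rightarrow> complex \<Rightarrow> complex) \<Rightarrow>
   (real \<Rightarrow> real \<Rightarrow> complex \<Rightarrow> complex) \<Rightarrow> (real \<Rightarrow> real \<Rightarrow> complex \<Rightarrow> complex) \<Rightarrow>
   (real \<Rightarrow> real \<Rightarrow> complex) \<Rightarrow> (real \<Rightarrow> real \<Rightarrow> complex) \<Rightarrow> bool" where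
  "asymptotic_solutions d m mu1 V Dom A B eta_t eta eta_t_inf eta_inf \<longleftrightarrow>
     mu1 > 0 \<and>
     (\<forall>lam\<in>{0..1-d}. Dom lam \<subseteq> cut_plane (V lam) \<and> (\<forall>\<^sub>F z in Re_to_infinity. z \<in> Dom lam)) \<and>
     (\<forall>mu\<ge>mu1. \<forall>lam\<in>{0..1-d}.
        A mu lam analytic_on Cplus \<and> B mu lam analytic_on Cplus \<and>
        (\<forall>j\<in>{-1,0,1}. LG_solution mu lam (w_airy mu (V lam) (A mu lam) (B mu lam) j)) \<and>
        recessive at_zero_end mu lam (w_airy mu (V lam) (A mu lam) (B mu lam) (-1)) \<and>
        recessive at_right_end mu lam (w_airy mu (V lam) (A mu lam) (B mu lam) 0) \<and>
        recessive at_left_end mu lam (w_airy mu (V lam) (A mu lam) (B mu lam) 1) \<and>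
        (\<forall>z\<in>Dom lam.
           A mu lam z = A_approx m mu lam (V lam) z * (1 + eta_t mu lam z) \<and>
           B mu lam z = B_approx m mu lam (V lam) z * (1 + eta mu lam z)) \<and>
        (eta_t mu lam \<longlongrightarrow> eta_t_inf mu lam) Re_to_infinity \<and>
        (eta mu lam \<longlongrightarrow> eta_inf mu lam) Re_to_infinity) \<and>
     (\<exists>K mu2. \<forall>mu\<ge>max mu1 mu2. \<forall>lam\<in>{0..1-d}. \<forall>z\<in>Dom lam.
        cmod (eta_t mu lam z) \<le> K / mu ^ (2 * m + 2) \<and>
        cmod (eta mu lam z) \<le> K / mu ^ (2 * m + 2))"

end

theory Submission
  imports Defs "HOL-Probability.Distributions" "HOL-Real_Asymp.Real_Asymp"
begin

text \<open>
  On the upper half plane a solution recessive at an end is unique up to a constant, so each Whittaker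
  function is a constant multiple of one \<open>w_airy\<close>, and the constant can be read off from the leading
  behaviour along the positive axis: at \<open>+\<infinity>\<close> itself for \<open>W\<^sub>\<kappa>\<^sub>,\<^sub>\<mu>\<close>, by continuation of the
  expansion of \<open>W\<close> for \<open>W\<^sub>-\<^sub>\<kappa>\<^sub>,\<^sub>\<mu>\<close>, and by the integral representation of Kummer's function for
  \<open>M\<^sub>\<kappa>\<^sub>,\<^sub>\<mu>\<close>.  On the Airy side only the leading asymptotics of \<open>Ai\<close> and \<open>Ai'\<close> matter, because
  \<open>\<xi> \<longlongrightarrow> \<infinity>\<close> removes the terms \<open>a\<^sub>s / \<xi>^s\<close> while \<open>\<E>\<^sub>2\<^sub>s \<longlongrightarrow> 0\<close> and
  \<open>\<E>\<^sub>2\<^sub>s\<^sub>+\<^sub>1\<close> tends to the constant \<open>Ehat_inf\<close>.  With \<open>S\<close> the sum of these constants and limiting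
  errors \<open>t\<close>, \<open>e\<close> the combination \<open>cosh S (1 + t) \<plusminus> sinh S (1 + e)\<close> equals
  \<open>exp (\<plusminus> S) (1 + \<delta>)\<close>, which defines \<open>\<delta>\<close>.
\<close>

section \<open>The Airy function\<close>

text \<open>Two steps named above hide the real obstacles. The branches are given by axioms, and the
  closed form of \<xi> holds only off \<open>gamma2\<close>, so nothing can be read off along the
  positive axis until that axis is known to avoid \<open>gamma2\<close>; the only information on
  this curve is that it lies in the closures of two components. Secondly, \<open>Ehat\<close> is a
  definite description over all families of paths in a cut plane whose topology is not known. It has
  a value because the integrands have single-valued primitives there. For odd index these come from
  reducing \<open>t ^ j / Z ^ n\<close> with odd \<open>n\<close>. For even index the integrand is
  rational, and logarithms are avoided because the even coefficients form the logarithmic derivative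
  of a generating function of the odd ones. Finally, both \<open>cmod delta < 1\<close> and the
  stated bound are obtained for small \<open>S\<close>. One threshold for all \<lambda> therefore
  requires bounds on \<open>Ehat_inf\<close> that are uniform in \<lambda>, and for this the
  coefficient polynomials are followed as functions of \<lambda>.\<close>

lemma entire_primitive:
  fixes f :: "complex \<Rightarrow> complex"
  assumes "f holomorphic_on UNIV"
  obtains P where "\<And>z. (P has_field_derivative f z) (at z)"
proof -
  have "\<exists>P. \<forall>z\<in>UNIV. (P has_field_derivative f z) (at z within UNIV)"
    using holomorphic_convex_primitive'[OF convex_UNIV open_UNIV assms] by metis
  then show ?thesis using that by blast
qed

lemma primitive_segment_bound:
  fixes f P :: "complex \<Rightarrow> complex"
  assumes "\<And>z. (P has_field_derivative f z) (at z)"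
    and "\<And>z. z \<in> closed_segment a b \<Longrightarrow> cmod (f z) \<le> B"
  shows "cmod (P b - P a) \<le> B * cmod (b - a)"
proof -
  have "cmod (P b - P a) \<le> B * cmod (b - a)"
    by (rule field_differentiable_bound[of "closed_segment a b" P f])
      (use assms in \<open>auto intro: has_field_derivative_at_within\<close>)
  then show ?thesis .
qed

lemma primitive_line_integral:
  fixes f P :: "complex \<Rightarrow> complex"
  assumes "\<And>z. (P has_field_derivative f z) (at z)" "a \<le> b"
  shows "((\<lambda>s. w * f (c + of_real s * w)) has_integral (P (c + of_real b * w) - P (c + of_real a * w))) {a..b}"
proof (rule fundamental_theorem_of_calculus[OF assms(2)])
  fix s assume "s \<in> {a..b}"
  have "((\<lambda>s. c + of_real s * w) has_vector_derivative w) (at s within {a..b})"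
    by (auto intro!: derivative_eq_intros)
  from field_vector_diff_chain_within[OF this has_field_derivative_at_within[OF assms(1)]]
  show "((\<lambda>s. P (c + of_real s * w)) has_vector_derivative w * f (c + of_real s * w)) (at s within {a..b})"
    by (simp add: o_def)
qed

text \<open>The cubic absorbs (\<rho> + 1) r: up to r = 3 (\<rho> + 1) this product is at most 3
  (\<rho> + 1)^2, and beyond it r^2 exceeds 3 (\<rho> + 1). The extra 1 leaves the factor exp(-r),
  so the bound is integrable and uniform on discs.\<close>

lemma airy_ray_integrand_bound:
  assumes "cmod w = 1" "0 \<le> r" "cmod x \<le> \<rho>"
  shows "cmod (w * exp (- of_real (r ^ 3) / 3 - x * (of_real r * w))) \<le> exp (3 * (\<rho> + 1) ^ 2) * exp (- r)"
proof -
  have \<rho>: "\<rho> \<ge> 0" using assms(3) norm_ge_zero order_trans by blast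
  have "\<bar>Re (x * (of_real r * w))\<bar> \<le> cmod (x * (of_real r * w))" by (rule abs_Re_le_cmod)
  also have "\<dots> \<le> \<rho> * r" using assms by (simp add: norm_mult mult_right_mono)
  finally have 1: "- Re (x * (of_real r * w)) \<le> \<rho> * r" by linarith
  have 2: "- (r ^ 3) / 3 + (\<rho> + 1) * r \<le> 3 * (\<rho> + 1) ^ 2"
  proof (cases "r \<le> 3 * (\<rho> + 1)")
    case True
    then have "(\<rho> + 1) * r \<le> (\<rho> + 1) * (3 * (\<rho> + 1))" using \<rho> by (intro mult_left_mono) auto
    moreover have "r ^ 3 \<ge> 0" using assms by simp
    moreover have "3 * (\<rho> + 1) ^ 2 = (\<rho> + 1) * (3 * (\<rho> + 1))" by (simp add: power2_eq_square)
    ultimately show ?thesis by linarith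
  next
    case False
    then have "r * r \<ge> (3 * (\<rho> + 1)) * (3 * (\<rho> + 1))" using \<rho> by (intro mult_mono) auto
    moreover have "(3 * (\<rho> + 1)) * (3 * (\<rho> + 1)) \<ge> 3 * (\<rho> + 1)" using \<rho> by (simp add: algebra_simps)
    ultimately have "r * r \<ge> 3 * (\<rho> + 1)" by linarith
    then have "r * (r * r) \<ge> r * (3 * (\<rho> + 1))" using assms by (intro mult_left_mono) auto
    then have "(\<rho> + 1) * r \<le> r ^ 3 / 3" by (simp add: power3_eq_cube algebra_simps)
    moreover have "(0::real) \<le> 3 * (\<rho> + 1) ^ 2" by simp
    ultimately show ?thesis by linarith
  qed
  have "Re (- of_real (r ^ 3) / 3 - x * (of_real r * w)) = - (r ^ 3) / 3 - Re (x * (of_real r * w))"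
    by (simp add: Re_divide_numeral)
  then have "Re (- of_real (r ^ 3) / 3 - x * (of_real r * w)) \<le> 3 * (\<rho> + 1) ^ 2 - r"
    using 1 2 by (simp add: algebra_simps)
  then show ?thesis using assms(1) by (simp add: norm_mult mult_exp_exp)
qed

text \<open>The rate is uniform for \<open>cmod x \<le> \<rho>\<close>. It serves twice: for locally
  uniform convergence in \<open>x\<close>, and for the improper integral along a ray as a limit of
  increments of a primitive.\<close>

lemma airy_ray_tail:
  assumes w: "cmod w = 1" and x: "cmod x \<le> \<rho>" and R: "0 \<le> R"
  defines "g \<equiv> \<lambda>r::real. w * exp (- of_real (r ^ 3) / 3 - x * (of_real r * w))"
  shows "cmod (airy_ray w x - integral {0..R} g) \<le> exp (3 * (\<rho> + 1) ^ 2) * exp (- R)"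
proof -
  let ?C = "exp (3 * (\<rho> + 1) ^ 2)"
  have cont: "continuous_on S g" for S unfolding g_def by (intro continuous_intros) auto
  have E: "((\<lambda>r. ?C * exp (- r)) has_integral ?C * exp (- a)) {a..}" for a :: real
    using has_integral_mult_right[OF has_integral_exp_minus_to_infinity[of 1 a], of ?C] by simp
  have int: "g integrable_on {a..}" if "a \<ge> 0" for a
  proof -
    have "g absolutely_integrable_on {a..}"
    proof (rule measurable_bounded_by_integrable_imp_absolutely_integrable)
      show "g \<in> borel_measurable (lebesgue_on {a..})"
        by (intro continuous_imp_measurable_on_sets_lebesgue cont) auto
      show "(\<lambda>r. ?C * exp (- r)) integrable_on {a..}" using E by blast
      show "norm (g r) \<le> ?C * exp (- r)" if "r \<in> {a..}" for r
        unfolding g_def using that \<open>a \<ge> 0\<close> by (intro airy_ray_integrand_bound w x) auto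
    qed auto
    then show ?thesis using absolutely_integrable_on_def by blast
  qed
  have "(g has_integral (integral {0..R} g + integral {R..} g)) ({0..R} \<union> {R..})"
    by (rule has_integral_Un)
      (use R int in \<open>auto intro!: integrable_integral integrable_continuous_real cont
        intro: negligible_subset[of "{R}"]\<close>)
  moreover have "{0..R} \<union> {R..} = {0..}" using R by auto
  ultimately have "airy_ray w x = integral {0..R} g + integral {R..} g"
    unfolding airy_ray_def by (intro integral_unique) (simp add: g_def)
  then have "cmod (airy_ray w x - integral {0..R} g) = cmod (integral {R..} g)" by simp
  also have "\<dots> \<le> integral {R..} (\<lambda>r. ?C * exp (- r))"
  proof (rule integral_norm_bound_integral)
    show "cmod (g r) \<le> ?C * exp (- r)" if "r \<in> {R..}" for r
      unfolding g_def using that R by (intro airy_ray_integrand_bound w x) auto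
  qed (use E[of R] int R in auto)
  also have "\<dots> = ?C * exp (- R)" by (rule integral_unique[OF E])
  finally show ?thesis .
qed

text \<open>The truncations at n are holomorphic as parameter integrals over a compact interval, and
  they converge uniformly on every disc of radius 1.\<close>

lemma airy_ray_entire:
  assumes w: "cmod w = 1"
  shows "airy_ray w holomorphic_on UNIV"
proof -
  define F where "F = (\<lambda>n x. integral {0..real n} (\<lambda>r. w * exp (- of_real (r ^ 3) / 3 - x * (of_real r * w))))"
  show ?thesis
  proof (rule holomorphic_uniform_sequence[of UNIV F])
    fix n
    have "(\<lambda>x. integral (cbox 0 (real n)) (\<lambda>r. w * exp (- of_real (r ^ 3) / 3 - x * (of_real r * w))))
        holomorphic_on UNIV"
    proof (rule leibniz_rule_holomorphic[where fx = "\<lambda>x r. w * exp (- of_real (r ^ 3) / 3 - x * (of_real r * w)) * (- (of_real r * w))"])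
      show "((\<lambda>x. w * exp (- of_real (t ^ 3) / 3 - x * (of_real t * w))) has_field_derivative
          w * exp (- of_real (t ^ 3) / 3 - x * (of_real t * w)) * (- (of_real t * w))) (at x within UNIV)" for x t
        by (auto intro!: derivative_eq_intros)
      show "(\<lambda>r. w * exp (- of_real (r ^ 3) / 3 - x * (of_real r * w))) integrable_on cbox 0 (real n)" for x
        by (intro integrable_continuous continuous_intros) auto
      show "continuous_on (UNIV \<times> cbox 0 (real n))
         (\<lambda>(x, r). w * exp (- of_real (r ^ 3) / 3 - x * (of_real r * w)) * (- (of_real r * w)))"
        unfolding split_beta by (intro continuous_intros) auto
    qed auto
    then show "F n holomorphic_on UNIV" by (simp add: F_def)
  next
    fix x :: complex
    have "uniform_limit (cball x 1) F (airy_ray w) sequentially"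
    proof (rule uniform_limitI)
      fix e :: real assume "e > 0"
      have "((\<lambda>n. exp (3 * (cmod x + 1 + 1) ^ 2) * exp (- real n)) \<longlongrightarrow> exp (3 * (cmod x + 1 + 1) ^ 2) * 0) sequentially"
        by (intro tendsto_intros filterlim_compose[OF exp_at_bot]
            filterlim_compose[OF filterlim_uminus_at_bot_at_top] filterlim_real_sequentially)
      then have "\<forall>\<^sub>F n in sequentially. exp (3 * (cmod x + 1 + 1) ^ 2) * exp (- real n) < e"
        using \<open>e > 0\<close> by (intro order_tendstoD(2)[of _ 0]) auto
      then show "\<forall>\<^sub>F n in sequentially. \<forall>y\<in>cball x 1. dist (F n y) (airy_ray w y) < e"
      proof eventually_elim
        case (elim n)
        show ?case
        proof
          fix y assume "y \<in> cball x 1"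
          then have "cmod y \<le> cmod x + 1" using norm_triangle_sub[of y x] by (auto simp: dist_norm norm_minus_commute)
          from airy_ray_tail[OF w this, of "real n"] elim
          show "dist (F n y) (airy_ray w y) < e" by (simp add: F_def dist_norm norm_minus_commute)
        qed
      qed
    qed
    then show "\<exists>d>0. cball x d \<subseteq> UNIV \<and> uniform_limit (cball x d) F (airy_ray w) sequentially"
      by (intro exI[of _ 1]) auto
  qed auto
qed

lemma Ai_entire: "Ai holomorphic_on UNIV"
  unfolding Ai_def[abs_def]
  by (intro holomorphic_intros airy_ray_entire) auto

text \<open>As w^3 = -1, the integrand is exp(t^3/3 - x t) pulled back along t = r w. With one
  entire primitive \<open>P\<close> every change of contour becomes an estimate of an increment of
  \<open>P\<close>.\<close>

lemma airy_ray_primitive: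
  assumes w: "cmod w = 1" "w ^ 3 = - 1"
    and P: "\<And>t. (P has_field_derivative exp (t ^ 3 / 3 - x * t)) (at t)"
  shows "((\<lambda>R::real. P (of_real R * w) - P 0) \<longlongrightarrow> airy_ray w x) at_top"
proof -
  let ?g = "\<lambda>r::real. w * exp (- of_real (r ^ 3) / 3 - x * (of_real r * w))"
  have eq: "integral {0..R} ?g = P (of_real R * w) - P 0" if "R \<ge> 0" for R
    using primitive_line_integral[OF P that, of w 0] w(2)
    by (intro integral_unique) (simp add: power_mult_distrib)
  have "((\<lambda>R. integral {0..R} ?g) \<longlongrightarrow> airy_ray w x) at_top"
  proof (rule Lim_transform)
    have "((\<lambda>R::real. exp (3 * (cmod x + 1) ^ 2) * exp (- R)) \<longlongrightarrow> exp (3 * (cmod x + 1) ^ 2) * 0) at_top"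
      by (intro tendsto_intros filterlim_compose[OF exp_at_bot] filterlim_uminus_at_bot_at_top)
    moreover have "\<forall>\<^sub>F R in at_top. cmod (integral {0..R} ?g - airy_ray w x) \<le> exp (3 * (cmod x + 1) ^ 2) * exp (- R)"
    proof (rule eventually_at_top_linorderI[of 0])
      fix R :: real assume "0 \<le> R"
      have "cmod (airy_ray w x - integral {0..R} ?g) \<le> exp (3 * (cmod x + 1) ^ 2) * exp (- R)"
        by (rule airy_ray_tail[OF w(1) order_refl \<open>0 \<le> R\<close>])
      then show "cmod (integral {0..R} ?g - airy_ray w x) \<le> exp (3 * (cmod x + 1) ^ 2) * exp (- R)"
        unfolding norm_minus_commute[of "integral {0..R} ?g" "airy_ray w x"] .
    qed
    ultimately show "((\<lambda>R. integral {0..R} ?g - airy_ray w x) \<longlongrightarrow> 0) at_top"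
      using Lim_null_comparison[of _ "\<lambda>R. exp (3 * (cmod x + 1) ^ 2) * exp (- R)" at_top] by simp
  qed auto
  then show ?thesis
    by (rule Lim_transform_eventually)
      (use eq in \<open>auto intro!: eventually_at_top_linorderI[of 0]\<close>)
qed


text \<open>The segment at height y joins the vertical line Re t = a to the ray of angle pi/3 (or
  -pi/3). On it u = Re t is at most |y| / sqrt 3, hence u^3/3 - u y^2 \<le> -(8/9) u y^2, which
  beats the linear term x t.\<close>

lemma airy_horizontal:
  assumes P: "\<And>t. (P has_field_derivative exp (t ^ 3 / 3 - x * t)) (at t)"
    and a: "0 < a" "sqrt 3 * a \<le> \<bar>y\<bar>"
  shows "cmod (P (Complex (\<bar>y\<bar> / sqrt 3) y) - P (Complex a y)) \<le> \<bar>y\<bar> * exp (2 * cmod x * \<bar>y\<bar> - 8 / 9 * a * y ^ 2)"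
proof -
  have a': "a \<le> \<bar>y\<bar> / sqrt 3" using a by (simp add: field_simps)
  have s3: "\<bar>y\<bar> / sqrt 3 \<le> \<bar>y\<bar>" by (simp add: field_simps mult_le_cancel_left1)
  have "cmod (P (Complex (\<bar>y\<bar> / sqrt 3) y) - P (Complex a y))
      \<le> exp (2 * cmod x * \<bar>y\<bar> - 8 / 9 * a * y ^ 2) * cmod (Complex (\<bar>y\<bar> / sqrt 3) y - Complex a y)"
  proof (rule primitive_segment_bound[OF P])
    fix t assume "t \<in> closed_segment (Complex a y) (Complex (\<bar>y\<bar> / sqrt 3) y)"
    then have t: "Im t = y" "a \<le> Re t" "Re t \<le> \<bar>y\<bar> / sqrt 3"
      using a' by (auto simp: closed_segment_same_Im closed_segment_eq_real_ivl)
    define u where "u = Re t"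
    have teq: "t = Complex u y" using t by (simp add: u_def complex_eq_iff)
    have "Re (t ^ 3) = u ^ 3 - 3 * u * y ^ 2"
      by (simp add: teq power3_eq_cube power2_eq_square algebra_simps)
    then have re: "Re (t ^ 3 / 3 - x * t) = u ^ 3 / 3 - u * y ^ 2 - Re (x * t)"
      by (simp add: Re_divide_numeral)
    have u0: "0 < u" using t a by (simp add: u_def)
    have "u ^ 2 \<le> (\<bar>y\<bar> / sqrt 3) ^ 2" using t u0 by (intro power_mono) (auto simp: u_def)
    then have "u * u ^ 2 \<le> u * (y ^ 2 / 3)" using u0 by (intro mult_left_mono) (auto simp: power_divide)
    then have 1: "u ^ 3 / 3 - u * y ^ 2 \<le> - (8 / 9 * u * y ^ 2)"
      by (simp add: power3_eq_cube power2_eq_square)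
    have 2: "a * y ^ 2 \<le> u * y ^ 2" using t by (intro mult_right_mono) (auto simp: u_def)
    have "cmod t \<le> \<bar>u\<bar> + \<bar>y\<bar>" using cmod_le[of t] by (simp add: teq)
    also have "\<dots> \<le> 2 * \<bar>y\<bar>" using t u0 s3 by (simp add: u_def)
    finally have "cmod x * cmod t \<le> cmod x * (2 * \<bar>y\<bar>)" by (intro mult_left_mono) auto
    then have 3: "- Re (x * t) \<le> 2 * cmod x * \<bar>y\<bar>"
      using abs_Re_le_cmod[of "x * t"] by (simp add: norm_mult)
    have "Re (t ^ 3 / 3 - x * t) \<le> 2 * cmod x * \<bar>y\<bar> - 8 / 9 * a * y ^ 2"
      unfolding re using 1 2 3 by linarith
    then show "cmod (exp (t ^ 3 / 3 - x * t)) \<le> exp (2 * cmod x * \<bar>y\<bar> - 8 / 9 * a * y ^ 2)"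
      by (simp only: norm_exp_eq_Re exp_le_cancel_iff)
  qed
  also have "cmod (Complex (\<bar>y\<bar> / sqrt 3) y - Complex a y) \<le> \<bar>y\<bar>"
  proof -
    have "Complex (\<bar>y\<bar> / sqrt 3) y - Complex a y = of_real (\<bar>y\<bar> / sqrt 3 - a)"
      by (simp add: complex_eq_iff)
    then show ?thesis using a' s3 a by (simp only: norm_of_real)
  qed
  finally show ?thesis by (simp add: mult.commute mult_right_mono)
qed

lemma cis_pi_third: "cis (pi / 3) = Complex (1 / 2) (1 * sqrt 3 / 2)" "cis (- pi / 3) = Complex (1 / 2) (-1 * sqrt 3 / 2)"
  by (auto simp: complex_eq_iff cos_60 sin_60)

text \<open>The two rays may be replaced by any vertical line in the right half plane, because the
  connecting horizontal segments contribute nothing in the limit.\<close>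

lemma airy_contour_shift:
  assumes P: "\<And>t. (P has_field_derivative exp (t ^ 3 / 3 - x * t)) (at t)" and c: "0 < Re c"
  shows "((\<lambda>S. P (c + of_real S * \<i>) - P (c - of_real S * \<i>)) \<longlongrightarrow> 2 * of_real pi * \<i> * Ai x) at_top"
proof -
  let ?a = "Re c"
  have lim0: "((\<lambda>y. \<bar>y\<bar> * exp (2 * cmod x * \<bar>y\<bar> - 8 / 9 * ?a * y ^ 2)) \<longlongrightarrow> 0) at_top"
    using c by real_asymp
  \<comment> \<open>The sign \<open>e\<close> selects the upper or the lower ray; 2 y / sqrt 3 is
    the radius at which that ray reaches height y in absolute value.\<close>
  have *: "((\<lambda>y. P (Complex ?a (e * y)) - P 0) \<longlongrightarrow> airy_ray w x) at_top"
    if w: "w = Complex (1 / 2) (e * sqrt 3 / 2)" and e: "\<bar>e\<bar> = 1" for e w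
  proof (rule Lim_transform)
    have e2: "e * e = 1" using e by (metis abs_mult_self_eq mult_1)
    from e have "e = 1 \<or> e = -1" by linarith
    then have "cmod w = 1" "w ^ 3 = -1"
      unfolding w by (auto simp: cmod_def power_divide complex_eq_iff power3_eq_cube)
    then have "((\<lambda>R::real. P (of_real R * w) - P 0) \<longlongrightarrow> airy_ray w x) at_top"
      by (intro airy_ray_primitive P)
    moreover have "LIM y at_top. 2 / sqrt 3 * y :> (at_top :: real filter)" by real_asymp
    ultimately have "((\<lambda>y. P (of_real (2 / sqrt 3 * y) * w) - P 0) \<longlongrightarrow> airy_ray w x) at_top"
      by (rule filterlim_compose)
    moreover have "of_real (2 / sqrt 3 * y) * w = Complex (y / sqrt 3) (e * y)" for y
      by (simp add: w complex_eq_iff)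
    ultimately show "((\<lambda>y. P (Complex (y / sqrt 3) (e * y)) - P 0) \<longlongrightarrow> airy_ray w x) at_top" by simp
    show "((\<lambda>y. (P (Complex ?a (e * y)) - P 0) - (P (Complex (y / sqrt 3) (e * y)) - P 0)) \<longlongrightarrow> 0) at_top"
    proof (rule Lim_null_comparison[OF _ lim0], rule eventually_at_top_linorderI[of "sqrt 3 * ?a"])
      fix y assume y: "sqrt 3 * ?a \<le> y"
      have "0 < sqrt 3 * ?a" using c by simp
      then have y0: "0 < y" using y by linarith
      have "cmod (P (Complex (\<bar>e * y\<bar> / sqrt 3) (e * y)) - P (Complex ?a (e * y)))
          \<le> \<bar>e * y\<bar> * exp (2 * cmod x * \<bar>e * y\<bar> - 8 / 9 * ?a * (e * y) ^ 2)"
        by (intro airy_horizontal P c) (use y y0 e in \<open>auto simp: abs_mult\<close>)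
      moreover have "\<bar>e * y\<bar> = y" "(e * y) ^ 2 = y ^ 2"
        using e e2 y0 by (auto simp: abs_mult power2_eq_square power_mult_distrib)
      ultimately show "cmod ((P (Complex ?a (e * y)) - P 0) - (P (Complex (y / sqrt 3) (e * y)) - P 0))
          \<le> \<bar>y\<bar> * exp (2 * cmod x * \<bar>y\<bar> - 8 / 9 * ?a * y ^ 2)"
        using y0 by (simp add: norm_minus_commute)
    qed
  qed
  \<comment> \<open>For non-real \<open>c\<close> the two end points lie at heights S + Im c and -(S
    - Im c), so the two limits are taken in shifted variables.\<close>
  have "((\<lambda>S. P (Complex ?a (1 * (S + Im c))) - P 0) \<longlongrightarrow> airy_ray (cis (pi / 3)) x) at_top"
    by (rule filterlim_compose[OF *[OF cis_pi_third(1)]]) (simp, real_asymp)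
  moreover have "((\<lambda>S. P (Complex ?a (-1 * (S - Im c))) - P 0) \<longlongrightarrow> airy_ray (cis (- pi / 3)) x) at_top"
    by (rule filterlim_compose[OF *[OF cis_pi_third(2)]]) (simp, real_asymp)
  ultimately have "((\<lambda>S. (P (Complex ?a (1 * (S + Im c))) - P 0) - (P (Complex ?a (-1 * (S - Im c))) - P 0))
      \<longlongrightarrow> airy_ray (cis (pi / 3)) x - airy_ray (cis (- pi / 3)) x) at_top"
    by (rule tendsto_diff)
  moreover have "airy_ray (cis (pi / 3)) x - airy_ray (cis (- pi / 3)) x = 2 * of_real pi * \<i> * Ai x"
    by (simp add: Ai_def)
  moreover have "Complex ?a (1 * (S + Im c)) = c + of_real S * \<i>"
    "Complex ?a (-1 * (S - Im c)) = c - of_real S * \<i>" for S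
    by (auto simp: complex_eq_iff)
  ultimately show ?thesis by simp
qed

section \<open>Gaussian integrals with complex parameter\<close>

lemma real_gaussian: "((\<lambda>T. integral {0..T} (\<lambda>s. exp (- s\<^sup>2))) \<longlongrightarrow> sqrt pi / 2) at_top"
proof -
  let ?f = "\<lambda>x::real. indicator {0..} x *\<^sub>R exp (- x\<^sup>2)"
  have "((\<lambda>y. \<integral>x. indicator {..y} x *\<^sub>R ?f x \<partial>lborel) \<longlongrightarrow> \<integral>x. ?f x \<partial>lborel) at_top"
    by (intro tendsto_integral_at_top) (use gaussian_moment_0 in \<open>auto simp: has_bochner_integral_iff\<close>)
  moreover have "(\<integral>x. ?f x \<partial>lborel) = sqrt pi / 2"
    using gaussian_moment_0 by (simp add: has_bochner_integral_iff)
  moreover have "(\<integral>x. indicator {..y} x *\<^sub>R ?f x \<partial>lborel) = integral {0..y} (\<lambda>s. exp (- s\<^sup>2))" for y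
  proof -
    have "(\<integral>x. indicator {..y} x *\<^sub>R ?f x \<partial>lborel) = (LINT s:{0..y}|lborel. exp (- s\<^sup>2))"
      unfolding set_lebesgue_integral_def
      by (intro Bochner_Integration.integral_cong) (auto simp: indicator_def)
    also have "\<dots> = integral {0..y} (\<lambda>s. exp (- s\<^sup>2))"
      by (intro set_borel_integral_eq_integral borel_integrable_atLeastAtMost') (intro continuous_intros)
    finally show ?thesis .
  qed
  ultimately show ?thesis by (simp only:)
qed

text \<open>With g = \<open>csqrt c\<close> the integral is that of exp(-z^2) over the segment from
  -S g to S g, divided by g. Rotating it to the real axis costs the vertical segments between S Re g
  and S g. There Re (z^2) is at least S^2 ((Re g)^2 - (Im g)^2) = S^2 Re c, which is
  positive.\<close>

lemma complex_gaussian: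
  assumes c: "0 < Re c"
  shows "((\<lambda>S. integral {- S..S} (\<lambda>s. exp (- c * of_real s ^ 2))) \<longlongrightarrow> of_real (sqrt pi) / csqrt c) at_top"
proof -
  define g where "g = csqrt c"
  obtain Q :: "complex \<Rightarrow> complex" where Q: "\<And>z. (Q has_field_derivative exp (- (z ^ 2))) (at z)"
    by (rule entire_primitive[of "\<lambda>z. exp (- (z ^ 2))"]) (auto intro!: holomorphic_intros)
  have g2: "g ^ 2 = c" by (simp add: g_def)
  have g0: "g \<noteq> 0" using c by (auto simp: g_def)
  have reg: "Re c = Re g ^ 2 - Im g ^ 2" by (simp add: g2[symmetric] Re_power2)
  have "Re g \<noteq> 0" using c reg zero_le_power2[of "Im g"] by auto
  then have p: "0 < Re g" using csqrt_principal[of c] by (auto simp: g_def)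
  define K where "K = (\<lambda>T::real. integral {0..T} (\<lambda>s. exp (- s\<^sup>2)))"
  have QK: "Q (of_real T) - Q (- of_real T) = of_real (2 * K T)" if T: "T \<ge> 0" for T
  proof -
    have "(Q (of_real T) - Q 0) = of_real (K T)"
    proof -
      have "((\<lambda>s. exp (- (of_real s ^ 2))) has_integral (Q (of_real T) - Q 0)) {0..T}"
        using primitive_line_integral[OF Q T, of 1 0] by simp
      moreover have "((\<lambda>s. exp (- s\<^sup>2)) has_integral K T) {0..T}"
        unfolding K_def by (intro integrable_integral integrable_continuous_real continuous_intros)
      then have "((\<lambda>s. of_real (exp (- s\<^sup>2)) :: complex) has_integral of_real (K T)) {0..T}"
        by (rule has_integral_of_real)
      then have "((\<lambda>s. exp (- (of_real s ^ 2)) :: complex) has_integral of_real (K T)) {0..T}"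
        by (simp add: exp_of_real[symmetric])
      ultimately show ?thesis by (rule has_integral_unique)
    qed
    moreover have "(Q (- of_real T) - Q 0) = - of_real (K T)"
    proof -
      have "((\<lambda>s. - exp (- (of_real s ^ 2))) has_integral (Q (- of_real T) - Q 0)) {0..T}"
        using primitive_line_integral[OF Q T, of "-1" 0] by simp
      moreover have "((\<lambda>s. exp (- s\<^sup>2)) has_integral K T) {0..T}"
        unfolding K_def by (intro integrable_integral integrable_continuous_real continuous_intros)
      then have "((\<lambda>s. of_real (exp (- s\<^sup>2)) :: complex) has_integral of_real (K T)) {0..T}"
        by (rule has_integral_of_real)
      then have "((\<lambda>s. exp (- (of_real s ^ 2)) :: complex) has_integral of_real (K T)) {0..T}"
        by (simp add: exp_of_real[symmetric])
      then have "((\<lambda>s. - exp (- (of_real s ^ 2)) :: complex) has_integral - of_real (K T)) {0..T}"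
        by (rule has_integral_neg)
      ultimately show ?thesis by (rule has_integral_unique)
    qed
    ultimately show ?thesis by (simp add: algebra_simps)
  qed
  have "((\<lambda>S. 2 * K (Re g * S)) \<longlongrightarrow> 2 * (sqrt pi / 2)) at_top"
    unfolding K_def
    by (intro tendsto_intros filterlim_compose[OF real_gaussian] filterlim_tendsto_pos_mult_at_top[OF tendsto_const p] filterlim_ident)
  then have l1: "((\<lambda>S. of_real (2 * K (Re g * S))) \<longlongrightarrow> (of_real (sqrt pi) :: complex)) at_top"
    by (intro tendsto_of_real) simp
  have lim0: "((\<lambda>S. 2 * (\<bar>Im g\<bar> * S * exp (- (Re c) * S ^ 2))) \<longlongrightarrow> 0) at_top"
    using c by (cases "Im g = 0") (simp, real_asymp)
  have vert: "cmod (Q (of_real S * g) - Q (of_real (S * Re g))) \<le> \<bar>Im g\<bar> * \<bar>S\<bar> * exp (- (Re c) * S ^ 2)" for S :: real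
  proof -
    have "cmod (Q (of_real S * g) - Q (of_real (S * Re g))) \<le> exp (- (Re c) * S ^ 2) * cmod (of_real S * g - of_real (S * Re g))"
    proof (rule primitive_segment_bound[OF Q])
      fix t assume "t \<in> closed_segment (complex_of_real (S * Re g)) (of_real S * g)"
      then have t: "Re t = S * Re g" "Im t \<in> closed_segment 0 (S * Im g)"
        by (auto simp: closed_segment_same_Re)
      then have "\<bar>Im t\<bar> \<le> \<bar>S * Im g\<bar>" by (auto simp: closed_segment_eq_real_ivl split: if_splits)
      then have "(Im t)\<^sup>2 \<le> (S * Im g)\<^sup>2" by (simp add: abs_le_square_iff)
      then have "Re (- (t ^ 2)) \<le> - (Re c) * S ^ 2"
        using t by (simp add: Re_power2 reg algebra_simps power_mult_distrib)
      then show "cmod (exp (- (t ^ 2))) \<le> exp (- (Re c) * S ^ 2)" by simp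
    qed
    also have "of_real S * g - of_real (S * Re g) = \<i> * of_real (S * Im g)" by (simp add: complex_eq_iff)
    finally show ?thesis by (simp add: norm_mult abs_mult algebra_simps)
  qed
  have "((\<lambda>S. Q (of_real S * g) - Q (- (of_real S * g))) \<longlongrightarrow> of_real (sqrt pi)) at_top"
  proof (rule Lim_transform[OF l1], rule Lim_null_comparison[OF _ lim0], rule eventually_at_top_linorderI[of 0])
    fix S :: real assume S: "0 \<le> S"
    have "cmod ((Q (of_real S * g) - Q (- (of_real S * g))) - of_real (2 * K (Re g * S)))
      = cmod ((Q (of_real S * g) - Q (of_real (S * Re g))) - (Q (of_real (- S) * g) - Q (of_real (- S * Re g))))"
      using QK[of "S * Re g"] S p by (simp add: algebra_simps)
    also have "\<dots> \<le> \<bar>Im g\<bar> * \<bar>S\<bar> * exp (- (Re c) * S ^ 2) + \<bar>Im g\<bar> * \<bar>- S\<bar> * exp (- (Re c) * (- S) ^ 2)"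
      by (intro order_trans[OF norm_triangle_ineq4] add_mono vert)
    finally show "cmod ((Q (of_real S * g) - Q (- (of_real S * g))) - of_real (2 * K (Re g * S)))
       \<le> 2 * (\<bar>Im g\<bar> * S * exp (- (Re c) * S ^ 2))" using S by (simp add: mult_ac)
  qed
  then have "((\<lambda>S. (Q (of_real S * g) - Q (- (of_real S * g))) / g) \<longlongrightarrow> of_real (sqrt pi) / g) at_top"
    using g0 by (intro tendsto_intros)
  then show ?thesis unfolding g_def[symmetric]
  proof (rule Lim_transform_eventually, intro eventually_at_top_linorderI[of 0])
    fix S :: real assume S: "0 \<le> S"
    have "((\<lambda>s. g * exp (- ((of_real s * g) ^ 2))) has_integral (Q (of_real S * g) - Q (- (of_real S * g)))) {- S..S}"
      using primitive_line_integral[OF Q, of "- S" S g 0] S by simp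
    then have "((\<lambda>s. inverse g * (g * exp (- ((of_real s * g) ^ 2)))) has_integral
        inverse g * (Q (of_real S * g) - Q (- (of_real S * g)))) {- S..S}"
      by (rule has_integral_mult_right)
    then have "((\<lambda>s. exp (- c * of_real s ^ 2)) has_integral (Q (of_real S * g) - Q (- (of_real S * g))) / g) {- S..S}"
      using g0 by (simp add: power_mult_distrib g2 field_simps)
    then show "(Q (of_real S * g) - Q (- (of_real S * g))) / g = integral {- S..S} (\<lambda>s. exp (- c * of_real s ^ 2))"
      by (simp add: integral_unique)
  qed
qed


lemma cmod_exp_i_minus_1_le: "cmod (exp (\<i> * of_real t) - 1) \<le> \<bar>t\<bar>"
proof -
  have "cmod (exp (\<i> * of_real t) - exp 0) \<le> 1 * cmod (\<i> * of_real t - 0)"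
  proof (rule primitive_segment_bound)
    fix z assume "z \<in> closed_segment 0 (\<i> * complex_of_real t)"
    then have "Re z = 0" by (auto simp: closed_segment_same_Re)
    then show "cmod (exp z) \<le> 1" by simp
  qed (rule DERIV_exp)
  then show ?thesis by (simp add: norm_mult)
qed

text \<open>This moment is the price of dropping the phase exp(-i s^3/3). The integrand has an
  elementary primitive on each half line, and each half contributes at most 1/(6 \<alpha>^2),
  whatever \<open>S\<close> is.\<close>

lemma cubic_gaussian_moment:
  fixes \<alpha> :: real
  assumes \<alpha>: "0 < \<alpha>" and S: "0 \<le> S"
  shows "(\<lambda>s. exp (- \<alpha> * s ^ 2) * (\<bar>s\<bar> ^ 3 / 3)) integrable_on {- S..S}"
    and "integral {- S..S} (\<lambda>s. exp (- \<alpha> * s ^ 2) * (\<bar>s\<bar> ^ 3 / 3)) \<le> 1 / (3 * \<alpha> ^ 2)"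
proof -
  define G where "G = (\<lambda>s::real. - (1 + \<alpha> * s ^ 2) * exp (- \<alpha> * s ^ 2) / (6 * \<alpha> ^ 2))"
  have G: "(G has_vector_derivative exp (- \<alpha> * s ^ 2) * (s ^ 3 / 3)) (at s within T)" for s T
    unfolding G_def has_real_derivative_iff_has_vector_derivative[symmetric] using \<alpha>
    by (auto intro!: derivative_eq_intros simp: field_simps power2_eq_square power3_eq_cube)
  have r: "((\<lambda>s. exp (- \<alpha> * s ^ 2) * (\<bar>s\<bar> ^ 3 / 3)) has_integral (G S - G 0)) {0..S}"
    using fundamental_theorem_of_calculus[OF S G]
    by (rule has_integral_eq[rotated]) auto
  have "((\<lambda>s. exp (- \<alpha> * s ^ 2) * (s ^ 3 / 3)) has_integral (G 0 - G (- S))) {- S..0}"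
    using fundamental_theorem_of_calculus[OF _ G] S by simp
  then have "((\<lambda>s. - (exp (- \<alpha> * s ^ 2) * (s ^ 3 / 3))) has_integral - (G 0 - G (- S))) {- S..0}"
    by (rule has_integral_neg)
  then have l: "((\<lambda>s. exp (- \<alpha> * s ^ 2) * (\<bar>s\<bar> ^ 3 / 3)) has_integral - (G 0 - G (- S))) {- S..0}"
    by (rule has_integral_eq[rotated]) (auto simp: power3_eq_cube)
  have I: "((\<lambda>s. exp (- \<alpha> * s ^ 2) * (\<bar>s\<bar> ^ 3 / 3)) has_integral (- (G 0 - G (- S)) + (G S - G 0))) {- S..S}"
    by (rule has_integral_combine[OF _ _ l r]) (use S in auto)
  then show "(\<lambda>s. exp (- \<alpha> * s ^ 2) * (\<bar>s\<bar> ^ 3 / 3)) integrable_on {- S..S}" by blast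
  have "- (G 0 - G (- S)) + (G S - G 0) \<le> 1 / (3 * \<alpha> ^ 2)"
    using \<alpha> S by (simp add: G_def field_simps)
  then show "integral {- S..S} (\<lambda>s. exp (- \<alpha> * s ^ 2) * (\<bar>s\<bar> ^ 3 / 3)) \<le> 1 / (3 * \<alpha> ^ 2)"
    unfolding integral_unique[OF I] .
qed

text \<open>Shifting the contour to the vertical line through the saddle point \<open>c\<close> gives
  \<open>2 \<pi> exp (2/3 c^3) Ai (c^2) = \<integral> exp (- c s^2 - i s^3 / 3) ds\<close>.\<close>

lemma Ai_estimate:
  assumes c: "0 < Re c"
  shows "cmod (2 * of_real pi * exp (2 / 3 * c ^ 3) * Ai (c ^ 2) - of_real (sqrt pi) / csqrt c) \<le> 1 / (3 * Re c ^ 2)"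
proof -
  define f where "f = (\<lambda>t::complex. exp (t ^ 3 / 3 - c ^ 2 * t))"
  have hol: "f holomorphic_on UNIV" unfolding f_def by (intro holomorphic_intros) auto
  obtain P :: "complex \<Rightarrow> complex" where P: "\<And>t. (P has_field_derivative f t) (at t)"
    by (rule entire_primitive[OF hol]) blast
  define D where "D = (\<lambda>S::real. integral {- S..S} (\<lambda>s. exp (- c * of_real s ^ 2 - \<i> * of_real (s ^ 3) / 3)))"
  define G where "G = (\<lambda>S::real. integral {- S..S} (\<lambda>s. exp (- c * of_real s ^ 2)))"
  have D: "exp (2 / 3 * c ^ 3) / \<i> * (P (c + of_real S * \<i>) - P (c - of_real S * \<i>)) = D S" if S: "0 \<le> S" for S
  proof -
    have "((\<lambda>s. \<i> * f (c + of_real s * \<i>)) has_integral (P (c + of_real S * \<i>) - P (c - of_real S * \<i>))) {- S..S}"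
      using primitive_line_integral[OF P, of "- S" S \<i> c] S by simp
    then have "((\<lambda>s. exp (2 / 3 * c ^ 3) / \<i> * (\<i> * f (c + of_real s * \<i>))) has_integral
        exp (2 / 3 * c ^ 3) / \<i> * (P (c + of_real S * \<i>) - P (c - of_real S * \<i>))) {- S..S}"
      by (rule has_integral_mult_right)
    moreover have "exp (2 / 3 * c ^ 3) / \<i> * (\<i> * f (c + of_real s * \<i>)) = exp (- c * of_real s ^ 2 - \<i> * of_real (s ^ 3) / 3)" for s
    proof -
      have "2 / 3 * c ^ 3 + ((c + of_real s * \<i>) ^ 3 / 3 - c ^ 2 * (c + of_real s * \<i>)) = - c * of_real s ^ 2 - \<i> * of_real (s ^ 3) / 3"
        by (simp add: power3_eq_cube power2_eq_square field_simps)
      then have "exp (2 / 3 * c ^ 3) * f (c + of_real s * \<i>) = exp (- c * of_real s ^ 2 - \<i> * of_real (s ^ 3) / 3)"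
        by (simp only: f_def mult_exp_exp)
      then show ?thesis by (simp add: field_simps)
    qed
    ultimately show ?thesis unfolding D_def by (intro integral_unique[symmetric]) simp
  qed
  have "((\<lambda>S. exp (2 / 3 * c ^ 3) / \<i> * (P (c + of_real S * \<i>) - P (c - of_real S * \<i>))) \<longlongrightarrow>
      exp (2 / 3 * c ^ 3) / \<i> * (2 * of_real pi * \<i> * Ai (c ^ 2))) at_top"
    by (intro tendsto_intros airy_contour_shift c) (use P in \<open>simp_all add: f_def\<close>)
  then have "((\<lambda>S. exp (2 / 3 * c ^ 3) / \<i> * (P (c + of_real S * \<i>) - P (c - of_real S * \<i>))) \<longlongrightarrow>
      2 * of_real pi * exp (2 / 3 * c ^ 3) * Ai (c ^ 2)) at_top"
    by (rule back_subst[of "\<lambda>l. (_ \<longlongrightarrow> l) at_top"]) (simp add: field_simps)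
  then have limD: "(D \<longlongrightarrow> 2 * of_real pi * exp (2 / 3 * c ^ 3) * Ai (c ^ 2)) at_top"
    by (rule Lim_transform_eventually) (use D in \<open>auto intro: eventually_at_top_linorderI[of 0]\<close>)
  have limG: "(G \<longlongrightarrow> of_real (sqrt pi) / csqrt c) at_top"
    unfolding G_def by (rule complex_gaussian[OF c])
  have bound: "cmod (D S - G S) \<le> 1 / (3 * Re c ^ 2)" if S: "0 \<le> S" for S
  proof -
    have "D S - G S = integral {- S..S} (\<lambda>s. exp (- c * of_real s ^ 2 - \<i> * of_real (s ^ 3) / 3) - exp (- c * of_real s ^ 2))"
      unfolding D_def G_def
      by (intro Henstock_Kurzweil_Integration.integral_diff[symmetric] integrable_continuous_real continuous_intros) auto
    also have "cmod \<dots> \<le> integral {- S..S} (\<lambda>s. exp (- Re c * s ^ 2) * (\<bar>s\<bar> ^ 3 / 3))"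
    proof (rule integral_norm_bound_integral)
      show "(\<lambda>s. exp (- c * of_real s ^ 2 - \<i> * of_real (s ^ 3) / 3) - exp (- c * of_real s ^ 2)) integrable_on {- S..S}"
        by (intro integrable_continuous_real continuous_intros) auto
      fix s :: real
      have "exp (- c * of_real s ^ 2 - \<i> * of_real (s ^ 3) / 3) - exp (- c * of_real s ^ 2)
          = exp (- c * of_real s ^ 2) * (exp (\<i> * of_real (- (s ^ 3) / 3)) - 1)"
        by (simp add: algebra_simps mult_exp_exp)
      then have "cmod (exp (- c * of_real s ^ 2 - \<i> * of_real (s ^ 3) / 3) - exp (- c * of_real s ^ 2))
          = exp (- Re c * s ^ 2) * cmod (exp (\<i> * of_real (- (s ^ 3) / 3)) - 1)"
        by (simp only: norm_mult norm_exp_eq_Re) (simp flip: of_real_power)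
      also have "\<dots> \<le> exp (- Re c * s ^ 2) * \<bar>- (s ^ 3) / 3\<bar>"
        by (intro mult_left_mono cmod_exp_i_minus_1_le) auto
      finally show "cmod (exp (- c * of_real s ^ 2 - \<i> * of_real (s ^ 3) / 3) - exp (- c * of_real s ^ 2))
          \<le> exp (- Re c * s ^ 2) * (\<bar>s\<bar> ^ 3 / 3)" by (simp add: power_abs)
    qed (rule cubic_gaussian_moment[OF c S])
    also have "\<dots> \<le> 1 / (3 * Re c ^ 2)" by (rule cubic_gaussian_moment[OF c S])
    finally show ?thesis .
  qed
  show ?thesis
    by (rule tendsto_upperbound[OF tendsto_norm[OF tendsto_diff[OF limD limG]]])
      (use bound in \<open>auto intro: eventually_at_top_linorderI[of 0]\<close>)
qed

text \<open>The sector \<open>cmod c \<le> 4 * Re c\<close> contains |arg c| \<le> pi/3 with room to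
  spare, as needed for the rotated functions \<open>Ai_rot\<close>. The derivative needs no second
  saddle point integral: the error term \<open>E\<close> is holomorphic, so its derivative is
  controlled by Cauchy's inequality.\<close>

lemma Ai_asymptotics:
  assumes inf: "filterlim c at_infinity F" and sec: "\<forall>\<^sub>F x in F. cmod (c x) \<le> 4 * Re (c x)"
  shows "((\<lambda>x. csqrt (c x) * exp (2 / 3 * c x ^ 3) * Ai (c x ^ 2)) \<longlongrightarrow> of_real (1 / (2 * sqrt pi))) F"
    and "((\<lambda>x. exp (2 / 3 * c x ^ 3) * deriv Ai (c x ^ 2) / csqrt (c x)) \<longlongrightarrow> - of_real (1 / (2 * sqrt pi))) F"
proof -
  define k where "k = (\<lambda>z. exp (2 / 3 * z ^ 3) * Ai (z ^ 2))"
  define E where "E = (\<lambda>z. 2 * of_real pi * k z - of_real (sqrt pi) / csqrt z)"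
  have E_le: "cmod (E z) \<le> 1 / (3 * Re z ^ 2)" if "0 < Re z" for z
    using Ai_estimate[OF that] by (simp add: E_def k_def mult.assoc)
  have nz: "csqrt z \<noteq> 0" if "0 < Re z" for z using that by auto
  have nonneg: "z \<notin> \<real>\<^sub>\<le>\<^sub>0" if "0 < Re z" for z :: complex
    using that by (auto simp: complex_nonpos_Reals_iff)
  have dA: "(Ai has_field_derivative deriv Ai z) (at z)" for z
    using Ai_entire holomorphic_derivI open_UNIV by blast
  have dk: "(k has_field_derivative exp (2 / 3 * z ^ 3) * (2 * z ^ 2 * Ai (z ^ 2) + 2 * z * deriv Ai (z ^ 2))) (at z)" for z
    unfolding k_def
    by (auto intro!: derivative_eq_intros DERIV_chain2[OF dA] simp: algebra_simps power2_eq_square power3_eq_cube)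
  define k' where "k' = (\<lambda>z. exp (2 / 3 * z ^ 3) * (2 * z ^ 2 * Ai (z ^ 2) + 2 * z * deriv Ai (z ^ 2)))"
  have dE: "(E has_field_derivative 2 * of_real pi * k' z + of_real (sqrt pi) / (2 * z * csqrt z)) (at z)" if "0 < Re z" for z
    unfolding E_def k'_def using nonneg[OF that] nz[OF that] power2_csqrt[of z]
    by (auto intro!: derivative_eq_intros dk simp: field_simps power2_eq_square)
  \<comment> \<open>On the disc of radius Re z / 2 about z all real parts are at least Re z / 2, so
    differentiation costs only a factor of order 1 / Re z.\<close>
  have E'_le: "cmod (2 * of_real pi * k' z + of_real (sqrt pi) / (2 * z * csqrt z)) \<le> 8 / (3 * Re z ^ 3)" if z: "0 < Re z" for z
  proof -
    let ?r = "Re z / 2"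
    have pos: "Re z / 2 \<le> Re y" if "y \<in> cball z ?r" for y
      using that abs_Re_le_cmod[of "z - y"] by (auto simp: dist_norm)
    have "cmod ((deriv ^^ 1) E z) \<le> fact 1 * (4 / (3 * Re z ^ 2)) / ?r ^ 1"
    proof (rule Cauchy_inequality)
      show "E holomorphic_on ball z ?r"
        using dE pos z by (intro holomorphic_onI) (meson ball_subset_cball field_differentiable_at_within field_differentiable_def half_gt_zero less_le_trans subsetD)
      show "continuous_on (cball z ?r) E"
        using dE pos z by (intro continuous_at_imp_continuous_on ballI) (meson DERIV_isCont half_gt_zero less_le_trans)
      show "0 < ?r" using z by simp
      fix y assume "cmod (z - y) = ?r"
      then have y: "Re z / 2 \<le> Re y" using pos[of y] by (simp add: dist_norm)
      then have "cmod (E y) \<le> 1 / (3 * Re y ^ 2)" using z by (intro E_le) linarith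
      also have "\<dots> \<le> 1 / (3 * (Re z / 2) ^ 2)"
        using y z by (intro divide_left_mono mult_left_mono power_mono mult_pos_pos) auto
      finally show "cmod (E y) \<le> 4 / (3 * Re z ^ 2)" by (simp add: power_divide)
    qed
    then show ?thesis using DERIV_imp_deriv[OF dE[OF z]] by (simp add: power2_eq_square power3_eq_cube)
  qed
  have "filterlim (\<lambda>x. cmod (c x)) at_top F" using inf filterlim_norm_at_top filterlim_compose by blast
  moreover have quarter: "LIM r at_top. r / 4 :> (at_top :: real filter)" by real_asymp
  moreover have "\<forall>\<^sub>F x in F. cmod (c x) / 4 \<le> Re (c x)" using sec by eventually_elim simp
  ultimately have re: "filterlim (\<lambda>x. Re (c x)) at_top F"
    using filterlim_at_top_mono[of "\<lambda>x. cmod (c x) / 4" F "\<lambda>x. Re (c x)"]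
    by (metis filterlim_compose[OF quarter])
  have pos: "\<forall>\<^sub>F x in F. 0 < Re (c x)" using re by (simp add: filterlim_at_top_dense)
  have l1: "((\<lambda>x. csqrt (c x) * E (c x)) \<longlongrightarrow> 0) F"
  proof (rule Lim_null_comparison)
    show "\<forall>\<^sub>F x in F. cmod (csqrt (c x) * E (c x)) \<le> 2 * sqrt (Re (c x)) / (3 * Re (c x) ^ 2)"
      using pos sec
    proof eventually_elim
      case (elim x)
      have "sqrt (cmod (c x)) \<le> sqrt (4 * Re (c x))" using elim by simp
      then have "cmod (csqrt (c x)) \<le> 2 * sqrt (Re (c x))" by (simp add: real_sqrt_mult)
      then have "cmod (csqrt (c x)) * cmod (E (c x)) \<le> (2 * sqrt (Re (c x))) * (1 / (3 * Re (c x) ^ 2))"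
        using elim E_le by (intro mult_mono) auto
      then show ?case by (simp add: norm_mult)
    qed
    have "((\<lambda>r. 2 * sqrt r / (3 * r ^ 2)) \<longlongrightarrow> 0) at_top" by real_asymp
    then show "((\<lambda>x. 2 * sqrt (Re (c x)) / (3 * Re (c x) ^ 2)) \<longlongrightarrow> 0) F"
      by (rule filterlim_compose[OF _ re])
  qed
  have "((\<lambda>x. (csqrt (c x) * E (c x) + of_real (sqrt pi)) / (2 * of_real pi)) \<longlongrightarrow> (0 + of_real (sqrt pi)) / (2 * of_real pi)) F"
    by (intro tendsto_intros l1) auto
  moreover have "\<forall>\<^sub>F x in F. (csqrt (c x) * E (c x) + of_real (sqrt pi)) / (2 * of_real pi) = csqrt (c x) * k (c x)"
    using pos by eventually_elim (use nz in \<open>simp add: E_def field_simps\<close>)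
  ultimately have "((\<lambda>x. csqrt (c x) * k (c x)) \<longlongrightarrow> (0 + of_real (sqrt pi)) / (2 * of_real pi)) F"
    by (rule Lim_transform_eventually)
  moreover have "(0 + of_real (sqrt pi)) / (2 * of_real pi) = complex_of_real (1 / (2 * sqrt pi))"
  proof -
    have "sqrt pi / (2 * pi) = 1 / (2 * sqrt pi)"
      using real_sqrt_mult_self[of pi] by (simp add: divide_simps)
    then have "complex_of_real (sqrt pi / (2 * pi)) = of_real (1 / (2 * sqrt pi))" by (rule arg_cong)
    then show ?thesis by simp
  qed
  ultimately have lk: "((\<lambda>x. csqrt (c x) * k (c x)) \<longlongrightarrow> of_real (1 / (2 * sqrt pi))) F" by simp
  then show "((\<lambda>x. csqrt (c x) * exp (2 / 3 * c x ^ 3) * Ai (c x ^ 2)) \<longlongrightarrow> of_real (1 / (2 * sqrt pi))) F"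
    by (simp add: k_def mult.assoc)
  have l2: "((\<lambda>x. k' (c x) / (2 * c x * csqrt (c x))) \<longlongrightarrow> 0) F"
  proof (rule Lim_null_comparison)
    show "\<forall>\<^sub>F x in F. cmod (k' (c x) / (2 * c x * csqrt (c x))) \<le> (8 / (3 * Re (c x) ^ 3) + sqrt pi / (2 * Re (c x) * sqrt (Re (c x)))) / (2 * pi) / (2 * Re (c x) * sqrt (Re (c x)))"
      using pos
    proof eventually_elim
      case (elim x)
      let ?z = "c x" and ?r = "Re (c x)"
      have rc: "?r \<le> cmod ?z" by (rule complex_Re_le_cmod)
      have d: "2 * ?r * sqrt ?r \<le> cmod (2 * ?z * csqrt ?z)"
        using elim rc by (auto simp: norm_mult intro!: mult_mono)
      have d0: "0 < 2 * ?r * sqrt ?r" using elim by simp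
      let ?u = "2 * of_real pi * k' ?z" and ?v = "of_real (sqrt pi) / (2 * ?z * csqrt ?z)"
      have "cmod ?u \<le> cmod (?u + ?v) + cmod ?v"
        using norm_triangle_ineq4[of "?u + ?v" ?v] by simp
      also have "cmod (?u + ?v) \<le> 8 / (3 * ?r ^ 3)" by (rule E'_le[OF elim])
      finally have "cmod ?u \<le> 8 / (3 * ?r ^ 3) + cmod ?v" by simp
      also have "cmod (of_real (sqrt pi) / (2 * ?z * csqrt ?z)) \<le> sqrt pi / (2 * ?r * sqrt ?r)"
        unfolding norm_divide using d d0 by (intro frac_le) auto
      finally have kk: "cmod (k' ?z) \<le> (8 / (3 * ?r ^ 3) + sqrt pi / (2 * ?r * sqrt ?r)) / (2 * pi)"
        by (simp add: norm_mult field_simps)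
      then show ?case unfolding norm_divide[of "k' ?z"]
        using order_trans[OF norm_ge_zero kk] d d0 by (intro frac_le) auto
    qed
    have "((\<lambda>r. (8 / (3 * r ^ 3) + sqrt pi / (2 * r * sqrt r)) / (2 * pi) / (2 * r * sqrt r)) \<longlongrightarrow> 0) at_top"
      by real_asymp
    then show "((\<lambda>x. (8 / (3 * Re (c x) ^ 3) + sqrt pi / (2 * Re (c x) * sqrt (Re (c x)))) / (2 * pi) / (2 * Re (c x) * sqrt (Re (c x)))) \<longlongrightarrow> 0) F"
      by (rule filterlim_compose[OF _ re])
  qed
  \<comment> \<open>By the product rule \<open>k'\<close> contains 2 z^2 Ai + 2 z Ai'. Divided by 2
    z sqrt z it tends to 0, so the Ai' term must balance the Ai term; this is where the minus sign
    comes from.\<close>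
  have lim: "((\<lambda>x. k' (c x) / (2 * c x * csqrt (c x)) - csqrt (c x) * k (c x)) \<longlongrightarrow> 0 - of_real (1 / (2 * sqrt pi))) F"
    by (intro tendsto_intros l2 lk)
  have eq: "\<forall>\<^sub>F x in F. k' (c x) / (2 * c x * csqrt (c x)) - csqrt (c x) * k (c x)
      = exp (2 / 3 * c x ^ 3) * deriv Ai (c x ^ 2) / csqrt (c x)"
    using pos
  proof eventually_elim
    case (elim x)
    define g where "g = csqrt (c x)"
    have g: "csqrt (c x) = g" "c x = g ^ 2" "g \<noteq> 0" using nz[OF elim] by (simp_all add: g_def)
    have "e * (2 * (g ^ 2) ^ 2 * a + 2 * g ^ 2 * b) / (2 * g ^ 2 * g) - g * (e * a) = e * b / g" for a b e
      using g(3) by (simp add: field_simps power2_eq_square)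
    then show ?case unfolding k'_def k_def g(1) unfolding g(2) .
  qed
  show "((\<lambda>x. exp (2 / 3 * c x ^ 3) * deriv Ai (c x ^ 2) / csqrt (c x)) \<longlongrightarrow> - of_real (1 / (2 * sqrt pi))) F"
    by (rule Lim_transform_eventually[OF lim[unfolded diff_0] eq])
qed

section \<open>Recessive solutions\<close>

lemma Re_of_real_times: "Re (of_real r * z) = r * Re z"
  by simp

lemma complex_i_mult_minus: "\<i> * (- \<i> * z) = z"
  by (simp add: mult.assoc[symmetric])

section \<open>Identity and uniqueness arguments on the closed upper half plane without 0\<close>

lemma Cplus_iff: "z \<in> Cplus \<longleftrightarrow> z \<noteq> 0 \<and> 0 \<le> Im z"
  unfolding Cplus_def using Arg_less_0[of z] Arg_bounded[of z] by auto

lemma of_real_in_Cplus [simp]: "complex_of_real x \<in> Cplus \<longleftrightarrow> x \<noteq> 0"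
  by (simp add: Cplus_iff)

lemma vertical_segment_Cplus:
  assumes "z \<in> Cplus"
  shows "closed_segment z (z + \<i>) \<subseteq> Cplus"
proof
  fix w assume "w \<in> closed_segment z (z + \<i>)"
  then have w: "Re w = Re z" "Im w \<in> closed_segment (Im z) (Im z + 1)"
    by (auto simp: closed_segment_same_Re)
  then have "Im z \<le> Im w" by (auto simp: closed_segment_eq_real_ivl split: if_splits)
  with w(1) assms show "w \<in> Cplus" by (auto simp: Cplus_iff complex_eq_iff)
qed

text \<open>\<open>Cplus\<close> is neither open nor convex. The open half plane is convex, and each
  boundary point is tied to it by a vertical segment inside \<open>Cplus\<close>.\<close>

lemma constant_on_Cplus:
  fixes f :: "complex \<Rightarrow> complex"
  assumes "\<And>z. z \<in> Cplus \<Longrightarrow> (f has_field_derivative 0) (at z)"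
  obtains C where "\<And>z. z \<in> Cplus \<Longrightarrow> f z = C"
proof -
  have "\<exists>C. \<forall>z\<in>{z. 0 < Im z}. f z = C"
    by (rule has_field_derivative_zero_constant)
      (auto simp: convex_halfspace_Im_gt Cplus_iff intro!: has_field_derivative_at_within assms)
  then obtain C where C: "\<And>z. 0 < Im z \<Longrightarrow> f z = C" by auto
  have "f z = C" if z: "z \<in> Cplus" for z
  proof -
    have "\<exists>c. \<forall>w\<in>closed_segment z (z + \<i>). f w = c"
      by (rule has_field_derivative_zero_constant)
        (use vertical_segment_Cplus[OF z] in \<open>auto intro!: has_field_derivative_at_within assms\<close>)
    then have "f z = f (z + \<i>)" by (metis ends_in_segment)
    also have "\<dots> = C" using z by (intro C) (simp add: Cplus_iff)
    finally show ?thesis .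
  qed
  then show ?thesis using that by blast
qed

lemma analytic_on_DERIV:
  assumes "f analytic_on S" "z \<in> S"
  shows "(f has_field_derivative deriv f z) (at z)"
  using assms analytic_at_imp_isCont analytic_on_imp_differentiable_at DERIV_deriv_iff_field_differentiable by blast

text \<open>The equation has no first order term, so the derivative of the Wronskian
  cancels.\<close>

lemma LG_wronskian:
  assumes "LG_solution mu lam w" "LG_solution mu lam u"
  obtains C where "\<And>z. z \<in> Cplus \<Longrightarrow> deriv w z * u z - w z * deriv u z = C"
proof (rule constant_on_Cplus)
  have an: "w analytic_on Cplus" "u analytic_on Cplus" using assms by (auto simp: LG_solution_def)
  note an' = this analytic_deriv[OF an(1)] analytic_deriv[OF an(2)]
  fix z assume z: "z \<in> Cplus"
  have "((\<lambda>z. deriv w z * u z - w z * deriv u z) has_field_derivative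
      (deriv (deriv w) z * u z + deriv u z * deriv w z) - (deriv w z * deriv u z + deriv (deriv u) z * w z)) (at z)"
    by (intro derivative_intros an'[THEN analytic_on_DERIV] z)
  moreover have "deriv (deriv w) z * u z - deriv (deriv u) z * w z = 0"
    using assms z by (simp add: LG_solution_def)
  ultimately show "((\<lambda>z. deriv w z * u z - w z * deriv u z) has_field_derivative 0) (at z)"
    by (simp add: algebra_simps)
qed blast

text \<open>The curve may run on the real axis, at the edge of \<open>Cplus\<close>. Zeros
  accumulate at some point p of the compact image, so w vanishes on a full ball about p, where w is
  still holomorphic. This ball meets the open half plane, which is connected, and the remaining
  boundary points are limits from above.\<close>

lemma analytic_zero_on_Cplus:
  assumes an: "w analytic_on Cplus" and \<gamma>: "continuous_on {a..b} \<gamma>" "inj_on \<gamma> {a..b}" "a < (b::real)"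
    and im: "\<And>s. s \<in> {a..b} \<Longrightarrow> \<gamma> s \<in> Cplus" and zero: "\<And>s. s \<in> {a..b} \<Longrightarrow> w (\<gamma> s) = 0"
    and z: "z \<in> Cplus"
  shows "w z = 0"
proof -
  let ?K = "\<gamma> ` {a..b}"
  have "infinite ?K" using \<gamma> by (simp add: finite_image_iff)
  moreover have "compact ?K" using \<gamma> by (intro compact_continuous_image) auto
  ultimately obtain p where p: "p \<in> ?K" "p islimpt ?K"
    unfolding compact_eq_Bolzano_Weierstrass by blast
  then have pC: "p \<in> Cplus" using im by auto
  obtain e where e: "e > 0" "w holomorphic_on ball p e"
    using an pC unfolding analytic_on_def by blast
  have ball: "w x = 0" if "x \<in> ball p e" for x
  proof (rule analytic_continuation[of w "ball p e" "?K \<inter> ball p e" p])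
    show "p islimpt ?K \<inter> ball p e" using p(2) e(1) by (intro islimpt_Int_eventually eventually_at_in_open') auto
  qed (use e that zero in auto)
  have H: "w holomorphic_on {z. 0 < Im z}"
    by (rule holomorphic_on_subset[OF analytic_imp_holomorphic[OF an]]) (auto simp: Cplus_iff)
  define q where "q = p + \<i> * of_real (e / 2)"
  have q: "q \<in> ball p e" "0 < Im q" using e pC by (auto simp: q_def dist_norm norm_mult Cplus_iff)
  have H0: "w x = 0" if "0 < Im x" for x
  proof (rule analytic_continuation[of w "{z. 0 < Im z}" "ball p e \<inter> {z. 0 < Im z}" q])
    show "q islimpt ball p e \<inter> {z. 0 < Im z}"
      using q by (intro interior_limit_point interiorI[of "ball p e \<inter> {z. 0 < Im z}"] open_Int open_halfspace_Im_gt) auto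
  qed (use H ball that q in \<open>auto simp: open_halfspace_Im_gt connected_halfspace_Im_gt\<close>)
  have "isCont w z" using analytic_on_DERIV[OF an z] DERIV_isCont by blast
  moreover have "((\<lambda>n. z + \<i> * of_real (1 / real (Suc n))) \<longlongrightarrow> z + \<i> * of_real 0) sequentially"
    by (intro tendsto_intros LIMSEQ_Suc lim_1_over_n)
  ultimately have "(\<lambda>n. w (z + \<i> * of_real (1 / real (Suc n)))) \<longlonglongrightarrow> w z"
    by (auto intro: isCont_tendsto_compose)
  moreover have "w (z + \<i> * of_real (1 / real (Suc n))) = 0" for n
    using z by (intro H0) (simp add: Cplus_iff add_nonneg_pos)
  ultimately show ?thesis by (simp add: LIMSEQ_const_iff)
qed

text \<open>If C were nonzero, the real part of (b / C) h would have derivative at least 1 and tend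
  to infinity, against h \<longlongrightarrow> 0. Hence h is constant, equal to its limit.\<close>

lemma ray_zero:
  fixes h k :: "real \<Rightarrow> complex"
  assumes h: "\<And>s. s0 \<le> s \<Longrightarrow> (h has_vector_derivative C * k s) (at s)"
    and k: "\<And>s. s0 \<le> s \<Longrightarrow> 1 \<le> Re (b * k s)" and lim: "(h \<longlongrightarrow> 0) at_top" and s: "s0 \<le> s"
  shows "h s = 0"
proof -
  have "C = 0"
  proof (rule ccontr)
    assume C: "C \<noteq> 0"
    define r where "r = (\<lambda>s. Re (b / C * h s))"
    have r: "(r has_real_derivative Re (b * k s)) (at s)" if "s0 \<le> s" for s
    proof -
      have "((\<lambda>s. b / C * h s) has_vector_derivative b / C * (C * k s)) (at s)"
        by (intro derivative_intros h that)
      then have "((\<lambda>s. Re (b / C * h s)) has_vector_derivative Re (b / C * (C * k s))) (at s)"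
        by (rule bounded_linear.has_vector_derivative[OF bounded_linear_Re])
      then show ?thesis using C unfolding r_def has_real_derivative_iff_has_vector_derivative by simp
    qed
    have mono: "r s0 - s0 + s \<le> r s" if "s0 \<le> s" for s
    proof -
      have "r s0 - s0 \<le> r s - s"
      proof (rule DERIV_nonneg_imp_nondecreasing[OF that])
        fix x assume "s0 \<le> x"
        then have "((\<lambda>s. r s - s) has_real_derivative Re (b * k x) - 1) (at x)" "0 \<le> Re (b * k x) - 1"
          using r k by (auto intro!: derivative_intros)
        then show "\<exists>y. ((\<lambda>s. r s - s) has_real_derivative y) (at x) \<and> 0 \<le> y" by blast
      qed
      then show ?thesis by simp
    qed
    have "LIM s at_top. r s0 - s0 + s :> at_top" by real_asymp
    then have "filterlim r at_top at_top"
      by (rule filterlim_at_top_mono) (use mono in \<open>auto intro: eventually_at_top_linorderI\<close>)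
    moreover have "((\<lambda>s. Re (b / C * h s)) \<longlongrightarrow> Re (b / C * 0)) at_top"
      by (intro tendsto_intros lim)
    then have "(r \<longlongrightarrow> 0) at_top" by (simp add: r_def)
    ultimately show False using not_tendsto_and_filterlim_at_infinity[of at_top r 0]
      by (auto intro: filterlim_at_top_imp_at_infinity)
  qed
  have const: "h t = h s" if "s \<le> t" for t
  proof -
    have "(h has_vector_derivative 0) (at x within {s..t})" if "x \<in> {s..t}" for x
      using h[of x] s \<open>C = 0\<close> that by (auto intro: has_vector_derivative_at_within)
    then obtain c where "\<And>x. x \<in> {s..t} \<Longrightarrow> h x = c"
      using has_vector_derivative_zero_constant[of "{s..t}" h] by auto
    then show ?thesis using that by (metis atLeastAtMost_iff order_refl)
  qed
  have "(h \<longlongrightarrow> h s) at_top"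
    by (rule tendsto_eventually, rule eventually_at_top_linorderI[of s]) (rule const)
  then show ?thesis using lim tendsto_unique by (metis trivial_limit_at_top_linorder)
qed

text \<open>With Wronskian \<open>C\<close> one has \<open>(w / u)' = C / u\<^sup>2\<close> along the curve, so if \<open>u\<close> is recessive
  then \<open>w / u\<close> cannot tend to zero unless \<open>C = 0\<close>.\<close>

lemma LG_ratio_zero:
  assumes w: "LG_solution mu lam w" and u: "LG_solution mu lam u"
    and \<gamma>: "\<And>s. s0 \<le> s \<Longrightarrow> (\<gamma> has_vector_derivative \<gamma>' s) (at s)" "inj_on \<gamma> {s0..}"
    and im: "\<And>s. s0 \<le> s \<Longrightarrow> \<gamma> s \<in> Cplus"
    and nz: "\<And>s. s0 \<le> s \<Longrightarrow> u (\<gamma> s) \<noteq> 0"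
    and div: "\<And>s. s0 \<le> s \<Longrightarrow> 1 \<le> Re (b * (\<gamma>' s / u (\<gamma> s) ^ 2))"
    and lim: "((\<lambda>s. w (\<gamma> s) / u (\<gamma> s)) \<longlongrightarrow> 0) at_top"
    and z: "z \<in> Cplus"
  shows "w z = 0"
proof -
  obtain C where C: "\<And>z. z \<in> Cplus \<Longrightarrow> deriv w z * u z - w z * deriv u z = C"
    using LG_wronskian[OF w u] by blast
  have an: "w analytic_on Cplus" "u analytic_on Cplus" using w u by (auto simp: LG_solution_def)
  have "w (\<gamma> s) / u (\<gamma> s) = 0" if s: "s0 \<le> s" for s
  proof (rule ray_zero[where C = C and k = "\<lambda>s. \<gamma>' s / u (\<gamma> s) ^ 2", OF _ div lim s])
    fix s assume s: "s0 \<le> s"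
    have "((\<lambda>z. w z / u z) has_field_derivative
        (deriv w (\<gamma> s) * u (\<gamma> s) - w (\<gamma> s) * deriv u (\<gamma> s)) / (u (\<gamma> s) * u (\<gamma> s))) (at (\<gamma> s))"
      by (intro derivative_intros an[THEN analytic_on_DERIV] im[OF s] nz[OF s])
    from field_vector_diff_chain_at[OF \<gamma>(1)[OF s] this]
    show "((\<lambda>s. w (\<gamma> s) / u (\<gamma> s)) has_vector_derivative C * (\<gamma>' s / u (\<gamma> s) ^ 2)) (at s)"
      unfolding C[OF im[OF s]] by (simp add: o_def power2_eq_square mult.commute[of C])
  qed
  then have zero: "w (\<gamma> s) = 0" if "s0 \<le> s" for s using nz that by fastforce
  show ?thesis
  proof (rule analytic_zero_on_Cplus[OF an(1) _ _ _ _ _ z, of s0 "s0 + 1" \<gamma>])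
    show "continuous_on {s0..s0 + 1} \<gamma>"
      by (intro continuous_at_imp_continuous_on ballI has_vector_derivative_continuous[OF \<gamma>(1)]) auto
    show "inj_on \<gamma> {s0..s0 + 1}" using \<gamma>(2) by (rule inj_on_subset) auto
  qed (use im zero in auto)
qed

text \<open>If u were not a multiple of w, recessiveness would give w / u \<longlongrightarrow> 0
  along the curve. But u is small there in the sense of \<open>div\<close>, so that limit would
  force w to vanish identically.\<close>

lemma recessive_proportional:
  assumes rec: "recessive F mu lam w" and u: "LG_solution mu lam u" and F: "filterlim \<gamma> F at_top"
    and \<gamma>: "\<And>s. s0 \<le> s \<Longrightarrow> (\<gamma> has_vector_derivative \<gamma>' s) (at s)" "inj_on \<gamma> {s0..}"
    and im: "\<And>s. s0 \<le> s \<Longrightarrow> \<gamma> s \<in> Cplus"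
    and nz: "\<And>s. s0 \<le> s \<Longrightarrow> u (\<gamma> s) \<noteq> 0"
    and div: "\<And>s. s0 \<le> s \<Longrightarrow> 1 \<le> Re (b * (\<gamma>' s / u (\<gamma> s) ^ 2))"
  obtains c where "\<And>z. z \<in> Cplus \<Longrightarrow> u z = c * w z"
proof -
  have w: "LG_solution mu lam w" and nonzero: "\<exists>z\<in>Cplus. w z \<noteq> 0"
    using rec by (auto simp: recessive_def)
  have "\<exists>c. \<forall>z\<in>Cplus. u z = c * w z"
  proof (rule ccontr)
    assume "\<nexists>c. \<forall>z\<in>Cplus. u z = c * w z"
    then have "((\<lambda>z. w z / u z) \<longlongrightarrow> 0) F" using rec u by (auto simp: recessive_def)
    then have "((\<lambda>s. w (\<gamma> s) / u (\<gamma> s)) \<longlongrightarrow> 0) at_top" by (rule filterlim_compose[OF _ F])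
    with LG_ratio_zero[OF w u \<gamma> im nz div] nonzero show False by blast
  qed
  then show ?thesis using that by blast
qed

text \<open>Supplies the hypothesis \<open>div\<close> of the preceding lemmas from leading
  behaviour v ~ c \<rho>: with velocity g of sign \<sigma>, the constant b = \<sigma> c^2 rotates g
  / v^2 towards the positive axis. The thresholds 1/2 and 2 are chosen to have product 1.\<close>

lemma recessive_growth:
  fixes v :: "real \<Rightarrow> complex" and \<rho> g :: "real \<Rightarrow> real"
  assumes lim: "((\<lambda>s. v s / of_real (\<rho> s)) \<longlongrightarrow> c) at_top" and c: "c \<noteq> 0"
    and \<rho>: "\<And>s. 0 < \<rho> s" and growth: "filterlim (\<lambda>s. \<sigma> * g s / \<rho> s ^ 2) at_top at_top"
  shows "\<forall>\<^sub>F s in at_top. v s \<noteq> 0 \<and> 1 \<le> Re (of_real \<sigma> * c ^ 2 * (of_real (g s) / v s ^ 2))"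
proof -
  have nz: "\<forall>\<^sub>F s in at_top. v s / of_real (\<rho> s) \<noteq> 0"
    using tendsto_imp_eventually_ne[OF lim c] .
  have "((\<lambda>s. Re (c ^ 2 / (v s / of_real (\<rho> s)) ^ 2)) \<longlongrightarrow> Re (c ^ 2 / c ^ 2)) at_top"
    using c by (intro tendsto_intros lim) auto
  then have "\<forall>\<^sub>F s in at_top. 1 / 2 < Re (c ^ 2 / (v s / of_real (\<rho> s)) ^ 2)"
    using c by (intro order_tendstoD(1)) auto
  moreover have "\<forall>\<^sub>F s in at_top. 2 \<le> \<sigma> * g s / \<rho> s ^ 2"
    using growth by (simp add: filterlim_at_top)
  ultimately show ?thesis using nz
  proof eventually_elim
    case (elim s)
    have "1 \<le> (\<sigma> * g s / \<rho> s ^ 2) * Re (c ^ 2 / (v s / of_real (\<rho> s)) ^ 2)"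
      using mult_mono[of 2 "\<sigma> * g s / \<rho> s ^ 2" "1/2" "Re (c ^ 2 / (v s / of_real (\<rho> s)) ^ 2)"] elim by simp
    also have "\<dots> = Re (of_real (\<sigma> * g s / \<rho> s ^ 2) * (c ^ 2 / (v s / of_real (\<rho> s)) ^ 2))"
      by (simp only: Re_of_real_times)
    also have "of_real (\<sigma> * g s / \<rho> s ^ 2) * (c ^ 2 / (v s / of_real (\<rho> s)) ^ 2)
        = of_real \<sigma> * c ^ 2 * (of_real (g s) / v s ^ 2)"
      using \<rho>[of s] by (simp add: power_divide field_simps)
    finally show ?case using elim by auto
  qed
qed

section \<open>Whittaker functions\<close>

text \<open>The logarithm of \<mu> z with its cut turned to the negative imaginary axis. It is
  therefore analytic in a neighbourhood of all of \<open>Cplus\<close>, including the negative real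
  axis, where the principal logarithm jumps.\<close>

definition surface_log :: "real \<Rightarrow> complex \<Rightarrow> complex" where
  "surface_log mu z = of_real (ln mu) + of_real (pi / 2) * \<i> + Ln (- \<i> * z)"

lemma surface_log_eq:
  assumes "mu > 0" "z \<in> Cplus"
  shows "surface_log mu z = Ln (of_real mu * z)"
proof -
  have z: "z \<noteq> 0" "0 \<le> Im z" using assms by (auto simp: Cplus_iff)
  have "Ln (of_real mu * z) = of_real (ln mu) + Ln z"
    using assms z Ln_of_real[of mu] by (simp add: Ln_times_of_real)
  moreover have "Ln z = Ln (- \<i> * z) + \<i> * of_real pi / 2"
    using Ln_times_ii[of "- \<i> * z"] z by simp
  ultimately show ?thesis by (simp add: surface_log_def)
qed


text \<open>Whittaker's equation is unchanged when the argument and \<kappa> change sign together.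
  The shift \<sigma> with exp \<sigma> = \<epsilon> = 1 or -1 thus treats W with index -\<kappa> on
  the rotated argument along with M and W.\<close>

lemma whittaker_LG:
  assumes y: "whittaker_solution (\<epsilon> * (lam * mu)) mu y" and mu: "mu > 0"
    and \<sigma>: "exp \<sigma> = of_real \<epsilon>" and \<epsilon>: "\<epsilon> * \<epsilon> = 1"
  shows "LG_solution mu lam (\<lambda>z. y (surface_log mu z + \<sigma>))"
proof -
  let ?\<Omega> = "{z. - \<i> * z \<notin> \<real>\<^sub>\<le>\<^sub>0}"
  let ?t = "\<lambda>z. surface_log mu z + \<sigma>"
  have op: "open ?\<Omega>"
    using open_vimage[of "- \<real>\<^sub>\<le>\<^sub>0" "\<lambda>z. - \<i> * z"] closed_nonpos_Reals_complex
    by (simp add: vimage_def open_Compl continuous_intros del: mult_minus_left)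
  have sub: "Cplus \<subseteq> ?\<Omega>" by (auto simp: Cplus_iff complex_nonpos_Reals_iff complex_eq_iff)
  have nz: "z \<noteq> 0" if "z \<in> ?\<Omega>" for z using that by auto
  have hol: "y holomorphic_on UNIV" and ode: "\<And>t. (deriv (deriv y) t - deriv y t) / exp t ^ 2 =
        ((of_real mu ^ 2 - 1/4) / exp t ^ 2 - of_real (\<epsilon> * (lam * mu)) / exp t + 1/4) * y t"
    using y by (auto simp: whittaker_solution_def)
  have dy: "(y has_field_derivative deriv y t) (at t)" for t
    using hol holomorphic_derivI open_UNIV by blast
  have dy': "(deriv y has_field_derivative deriv (deriv y) t) (at t)" for t
    using hol holomorphic_derivI holomorphic_deriv open_UNIV by blast
  have dt: "(?t has_field_derivative 1 / z) (at z)" if "z \<in> ?\<Omega>" for z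
    unfolding surface_log_def using that nz[OF that]
    by (auto intro!: derivative_eq_intros simp: field_simps)
  have d1: "((\<lambda>z. y (?t z)) has_field_derivative deriv y (?t z) / z) (at z)" if "z \<in> ?\<Omega>" for z
    using DERIV_chain2[OF dy dt[OF that]] by simp
  have d2: "((\<lambda>z. deriv y (?t z) / z) has_field_derivative (deriv (deriv y) (?t z) - deriv y (?t z)) / z ^ 2) (at z)" if "z \<in> ?\<Omega>" for z
  proof -
    have "((\<lambda>z. deriv y (?t z) / z) has_field_derivative
        (deriv (deriv y) (?t z) * (1 / z) * z - deriv y (?t z) * 1) / (z * z)) (at z)"
      by (intro derivative_intros DERIV_chain2[OF dy' dt[OF that]] nz[OF that])
    then show ?thesis using nz[OF that] by (simp add: power2_eq_square)
  qed
  have deriv2: "deriv (deriv (\<lambda>z. y (?t z))) z = (deriv (deriv y) (?t z) - deriv y (?t z)) / z ^ 2" if "z \<in> ?\<Omega>" for z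
  proof -
    have "(deriv (\<lambda>z. y (?t z)) has_field_derivative (deriv (deriv y) (?t z) - deriv y (?t z)) / z ^ 2) (at z)"
      by (rule has_field_derivative_transform_within_open[OF d2[OF that] op that])
        (rule DERIV_imp_deriv[OF d1, symmetric])
    then show ?thesis by (rule DERIV_imp_deriv)
  qed
  have "(\<lambda>z. y (?t z)) holomorphic_on ?\<Omega>"
    unfolding holomorphic_on_open[OF op] using d1 by blast
  then have "(\<lambda>z. y (?t z)) analytic_on Cplus"
    using op sub by (meson analytic_on_open analytic_on_subset)
  moreover have "deriv (deriv (\<lambda>z. y (?t z))) z = (of_real (mu ^ 2) * f_LG lam z + g_LG z) * y (?t z)" if "z \<in> Cplus" for z
  proof -
    have z: "z \<in> ?\<Omega>" and z0: "z \<noteq> 0" using that sub nz by blast+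
    have "exp (of_real (ln mu)) = complex_of_real mu" using mu by (simp add: exp_of_real)
    moreover have "exp (of_real (pi / 2) * \<i>) = \<i>"
      using cis_conv_exp[of "pi / 2"] cis_pi_half by (metis mult.commute)
    moreover have "exp (Ln (- \<i> * z)) = - \<i> * z" using z0 by simp
    ultimately have ex: "exp (?t z) = of_real mu * z * of_real \<epsilon>"
      unfolding surface_log_def exp_add \<sigma> using complex_i_mult_minus[of z] by (simp add: mult.assoc)
    have eps2: "of_real \<epsilon> * of_real \<epsilon> = (1::complex)" using \<epsilon> by (metis of_real_1 of_real_mult)
    then have ep0: "of_real \<epsilon> \<noteq> (0::complex)" by auto
    have m0: "of_real mu \<noteq> (0::complex)" using mu by simp
    have "exp (?t z) ^ 2 = (of_real mu * z) ^ 2"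
      unfolding ex using eps2 by (simp add: power2_eq_square mult_ac)
    moreover have "of_real (\<epsilon> * (lam * mu)) / exp (?t z) = of_real lam / z"
      unfolding ex using ep0 m0 z0 by (simp add: field_simps)
    ultimately have "(deriv (deriv y) (?t z) - deriv y (?t z)) / (of_real mu * z) ^ 2 =
        ((of_real mu ^ 2 - 1/4) / (of_real mu * z) ^ 2 - of_real lam / z + 1/4) * y (?t z)"
      using ode[of "?t z"] by simp
    moreover have d0: "(of_real mu * z) ^ 2 \<noteq> 0" using m0 z0 by simp
    ultimately have "deriv (deriv y) (?t z) - deriv y (?t z) = ((of_real mu ^ 2 - 1/4) / (of_real mu * z) ^ 2 - of_real lam / z + 1/4) * y (?t z) * (of_real mu * z) ^ 2"
      unfolding nonzero_divide_eq_eq[OF d0] by blast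
    then have "deriv (deriv (\<lambda>z. y (?t z))) z = ((of_real mu ^ 2 - 1/4) / (of_real mu * z) ^ 2 - of_real lam / z + 1/4) * y (?t z) * (of_real mu * z) ^ 2 / z ^ 2"
      using deriv2[OF z] by simp
    also have "\<dots> = (of_real (mu ^ 2) * f_LG lam z + g_LG z) * y (?t z)"
      unfolding f_LG_def g_LG_def using m0 z0 by (simp add: field_simps power2_eq_square)
    finally show ?thesis .
  qed
  ultimately show ?thesis unfolding LG_solution_def by blast
qed


section \<open>Kummer's confluent hypergeometric function and the function M\<close>

definition kummer_coeff :: "real \<Rightarrow> real \<Rightarrow> nat \<Rightarrow> real" where
  "kummer_coeff a b n = pochhammer a n / (pochhammer b n * fact n)"

definition kummer :: "real \<Rightarrow> real \<Rightarrow> complex \<Rightarrow> complex" where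
  "kummer a b z = (\<Sum>n. of_real (kummer_coeff a b n) * z ^ n)"

lemma kummer_coeff_bound:
  assumes "0 < a" "a \<le> b"
  shows "0 \<le> kummer_coeff a b n" "kummer_coeff a b n \<le> 1 / fact n"
proof -
  have pos: "0 < pochhammer a n" "0 < pochhammer b n" using assms by (auto intro: pochhammer_pos)
  then show "0 \<le> kummer_coeff a b n" by (simp add: kummer_coeff_def)
  have "pochhammer a n \<le> pochhammer b n"
    unfolding pochhammer_prod using assms by (intro prod_mono) auto
  then show "kummer_coeff a b n \<le> 1 / fact n"
    using pos by (simp add: kummer_coeff_def field_simps)
qed

lemma kummer_summable:
  assumes "0 < a" "a \<le> b"
  shows "summable (\<lambda>n. of_real (kummer_coeff a b n) * (z::complex) ^ n)"
proof (rule summable_comparison_test')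
  show "summable (\<lambda>n. cmod z ^ n / fact n)"
    using summable_exp_generic[of "cmod z"] by (simp add: field_simps)
  show "cmod (of_real (kummer_coeff a b n) * z ^ n) \<le> cmod z ^ n / fact n" if "0 \<le> n" for n
    using kummer_coeff_bound[OF assms, of n] mult_right_mono[of "kummer_coeff a b n" "1 / fact n" "cmod z ^ n"]
    by (simp add: norm_mult norm_power)
qed

lemma powser_shift:
  fixes z :: "'a::real_normed_field"
  assumes "(\<lambda>n. d n * z ^ n) sums D"
  shows "(\<lambda>n. (case n of 0 \<Rightarrow> 0 | Suc k \<Rightarrow> d k) * z ^ n) sums (z * D)"
proof -
  have "(\<lambda>n. (case Suc n of 0 \<Rightarrow> 0 | Suc k \<Rightarrow> d k) * z ^ Suc n) sums (z * D)"
    using sums_mult[OF assms, of z] by (simp add: mult_ac)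
  from sums_Suc[OF this] show ?thesis by simp
qed

text \<open>Comparison of coefficients, based on (n + 1) (b + n) c(n+1) = (a + n) c(n). The factors
  z in front of K1 and K2 become index shifts.\<close>

lemma kummer_ode:
  assumes "0 < a" "a \<le> b"
  obtains K1 K2 where "\<And>z. (kummer a b has_field_derivative K1 z) (at z)"
    "\<And>z. (K1 has_field_derivative K2 z) (at z)"
    "\<And>z. z * K2 z + (of_real b - z) * K1 z = of_real a * kummer a b z"
proof -
  define c where "c = (\<lambda>n. complex_of_real (kummer_coeff a b n))"
  have s0: "summable (\<lambda>n. c n * z ^ n)" for z unfolding c_def by (rule kummer_summable[OF assms])
  have s1: "summable (\<lambda>n. diffs c n * z ^ n)" for z by (rule termdiff_converges_all[OF s0])
  have s2: "summable (\<lambda>n. diffs (diffs c) n * z ^ n)" for z by (rule termdiff_converges_all[OF s1])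
  define K1 where "K1 = (\<lambda>z. \<Sum>n. diffs c n * z ^ n)"
  define K2 where "K2 = (\<lambda>z. \<Sum>n. diffs (diffs c) n * z ^ n)"
  have K: "kummer a b = (\<lambda>z. \<Sum>n. c n * z ^ n)" by (simp add: kummer_def c_def fun_eq_iff)
  show ?thesis
  proof (rule that)
    show "(kummer a b has_field_derivative K1 z) (at z)" for z
      unfolding K K1_def by (rule termdiffs_strong_converges_everywhere[OF s0])
    show "(K1 has_field_derivative K2 z) (at z)" for z
      unfolding K1_def K2_def by (rule termdiffs_strong_converges_everywhere[OF s1])
    show "z * K2 z + (of_real b - z) * K1 z = of_real a * kummer a b z" for z
    proof -
      have "(\<lambda>n. (case n of 0 \<Rightarrow> 0 | Suc k \<Rightarrow> diffs (diffs c) k) * z ^ n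
          + (of_real b * (diffs c n * z ^ n) - (case n of 0 \<Rightarrow> 0 | Suc k \<Rightarrow> diffs c k) * z ^ n))
        sums (z * K2 z + (of_real b * K1 z - z * K1 z))"
        unfolding K1_def K2_def
        by (intro sums_add sums_diff sums_mult powser_shift summable_sums s1 s2)
      moreover have "(\<lambda>n. of_real a * (c n * z ^ n)) sums (of_real a * kummer a b z)"
        unfolding K by (intro sums_mult summable_sums s0)
      moreover have "(case n of 0 \<Rightarrow> 0 | Suc k \<Rightarrow> diffs (diffs c) k) * z ^ n
          + (of_real b * (diffs c n * z ^ n) - (case n of 0 \<Rightarrow> 0 | Suc k \<Rightarrow> diffs c k) * z ^ n)
          = of_real a * (c n * z ^ n)" for n
      proof -
        have alg: "S * m * (p * k / (q * m * (S * f))) = k * (p / (q * f))"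
          if "S \<noteq> 0" "m \<noteq> 0" "q \<noteq> 0" "f \<noteq> 0" for S m p k q f :: real
          using that by (simp add: field_simps)
        have "real (Suc n) * (b + real n) * kummer_coeff a b (Suc n) = (a + real n) * kummer_coeff a b n"
          unfolding kummer_coeff_def pochhammer_Suc fact_Suc
          using assms by (intro alg) (auto simp: pochhammer_eq_0_iff)
        then have rec: "of_nat (Suc n) * (of_real b + of_nat n) * c (Suc n) = (of_real a + of_nat n) * c n"
          unfolding c_def by (metis of_real_add of_real_mult of_real_of_nat_eq)
        have "(case n of 0 \<Rightarrow> 0 | Suc k \<Rightarrow> diffs (diffs c) k) + of_real b * diffs c n - (case n of 0 \<Rightarrow> 0 | Suc k \<Rightarrow> diffs c k)
            = of_real a * c n"
          using rec by (cases n) (simp_all add: diffs_def algebra_simps)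
        then have "((case n of 0 \<Rightarrow> 0 | Suc k \<Rightarrow> diffs (diffs c) k) + of_real b * diffs c n - (case n of 0 \<Rightarrow> 0 | Suc k \<Rightarrow> diffs c k)) * z ^ n
            = of_real a * c n * z ^ n" by (rule arg_cong)
        then show ?thesis by (simp only: algebra_simps)
      qed
      ultimately have "z * K2 z + (of_real b * K1 z - z * K1 z) = of_real a * kummer a b z"
        by (simp only: sums_unique2)
      then show ?thesis by (simp add: algebra_simps)
    qed
  qed
qed

text \<open>The classical formula z^(\<mu> + 1/2) exp(-z/2) 1F1(\<mu> - \<kappa> + 1/2; 2 \<mu> + 1;
  z), written in the variable t = ln z.\<close>

definition whittaker_M_fun :: "real \<Rightarrow> real \<Rightarrow> complex \<Rightarrow> complex" where
  "whittaker_M_fun kappa mu t = exp (of_real (mu + 1/2) * t - exp t / 2) * kummer (mu - kappa + 1/2) (2 * mu + 1) (exp t)"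

lemma whittaker_M_fun_solution:
  assumes "0 \<le> kappa" "kappa < mu + 1/2" "0 < mu"
  shows "whittaker_solution kappa mu (whittaker_M_fun kappa mu)"
proof -
  define a where "a = mu - kappa + 1/2"
  define \<alpha> where "\<alpha> = mu + 1/2"
  have ab: "0 < a" "a \<le> 2 * \<alpha>" using assms by (auto simp: a_def \<alpha>_def)
  obtain K1 K2 where K: "\<And>z. (kummer a (2 * \<alpha>) has_field_derivative K1 z) (at z)"
    "\<And>z. (K1 has_field_derivative K2 z) (at z)"
    "\<And>z. z * K2 z + (of_real (2 * \<alpha>) - z) * K1 z = of_real a * kummer a (2 * \<alpha>) z"
    using kummer_ode[OF ab] by blast
  let ?\<Phi> = "kummer a (2 * \<alpha>)"
  define E where "E = (\<lambda>t::complex. exp (of_real \<alpha> * t - exp t / 2))"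
  have M: "whittaker_M_fun kappa mu = (\<lambda>t. E t * ?\<Phi> (exp t))"
    by (simp add: whittaker_M_fun_def E_def a_def \<alpha>_def fun_eq_iff algebra_simps)
  have E: "(E has_field_derivative E t * (of_real \<alpha> - exp t / 2)) (at t)" for t
    unfolding E_def by (auto intro!: derivative_eq_intros)
  have P: "((\<lambda>t. ?\<Phi> (exp t)) has_field_derivative K1 (exp t) * exp t) (at t)" for t
    by (rule DERIV_chain2[OF K(1) DERIV_exp])
  have P1: "((\<lambda>t. K1 (exp t)) has_field_derivative K2 (exp t) * exp t) (at t)" for t
    by (rule DERIV_chain2[OF K(2) DERIV_exp])
  define M1 where "M1 = (\<lambda>t. E t * ((of_real \<alpha> - exp t / 2) * ?\<Phi> (exp t) + exp t * K1 (exp t)))"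
  have d1: "(whittaker_M_fun kappa mu has_field_derivative M1 t) (at t)" for t
    unfolding M M1_def by (rule E P derivative_eq_intros refl)+ (simp add: algebra_simps)
  have d2: "(M1 has_field_derivative E t * ((of_real \<alpha> - exp t / 2) * ((of_real \<alpha> - exp t / 2) * ?\<Phi> (exp t) + exp t * K1 (exp t))
      + ((of_real \<alpha> - exp t / 2) * (K1 (exp t) * exp t) - exp t / 2 * ?\<Phi> (exp t)
         + (exp t * K1 (exp t) + exp t * (K2 (exp t) * exp t))))) (at t)" for t
  proof -
    have e2: "((\<lambda>t. of_real \<alpha> - exp t / 2) has_field_derivative - (exp t / 2)) (at t)"
      by (auto intro!: derivative_eq_intros)
    show ?thesis unfolding M1_def
      by (rule DERIV_cong[OF DERIV_mult[OF E DERIV_add[OF DERIV_mult[OF e2 P] DERIV_mult[OF DERIV_exp P1]]]])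
        (simp add: algebra_simps)
  qed
  have D1: "deriv (whittaker_M_fun kappa mu) = M1" using d1 by (auto simp: fun_eq_iff DERIV_imp_deriv)
  have ode: "(deriv M1 t - M1 t) / exp t ^ 2 =
      ((of_real mu ^ 2 - 1/4) / exp t ^ 2 - of_real kappa / exp t + 1/4) * whittaker_M_fun kappa mu t" for t
  proof -
    define x where "x = exp t"
    have x: "x \<noteq> 0" by (simp add: x_def)
    \<comment> \<open>Kummer's equation, used once more with a factor x, eliminates the second
      derivative; the rest is a polynomial identity in x.\<close>
    have "x * K2 x = of_real a * ?\<Phi> x - (of_real (2 * \<alpha>) - x) * K1 x"
      using K(3)[of x] by (simp only: eq_diff_eq)
    then have k: "x * (x * K2 x) = x * (of_real a * ?\<Phi> x - (of_real (2 * \<alpha>) - x) * K1 x)"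
      by (rule arg_cong)
    have "deriv M1 t - M1 t = E t * ((of_real \<alpha> - x / 2) * ((of_real \<alpha> - x / 2) * ?\<Phi> x + x * K1 x)
      + ((of_real \<alpha> - x / 2) * (K1 x * x) - x / 2 * ?\<Phi> x + (x * K1 x + x * (x * K2 x)))
      - ((of_real \<alpha> - x / 2) * ?\<Phi> x + x * K1 x))"
      using DERIV_imp_deriv[OF d2[of t]] by (simp add: M1_def x_def algebra_simps)
    also have "\<dots> = (of_real mu ^ 2 - 1/4 - of_real kappa * x + x ^ 2 / 4) * (E t * ?\<Phi> x)"
      unfolding k by (simp add: a_def \<alpha>_def power2_eq_square field_simps)
    finally have "deriv M1 t - M1 t = (of_real mu ^ 2 - 1/4 - of_real kappa * x + x ^ 2 / 4) * whittaker_M_fun kappa mu t"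
      by (simp add: M x_def)
    then have "(deriv M1 t - M1 t) / x ^ 2 = (of_real mu ^ 2 - 1/4 - of_real kappa * x + x ^ 2 / 4) / x ^ 2 * whittaker_M_fun kappa mu t"
      by simp
    also have "(of_real mu ^ 2 - 1/4 - of_real kappa * x + x ^ 2 / 4) / x ^ 2 =
        (of_real mu ^ 2 - 1/4) / x ^ 2 - of_real kappa / x + 1/4"
      using x by (simp add: diff_divide_distrib add_divide_distrib power2_eq_square)
    finally show ?thesis by (simp add: x_def)
  qed
  show ?thesis
    unfolding whittaker_solution_def D1 holomorphic_on_open[OF open_UNIV] using d1 ode by blast
qed

lemma whittaker_M_fun_at_bot:
  assumes "0 \<le> kappa" "kappa < mu + 1/2" "0 < mu" and t: "filterlim (\<lambda>s. Re (t s)) at_bot F"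
  shows "((\<lambda>s. whittaker_M_fun kappa mu (t s) / exp ((of_real mu + 1/2) * t s)) \<longlongrightarrow> 1) F"
proof -
  have ab: "0 < mu - kappa + 1/2" "mu - kappa + 1/2 \<le> 2 * mu + 1" using assms by auto
  obtain K1 where K: "\<And>z. (kummer (mu - kappa + 1/2) (2 * mu + 1) has_field_derivative K1 z) (at z)"
    by (rule kummer_ode[OF ab]) (rule that)
  have e: "((\<lambda>s. exp (t s)) \<longlongrightarrow> 0) F"
    by (rule tendsto_norm_zero_cancel) (simp add: filterlim_compose[OF exp_at_bot t])
  have "((\<lambda>s. exp (- exp (t s) / 2) * kummer (mu - kappa + 1/2) (2 * mu + 1) (exp (t s)))
      \<longlongrightarrow> exp (- 0 / 2) * kummer (mu - kappa + 1/2) (2 * mu + 1) 0) F"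
    by (intro tendsto_intros e isCont_tendsto_compose[OF DERIV_isCont[OF K]]) simp
  moreover have "kummer (mu - kappa + 1/2) (2 * mu + 1) 0 = 1"
    unfolding kummer_def using powser_zero[of "\<lambda>n. complex_of_real (kummer_coeff (mu - kappa + 1/2) (2 * mu + 1) n)"]
    by (simp add: kummer_coeff_def)
  moreover have "whittaker_M_fun kappa mu (t s) / exp ((of_real mu + 1/2) * t s)
      = exp (- exp (t s) / 2) * kummer (mu - kappa + 1/2) (2 * mu + 1) (exp (t s))" for s
  proof -
    have "exp (of_real (mu + 1/2) * t s - exp (t s) / 2) = exp ((of_real mu + 1/2) * t s) * exp (- exp (t s) / 2)"
      by (simp add: mult_exp_exp)
    then show ?thesis by (simp add: whittaker_M_fun_def)
  qed
  ultimately show ?thesis by simp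
qed


text \<open>The substitution t = x s in the Gamma integral. Working with integrals in
  \<open>ennreal\<close> gives existence and value at the same time.\<close>

lemma laplace_powr:
  fixes c x :: real
  assumes c: "0 < c" and x: "0 < x"
  shows "((\<lambda>s. s powr (c - 1) * exp (- x * s)) has_integral (Gamma c / x powr c)) {0..}"
proof -
  let ?f = "\<lambda>s. indicator {0..} s * (s powr (c - 1) * exp (- x * s))"
  have "ennreal (Gamma c) = (\<integral>\<^sup>+t. ennreal (indicator {0..} t * t powr (c - 1) / exp t) \<partial>lborel)"
    by (rule Gamma_conv_nn_integral_real[OF c])
  also have "\<dots> = ennreal \<bar>x\<bar> * (\<integral>\<^sup>+s. ennreal (indicator {0..} (0 + x * s) * (0 + x * s) powr (c - 1) / exp (0 + x * s)) \<partial>lborel)"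
    by (rule nn_integral_real_affine) (use x in auto)
  also have "(\<lambda>s. ennreal (indicator {0..} (0 + x * s) * (0 + x * s) powr (c - 1) / exp (0 + x * s)))
      = (\<lambda>s. ennreal (x powr (c - 1)) * ennreal (?f s))"
    using x by (auto simp: fun_eq_iff indicator_def zero_le_mult_iff powr_mult exp_minus field_simps simp flip: ennreal_mult')
  also have "ennreal \<bar>x\<bar> * (\<integral>\<^sup>+s. ennreal (x powr (c - 1)) * ennreal (?f s) \<partial>lborel)
      = ennreal (x powr c) * (\<integral>\<^sup>+s. ennreal (?f s) \<partial>lborel)"
  proof -
    have "x * x powr (c - 1) = x powr c" using x by (simp add: powr_diff)
    then have "ennreal \<bar>x\<bar> * ennreal (x powr (c - 1)) = ennreal (x powr c)"
      using x by (simp flip: ennreal_mult')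
    then show ?thesis by (simp add: nn_integral_cmult mult.assoc[symmetric])
  qed
  finally have e: "ennreal (Gamma c) = ennreal (x powr c) * (\<integral>\<^sup>+s. ennreal (?f s) \<partial>lborel)" .
  define J where "J = (\<integral>\<^sup>+s. ennreal (?f s) \<partial>lborel)"
  have "ennreal (1 / x powr c) * ennreal (Gamma c) = (ennreal (1 / x powr c) * ennreal (x powr c)) * J"
    unfolding e J_def by (rule mult.assoc[symmetric])
  then have "J = ennreal (Gamma c / x powr c)"
    using x by (simp flip: ennreal_mult')
  then have "(\<integral>\<^sup>+s. ennreal (?f s) \<partial>lborel) = ennreal (Gamma c / x powr c)"
    unfolding J_def .
  then have "(?f has_integral (Gamma c / x powr c)) UNIV"
    by (intro nn_integral_has_integral) (use c x in \<open>auto intro!: divide_nonneg_nonneg Gamma_real_nonneg\<close>)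
  then have "((\<lambda>s. if s \<in> {0..} then s powr (c - 1) * exp (- x * s) else 0) has_integral (Gamma c / x powr c)) UNIV"
    by (rule has_integral_eq[rotated]) (auto simp: indicator_def)
  then show ?thesis by (simp only: has_integral_restrict_UNIV)
qed

text \<open>Euler's integral for 1F1 after t is replaced by 1 - t. The series of exp(x (1 - t)) is
  integrated termwise against the Beta weight; all terms are nonnegative, so monotone convergence
  applies.\<close>

lemma kummer_integral:
  fixes a c x :: real
  assumes a: "0 < a" and c: "0 < c" and x: "0 < x"
  shows "((\<lambda>t. exp (- x * t) * (t powr (c - 1) * (1 - t) powr (a - 1)))
    has_integral (exp (- x) * (Beta c a * (\<Sum>n. kummer_coeff a (a + c) n * x ^ n)))) {0..1}"
proof -
  let ?w = "\<lambda>t. t powr (c - 1) * (1 - t) powr (a - 1)"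
  have sm: "summable (\<lambda>n. kummer_coeff a (a + c) n * x ^ n)"
    using kummer_summable[of a "a + c" "of_real x"] a c
    by (simp flip: of_real_power of_real_mult add: summable_of_real_iff)
  have "((\<lambda>t. exp (x * (1 - t)) * ?w t) has_integral (Beta c a * (\<Sum>n. kummer_coeff a (a + c) n * x ^ n))) {0..1}"
  proof (rule has_integral_monotone_convergence_increasing)
    show "((\<lambda>t. (\<Sum>n<k. (x * (1 - t)) ^ n / fact n) * ?w t) has_integral
        (\<Sum>n<k. x ^ n / fact n * Beta c (a + real n))) {0..1}" for k
    proof -
      have "((\<lambda>t. \<Sum>n<k. x ^ n / fact n * (t powr (c - 1) * (1 - t) powr (a + real n - 1)))
         has_integral (\<Sum>n<k. x ^ n / fact n * Beta c (a + real n))) {0..1}"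
        using a c by (intro has_integral_sum has_integral_mult_right has_integral_Beta_real) auto
      moreover have "(1 - t) powr (a + real n - 1) = (1 - t) powr (a - 1) * (1 - t) ^ n" if "t \<in> {0..1}" for t n
        using that by (cases "t = 1") (auto simp: powr_realpow[symmetric] simp flip: powr_add, simp add: algebra_simps)
      ultimately show ?thesis
        by (elim has_integral_eq[rotated]) (simp add: sum_distrib_left power_mult_distrib mult_ac)
    qed
    show "(\<Sum>n<k. (x * (1 - t)) ^ n / fact n) * ?w t \<le> (\<Sum>n<Suc k. (x * (1 - t)) ^ n / fact n) * ?w t"
      if "t \<in> {0..1}" for k t using that x by (intro mult_right_mono) auto
    show "(\<lambda>k. (\<Sum>n<k. (x * (1 - t)) ^ n / fact n) * ?w t) \<longlonglongrightarrow> exp (x * (1 - t)) * ?w t" for t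
      using exp_converges[of "x * (1 - t)"] unfolding sums_def
      by (intro tendsto_mult tendsto_const) (simp add: field_simps)
    have "Beta c (a + real n) = Beta c a * (pochhammer a n / pochhammer (a + c) n)" for n
    proof -
      have "Gamma (a + real n) = pochhammer a n * Gamma a" "Gamma (a + c + real n) = pochhammer (a + c) n * Gamma (a + c)"
        using a c by (auto simp: pochhammer_Gamma Gamma_eq_zero_iff nonpos_Ints_def)
      then show ?thesis by (simp add: Beta_def add_ac mult_ac)
    qed
    then have "(\<Sum>n<k. x ^ n / fact n * Beta c (a + real n)) = Beta c a * (\<Sum>n<k. kummer_coeff a (a + c) n * x ^ n)" for k
      by (simp add: sum_distrib_left kummer_coeff_def mult_ac)
    then show "(\<lambda>k. \<Sum>n<k. x ^ n / fact n * Beta c (a + real n)) \<longlonglongrightarrow> Beta c a * (\<Sum>n. kummer_coeff a (a + c) n * x ^ n)"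
      using summable_LIMSEQ[OF sm] by (simp add: tendsto_mult_left)
  qed
  then have "((\<lambda>t. exp (- x) * (exp (x * (1 - t)) * ?w t)) has_integral
     (exp (- x) * (Beta c a * (\<Sum>n. kummer_coeff a (a + c) n * x ^ n)))) {0..1}"
    by (rule has_integral_mult_right)
  moreover have "exp (- x) * (exp (x * (1 - t)) * ?w t) = exp (- x * t) * ?w t" for t
  proof -
    have "exp (- x) * exp (x * (1 - t)) = exp (- x * t)" by (simp add: mult_exp_exp algebra_simps)
    then show ?thesis by (simp only: mult.assoc[symmetric])
  qed
  ultimately show ?thesis by (simp only:)
qed

text \<open>Watson's lemma: \<open>(1 - t)^(a-1)\<close> is squeezed between \<open>1 - N t\<close> and \<open>1\<close>.\<close>

lemma kummer_at_top:
  fixes a c :: real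
  assumes a: "1 \<le> a" and c: "0 < c"
  shows "((\<lambda>x. x powr c * exp (- x) * (\<Sum>n. kummer_coeff a (a + c) n * x ^ n)) \<longlongrightarrow> Gamma (a + c) / Gamma a) at_top"
proof -
  define K where "K = (\<lambda>x. \<Sum>n. kummer_coeff a (a + c) n * x ^ n)"
  \<comment> \<open>An integer exponent N \<ge> a - 1 makes Bernoulli's inequality applicable. With
    N \<ge> 1 the minorant 1 - N t is also nonpositive for t \<ge> 1, so both comparisons extend to
    the whole half line.\<close>
  define N where "N = Suc (nat \<lceil>a\<rceil>)"
  have N: "a - 1 \<le> real N" "1 \<le> N" by (auto simp: N_def) linarith
  have G: "0 < Gamma a" "0 < Gamma c" "0 < Gamma (a + c)" using a c by (auto intro!: Gamma_real_pos)
  have B: "Beta c a = Gamma c * Gamma a / Gamma (a + c)" by (simp add: Beta_def add.commute)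
  have bounds: "Gamma c - real N * Gamma (c + 1) / x \<le> x powr c * (exp (- x) * (Beta c a * K x))"
    "x powr c * (exp (- x) * (Beta c a * K x)) \<le> Gamma c" if x: "0 < x" for x
  proof -
    let ?w = "\<lambda>t. exp (- x * t) * (t powr (c - 1) * (1 - t) powr (a - 1))"
    have "(?w has_integral (exp (- x) * (Beta c a * K x))) {0..1}"
      unfolding K_def using a c x by (intro kummer_integral) auto
    then have I: "((\<lambda>t. if t \<in> {0..1} then ?w t else 0) has_integral (exp (- x) * (Beta c a * K x))) {0..}"
      by (subst has_integral_restrict) auto
    have up: "((\<lambda>t. t powr (c - 1) * exp (- x * t)) has_integral (Gamma c / x powr c)) {0..}"
      by (rule laplace_powr[OF c x])
    have I0: "((\<lambda>t. t powr (c - 1) * exp (- x * t) - real N * (t powr (c + 1 - 1) * exp (- x * t))) has_integral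
        (Gamma c / x powr c - real N * (Gamma (c + 1) / x powr (c + 1)))) {0..}"
      using c x by (intro has_integral_diff has_integral_mult_right laplace_powr) auto
    have tp: "t powr c = t * t powr (c - 1)" if "0 \<le> t" for t
      using that by (cases "t = 0") (auto simp: powr_diff)
    have lo: "((\<lambda>t. t powr (c - 1) * exp (- x * t) * (1 - real N * t)) has_integral
        (Gamma c / x powr c - real N * (Gamma (c + 1) / x powr (c + 1)))) {0..}"
      by (rule has_integral_eq[OF _ I0]) (auto simp: algebra_simps tp)
    have bern: "1 - real N * t \<le> (1 - t) powr (a - 1)" if "t \<in> {0..1}" for t
    proof (cases "t = 1")
      case False
      have "1 - real N * t \<le> (1 - t) ^ N"
        using Bernoulli_inequality[of "- t" N] that by simp
      also have "\<dots> = (1 - t) powr (real N)" using that False by (simp add: powr_realpow)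
      also have "\<dots> \<le> (1 - t) powr (a - 1)" using that False N by (intro powr_mono') auto
      finally show ?thesis .
    qed (use N in auto)
    have "exp (- x) * (Beta c a * K x) \<le> Gamma c / x powr c"
    proof (rule has_integral_le[OF I up])
      fix t :: real assume t: "t \<in> {0..}"
      have "(1 - t) powr (a - 1) \<le> 1" if "t \<le> 1" using t that a by (intro powr_le1) auto
      then show "(if t \<in> {0..1} then ?w t else 0) \<le> t powr (c - 1) * exp (- x * t)"
        using t by (auto simp: mult.commute[of "exp _"] intro!: mult_right_mono mult_left_le)
    qed
    then show "x powr c * (exp (- x) * (Beta c a * K x)) \<le> Gamma c"
      using x by (simp add: field_simps)
    have "Gamma c / x powr c - real N * (Gamma (c + 1) / x powr (c + 1)) \<le> exp (- x) * (Beta c a * K x)"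
    proof (rule has_integral_le[OF lo I])
      fix t :: real assume t: "t \<in> {0..}"
      show "t powr (c - 1) * exp (- x * t) * (1 - real N * t) \<le> (if t \<in> {0..1} then ?w t else 0)"
      proof (cases "t \<le> 1")
        case True
        have "t powr (c - 1) * exp (- x * t) * (1 - real N * t) \<le> t powr (c - 1) * exp (- x * t) * (1 - t) powr (a - 1)"
          using bern t True by (intro mult_left_mono) auto
        then show ?thesis using t True by (simp add: mult_ac)
      next
        case False
        have "1 * 1 \<le> real N * t" using N False by (intro mult_mono) auto
        then show ?thesis using t False by (auto intro!: mult_nonneg_nonpos)
      qed
    qed
    then have "x powr c * (Gamma c / x powr c - real N * (Gamma (c + 1) / x powr (c + 1))) \<le> x powr c * (exp (- x) * (Beta c a * K x))"
      by (rule mult_left_mono) simp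
    also have "x powr c * (Gamma c / x powr c - real N * (Gamma (c + 1) / x powr (c + 1))) = Gamma c - real N * Gamma (c + 1) / x"
      using x by (simp add: powr_add field_simps)
    finally show "Gamma c - real N * Gamma (c + 1) / x \<le> x powr c * (exp (- x) * (Beta c a * K x))" .
  qed
  have "((\<lambda>x. x powr c * (exp (- x) * (Beta c a * K x))) \<longlongrightarrow> Gamma c) at_top"
  proof (rule tendsto_sandwich[where h = "\<lambda>_. Gamma c"])
    have "((\<lambda>x. Gamma c - real N * Gamma (c + 1) * inverse x) \<longlongrightarrow> Gamma c - real N * Gamma (c + 1) * 0) at_top"
      by (intro tendsto_intros tendsto_inverse_0_at_top filterlim_ident)
    then show "((\<lambda>x. Gamma c - real N * Gamma (c + 1) / x) \<longlongrightarrow> Gamma c) at_top"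
      by (simp add: divide_inverse)
  qed (use bounds in \<open>auto intro!: eventually_at_top_linorderI[of 1]\<close>)
  then have "((\<lambda>x. x powr c * (exp (- x) * (Beta c a * K x)) / Beta c a) \<longlongrightarrow> Gamma c / Beta c a) at_top"
    using G B by (intro tendsto_intros) auto
  moreover have "x powr c * (exp (- x) * (Beta c a * K x)) / Beta c a = x powr c * exp (- x) * K x" for x
    using G B by simp
  moreover have "Gamma c / Beta c a = Gamma (a + c) / Gamma a" using G B by simp
  ultimately show ?thesis by (simp add: K_def)
qed

text \<open>Watson's lemma with c = \<mu> + \<kappa> + 1/2, so that a + c = 2 \<mu> + 1. The
  condition 1/2 \<le> \<mu> - \<kappa> says a \<ge> 1, which keeps (1 - t)^(a-1) below 1.\<close>

lemma whittaker_M_fun_at_top: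
  assumes "0 \<le> kappa" "1/2 \<le> mu - kappa" "0 < mu"
  shows "((\<lambda>x. whittaker_M_fun kappa mu (of_real (ln x)) / of_real (x powr (- kappa) * exp (x / 2)))
     \<longlongrightarrow> of_real (Gamma (2 * mu + 1) / Gamma (mu - kappa + 1/2))) at_top"
proof -
  define a where "a = mu - kappa + 1/2"
  define c where "c = mu + kappa + 1/2"
  have ac: "1 \<le> a" "0 < c" "a + c = 2 * mu + 1" using assms by (auto simp: a_def c_def)
  define K where "K = (\<lambda>x. \<Sum>n. kummer_coeff a (a + c) n * x ^ n)"
  have sm: "summable (\<lambda>n. kummer_coeff a (a + c) n * x ^ n)" for x :: real
    using kummer_summable[of a "a + c" "of_real x"] ac
    by (simp flip: of_real_power of_real_mult add: summable_of_real_iff)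
  have "((\<lambda>x. complex_of_real (x powr c * exp (- x) * K x)) \<longlongrightarrow> of_real (Gamma (a + c) / Gamma a)) at_top"
    unfolding K_def by (intro tendsto_of_real kummer_at_top ac)
  moreover have "\<forall>\<^sub>F x in at_top. complex_of_real (x powr c * exp (- x) * K x)
      = whittaker_M_fun kappa mu (of_real (ln x)) / of_real (x powr (- kappa) * exp (x / 2))"
  proof (rule eventually_at_top_linorderI[of 1])
    fix x :: real assume x: "1 \<le> x"
    have kx: "kummer a (a + c) (of_real x) = of_real (K x)"
      unfolding kummer_def K_def using suminf_of_real[OF sm[of x], where ?'a = complex] by simp
    have ex: "exp (complex_of_real (ln x)) = of_real x" using x by (simp add: exp_of_real)
    have eq1: "whittaker_M_fun kappa mu (of_real (ln x)) = of_real (x powr (mu + 1/2) * exp (- x / 2) * K x)"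
    proof -
      have "exp (of_real (mu + 1/2) * of_real (ln x) - exp (of_real (ln x)) / 2) = complex_of_real (exp ((mu + 1/2) * ln x - x / 2))"
        unfolding ex by (simp add: exp_of_real[symmetric])
      also have "exp ((mu + 1/2) * ln x - x / 2) = x powr (mu + 1/2) * exp (- x / 2)"
        using x by (simp add: powr_def mult_exp_exp)
      finally show ?thesis using kx unfolding whittaker_M_fun_def ex a_def[symmetric] ac(3)[symmetric] by simp
    qed
    have eq2: "x powr (mu + 1/2) * exp (- x / 2) = x powr c * exp (- x) * (x powr (- kappa) * exp (x / 2))"
    proof -
      have "x powr (mu + 1/2) = x powr c * x powr (- kappa)" by (simp add: c_def flip: powr_add)
      moreover have "exp (- x / 2) = exp (- x) * exp (x / 2)" by (simp add: mult_exp_exp)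
      ultimately show ?thesis by simp
    qed
    show "complex_of_real (x powr c * exp (- x) * K x)
      = whittaker_M_fun kappa mu (of_real (ln x)) / of_real (x powr (- kappa) * exp (x / 2))"
      unfolding eq1 eq2 using x by simp
  qed
  ultimately show ?thesis unfolding a_def[symmetric] ac(3)[symmetric] by (rule Lim_transform_eventually)
qed

section \<open>The coefficients\<close>

definition cpoly :: "real poly \<Rightarrow> complex \<Rightarrow> complex" where
  "cpoly p = poly (map_poly of_real p)"

lemma cpoly_0 [simp]: "cpoly 0 z = 0"
  by (simp add: cpoly_def)

lemma cpoly_pCons [simp]: "cpoly (pCons a p) z = of_real a + z * cpoly p z"
  by (simp add: cpoly_def map_poly_pCons)

lemma cpoly_add [simp]: "cpoly (p + q) z = cpoly p z + cpoly q z"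
proof -
  have "map_poly of_real (p + q) = map_poly of_real p + (map_poly of_real q :: complex poly)"
    by (rule poly_eqI) (simp add: coeff_map_poly)
  then show ?thesis by (simp add: cpoly_def)
qed

lemma cpoly_smult [simp]: "cpoly (smult c p) z = of_real c * cpoly p z"
proof -
  have "map_poly of_real (smult c p) = smult (of_real c) (map_poly of_real p :: complex poly)"
    by (rule poly_eqI) (simp add: coeff_map_poly)
  then show ?thesis by (simp add: cpoly_def)
qed

lemma cpoly_minus [simp]: "cpoly (- p) z = - cpoly p z"
  using cpoly_smult[of "-1" p z] by simp

lemma cpoly_diff [simp]: "cpoly (p - q) z = cpoly p z - cpoly q z"
  using cpoly_add[of p "- q" z] by simp

lemma cpoly_mult [simp]: "cpoly (p * q) z = cpoly p z * cpoly q z"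
  by (induction p) (simp_all add: algebra_simps)

lemma cpoly_sum: "cpoly (sum f A) z = (\<Sum>i\<in>A. cpoly (f i) z)"
  by (induction A rule: infinite_finite_induct) auto

lemma DERIV_cpoly: "(cpoly p has_field_derivative cpoly (pderiv p) z) (at z)"
proof -
  have "map_poly of_real (pderiv p) = pderiv (map_poly of_real p :: complex poly)"
    by (rule poly_eqI) (simp add: coeff_map_poly coeff_pderiv)
  then show ?thesis unfolding cpoly_def by (metis poly_DERIV)
qed

lemma cpoly_altdef: "cpoly p z = (\<Sum>i\<le>degree p. of_real (coeff p i) * z ^ i)"
proof -
  have "degree (map_poly of_real p :: complex poly) = degree p" by (rule degree_map_poly) auto
  then show ?thesis by (simp add: cpoly_def poly_altdef coeff_map_poly)
qed

lemma cpoly_eqI: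
  assumes "infinite A" "\<And>z. z \<in> A \<Longrightarrow> cpoly p z = cpoly q z"
  shows "p = q"
proof -
  have "A \<subseteq> {z. poly (map_poly of_real (p - q)) z = (0::complex)}"
    using assms(2) cpoly_diff[of p q] by (auto simp: cpoly_def)
  then have "infinite {z. poly (map_poly of_real (p - q)) z = (0::complex)}"
    using assms(1) infinite_super by blast
  then have "map_poly of_real (p - q) = (0 :: complex poly)" using poly_roots_finite by blast
  then have "coeff (p - q) i = 0" for i
    using coeff_map_poly[of "of_real :: real \<Rightarrow> complex" "p - q" i] by simp
  then show ?thesis by (metis coeff_0 eq_iff_diff_eq_0 poly_eqI)
qed

definition quad :: "real \<Rightarrow> complex \<Rightarrow> complex" where
  "quad lam z = z ^ 2 - 4 * of_real lam * z + 4"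

text \<open>The polynomial of index 2 s + 1 made explicit: the ansatz z P / Z^(3s+3) is put into the
  recursion for \<open>Fhat\<close>, and Z Z' = z - 2 \<lambda> together with the quadratic Z^2
  clears all denominators.\<close>

fun P_poly :: "real \<Rightarrow> nat \<Rightarrow> real poly" where
  "P_poly lam 0 = 0"
| "P_poly lam (Suc 0) = [:- 8 * lam, 8 - 2 * lam ^ 2, 0, - 1 / 2:]"
| "P_poly lam (Suc (Suc s)) =
     smult (real (3 * Suc s + 3)) ([:0, - 2 * lam, 1:] * P_poly lam (Suc s))
     - (P_poly lam (Suc s) + pCons 0 (pderiv (P_poly lam (Suc s)))) * [:4, - 4 * lam, 1:]
     - smult (1 / 2) (pCons 0 (\<Sum>j = 1..s. P_poly lam j * P_poly lam (Suc s - j)))"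

lemma degree_P_poly: "degree (P_poly lam s) \<le> 2 * s + 1"
proof (induction lam s rule: P_poly.induct)
  case (3 lam s)
  let ?p = "P_poly lam (Suc s)"
  have p: "degree ?p \<le> 2 * s + 3" using 3(1) by simp
  have 1: "degree (smult (real (3 * Suc s + 3)) ([:0, - 2 * lam, 1:] * ?p)) \<le> 2 * s + 5"
    using p by (intro order_trans[OF degree_smult_le] order_trans[OF degree_mult_le]) simp
  have "degree (?p + pCons 0 (pderiv ?p)) \<le> 2 * s + 3"
    using p by (intro degree_add_le) (auto simp: degree_pCons_eq_if degree_pderiv)
  then have 2: "degree ((?p + pCons 0 (pderiv ?p)) * [:4, - 4 * lam, 1:]) \<le> 2 * s + 5"
    by (intro order_trans[OF degree_mult_le]) simp
  have "degree (\<Sum>j = 1..s. P_poly lam j * P_poly lam (Suc s - j)) \<le> 2 * s + 4"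
  proof (rule degree_sum_le)
    fix j assume j: "j \<in> {1..s}"
    then have "degree (P_poly lam j) \<le> 2 * j + 1" "degree (P_poly lam (Suc s - j)) \<le> 2 * (Suc s - j) + 1"
      using 3 by auto
    then show "degree (P_poly lam j * P_poly lam (Suc s - j)) \<le> 2 * s + 4"
      using j by (intro order_trans[OF degree_mult_le]) auto
  qed simp
  then have "degree (smult (1 / 2) (pCons 0 (\<Sum>j = 1..s. P_poly lam j * P_poly lam (Suc s - j)))) \<le> 2 * s + 5"
    by (intro order_trans[OF degree_smult_le]) (auto simp: degree_pCons_eq_if)
  then have "degree (P_poly lam (Suc (Suc s))) \<le> 2 * s + 5"
    unfolding P_poly.simps using 1 2 by (intro degree_diff_le)
  then show ?case by simp
qed auto

lemma continuous_coeff_mult: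
  fixes p q :: "real \<Rightarrow> real poly"
  assumes "\<And>i. continuous_on A (\<lambda>x. coeff (p x) i)" "\<And>i. continuous_on A (\<lambda>x. coeff (q x) i)"
  shows "continuous_on A (\<lambda>x. coeff (p x * q x) i)"
  unfolding coeff_mult by (intro continuous_intros assms)

lemma continuous_coeff_pCons:
  fixes p :: "real \<Rightarrow> real poly"
  assumes "continuous_on A a" "\<And>i. continuous_on A (\<lambda>x. coeff (p x) i)"
  shows "continuous_on A (\<lambda>x. coeff (pCons (a x) (p x)) i)"
  by (cases i) (auto intro: assms)

lemma continuous_coeff_P_poly: "continuous_on UNIV (\<lambda>lam. coeff (P_poly lam s) i)"
proof (induction s arbitrary: i rule: less_induct)
  case (less s)
  consider "s = 0" | "s = 1" | r where "s = Suc (Suc r)" by (metis One_nat_def not0_implies_Suc)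
  then show ?case
  proof cases
    case 3
    have p: "continuous_on UNIV (\<lambda>lam. coeff (P_poly lam (Suc r)) i)" for i using less 3 by simp
    have pr: "continuous_on UNIV (\<lambda>lam. coeff (P_poly lam j * P_poly lam (Suc r - j)) i)" if "j \<in> {1..r}" for i j
      using less 3 that by (intro continuous_coeff_mult) auto
    show ?thesis unfolding 3 P_poly.simps coeff_diff coeff_smult
      by (intro continuous_intros continuous_coeff_mult continuous_coeff_pCons)
        (auto simp: coeff_pderiv coeff_sum intro!: continuous_intros p pr continuous_coeff_pCons)
  qed (auto intro!: continuous_coeff_pCons continuous_intros)
qed

text \<open>Uniformity in \<lambda> comes from compactness: each coefficient depends continuously on
  \<lambda>, and only those up to the degree bound 2 s + 1 can be nonzero.\<close>

lemma P_poly_coeff_bounded: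
  obtains C where "0 \<le> C" "\<And>lam i. lam \<in> {0..1} \<Longrightarrow> \<bar>coeff (P_poly lam s) i\<bar> \<le> C"
proof -
  have "\<exists>C. \<forall>lam\<in>{0..1}. \<bar>coeff (P_poly lam s) i\<bar> \<le> C" for i
  proof -
    have "compact ((\<lambda>lam. coeff (P_poly lam s) i) ` {0..1})"
      by (intro compact_continuous_image continuous_on_subset[OF continuous_coeff_P_poly]) auto
    then show ?thesis using compact_imp_bounded bounded_real by fastforce
  qed
  then obtain C where C: "\<And>i lam. lam \<in> {0..1} \<Longrightarrow> \<bar>coeff (P_poly lam s) i\<bar> \<le> C i" by metis
  have C0: "0 \<le> C i" for i using C[of 0 i] by force
  show ?thesis
  proof (rule that[of "\<Sum>i\<le>2 * s + 1. C i"])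
    show "0 \<le> (\<Sum>i\<le>2 * s + 1. C i)" using C0 by (intro sum_nonneg)
    fix lam :: real and i assume lam: "lam \<in> {0..1}"
    show "\<bar>coeff (P_poly lam s) i\<bar> \<le> (\<Sum>i\<le>2 * s + 1. C i)"
    proof (cases "i \<le> 2 * s + 1")
      case True
      have "C i \<le> (\<Sum>i\<le>2 * s + 1. C i)" using True C0 by (intro member_le_sum) auto
      then show ?thesis using C[OF lam, of i] by linarith
    next
      case False
      then have "coeff (P_poly lam s) i = 0" using degree_P_poly[of lam s] by (intro coeff_eq_0) linarith
      then show ?thesis using C0 by (simp add: sum_nonneg)
    qed
  qed
qed

text \<open>The recursion for \<open>Fhat\<close> differentiates also at points of the real axis,
  where \<open>cut_plane\<close> contains no full neighbourhood. This open set carries Z and its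
  defining equation across the axis.\<close>

definition regular_region :: "real \<Rightarrow> branches \<Rightarrow> complex set" where
  "regular_region lam V = {z. \<exists>e>0. Zrt V holomorphic_on ball z e \<and> (\<forall>w\<in>ball z e. Zrt V w ^ 2 = quad lam w)}"

lemma open_regular_region: "open (regular_region lam V)"
proof (rule openI)
  fix z assume "z \<in> regular_region lam V"
  then obtain e where e: "e > 0" "Zrt V holomorphic_on ball z e" "\<And>w. w \<in> ball z e \<Longrightarrow> Zrt V w ^ 2 = quad lam w"
    by (auto simp: regular_region_def)
  have "y \<in> regular_region lam V" if y: "y \<in> ball z e" for y
  proof -
    obtain d where "d > 0" "ball y d \<subseteq> ball z e" using y open_ball openE by blast
    then show ?thesis using e holomorphic_on_subset unfolding regular_region_def by blast
  qed
  then show "\<exists>e>0. ball z e \<subseteq> regular_region lam V" using e(1) by blast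
qed

lemma regular_region_square: "z \<in> regular_region lam V \<Longrightarrow> Zrt V z ^ 2 = quad lam z"
  by (auto simp: regular_region_def)

text \<open>Near a point of the cut plane the equation for Z^2 is given only in the part of a ball
  lying in \<open>Cplus\<close>. The identity theorem, started at a point q above the axis, extends
  it to the whole ball.\<close>

lemma cut_plane_regular:
  assumes tp: "turning_point_branches lam V"
  shows "cut_plane V \<subseteq> regular_region lam V"
proof
  fix z assume z: "z \<in> cut_plane V"
  have an: "Zrt V analytic_on cut_plane V" and sq: "\<And>z. z \<in> cut_plane V \<Longrightarrow> Zrt V z ^ 2 = quad lam z"
    using tp by (auto simp: turning_point_branches_def quad_def)
  obtain e1 where e1: "e1 > 0" "Zrt V holomorphic_on ball z e1"
    using an z unfolding analytic_on_def by blast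
  have zC: "z \<in> Cplus" and "z \<in> - (closure (Sm1 V) \<inter> closure (S1 V))"
    using z by (auto simp: cut_plane_def gamma2_def)
  moreover have "open (- (closure (Sm1 V) \<inter> closure (S1 V)))" by auto
  ultimately obtain e2 where e2: "e2 > 0" "ball z e2 \<subseteq> - (closure (Sm1 V) \<inter> closure (S1 V))"
    by (meson openE)
  define e where "e = min e1 e2"
  have e: "e > 0" "Zrt V holomorphic_on ball z e" "ball z e \<inter> Cplus \<subseteq> cut_plane V"
    using e1 e2 by (auto simp: e_def cut_plane_def gamma2_def intro: holomorphic_on_subset)
  define q where "q = z + \<i> * of_real (e / 2)"
  have q: "q \<in> ball z e" "0 < Im q" using e zC by (auto simp: q_def dist_norm norm_mult Cplus_iff)
  have "Zrt V w ^ 2 - quad lam w = 0" if w: "w \<in> ball z e" for w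
  proof (rule analytic_continuation[of "\<lambda>w. Zrt V w ^ 2 - quad lam w" "ball z e" "ball z e \<inter> {w. 0 < Im w}" q])
    show "(\<lambda>w. Zrt V w ^ 2 - quad lam w) holomorphic_on ball z e"
      unfolding quad_def by (intro holomorphic_intros e)
    show "q islimpt ball z e \<inter> {w. 0 < Im w}"
      using q by (intro interior_limit_point interiorI[of "ball z e \<inter> {w. 0 < Im w}"] open_Int open_halfspace_Im_gt) auto
    show "Zrt V x ^ 2 - quad lam x = 0" if "x \<in> ball z e \<inter> {w. 0 < Im w}" for x
    proof -
      have "x \<in> Cplus" using that by (auto simp: Cplus_iff)
      then show ?thesis using sq[of x] e(3) that by auto
    qed
  qed (use w q in auto)
  then show "z \<in> regular_region lam V" using e by (auto simp: regular_region_def)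
qed

text \<open>Where Z vanishes and is holomorphic, the derivative of Z^2 vanishes too. This forces z =
  2 \<lambda>, but there the quadratic equals 4 (1 - \<lambda>^2). Hence no branch point is
  regular.\<close>

lemma Zrt_regular:
  assumes lam: "\<bar>lam\<bar> < 1" and z: "z \<in> regular_region lam V"
  shows "Zrt V z \<noteq> 0" and "(Zrt V has_field_derivative (z - 2 * of_real lam) / Zrt V z) (at z)"
proof -
  obtain e where e: "e > 0" "Zrt V holomorphic_on ball z e" "\<And>w. w \<in> ball z e \<Longrightarrow> Zrt V w ^ 2 = quad lam w"
    using z by (auto simp: regular_region_def)
  have D: "(Zrt V has_field_derivative deriv (Zrt V) z) (at z)"
    using e by (intro holomorphic_derivI[of _ "ball z e"]) auto
  have "((\<lambda>w. Zrt V w ^ 2) has_field_derivative 2 * Zrt V z * deriv (Zrt V) z) (at z)"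
    by (auto intro!: derivative_eq_intros D)
  moreover have "((\<lambda>w. Zrt V w ^ 2) has_field_derivative 2 * (z - 2 * of_real lam)) (at z)"
  proof (rule has_field_derivative_transform_within_open[of "quad lam" _ _ "ball z e"])
    show "(quad lam has_field_derivative 2 * (z - 2 * of_real lam)) (at z)"
      unfolding quad_def[abs_def] by (auto intro!: derivative_eq_intros simp: algebra_simps)
  qed (use e in auto)
  ultimately have eq: "2 * Zrt V z * deriv (Zrt V) z = 2 * (z - 2 * of_real lam)"
    by (rule DERIV_unique)
  show nz: "Zrt V z \<noteq> 0"
  proof
    assume Z: "Zrt V z = 0"
    then have "z = of_real (2 * lam)" using eq by simp
    moreover have "quad lam z = 0" using e(1) e(3)[of z] Z by simp
    ultimately have "of_real ((2 * lam) ^ 2 - 4 * lam * (2 * lam) + 4) = (0::complex)" by (simp add: quad_def)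
    then have "lam ^ 2 = 1" unfolding of_real_eq_0_iff by (simp add: power2_eq_square)
    then show False using lam by (simp add: abs_square_eq_1)
  qed
  have "Zrt V z * deriv (Zrt V) z = z - 2 * of_real lam"
    using eq by (metis mult.assoc mult_cancel_left zero_neq_numeral)
  then have "deriv (Zrt V) z = (z - 2 * of_real lam) / Zrt V z"
    using nz by (metis nonzero_mult_div_cancel_left)
  then show "(Zrt V has_field_derivative (z - 2 * of_real lam) / Zrt V z) (at z)" using D by simp
qed

text \<open>The induction runs over the open region, so that the formula for one index may be
  differentiated to reach the next.\<close>

lemma Fhat_eq:
  assumes lam: "\<bar>lam\<bar> < 1" and z: "z \<in> regular_region lam V"
  shows "Fhat lam V s z = z * cpoly (P_poly lam s) z / Zrt V z ^ (3 * s + 3)"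
  using z
proof (induction s arbitrary: z rule: less_induct)
  case (less s)
  note nz = Zrt_regular(1)[OF lam] and DZ = Zrt_regular(2)[OF lam]
  consider "s = 0" | "s = 1" | r where "s = Suc (Suc r)" by (metis One_nat_def not0_implies_Suc)
  then show ?case
  proof cases
    case 2
    then show ?thesis by (simp add: field_simps power2_eq_square power3_eq_cube eval_nat_numeral)
  next
    case 3
    define m where "m = 3 * Suc r + 3"
    define p where "p = P_poly lam (Suc r)"
    define W where "W = Zrt V z"
    have W: "W \<noteq> 0" "W ^ 2 = quad lam z"
      using nz[OF less(2)] regular_region_square[OF less(2)] by (auto simp: W_def)
    have "((\<lambda>z. z * cpoly p z / Zrt V z ^ m) has_field_derivative
        ((1 * cpoly p z + cpoly (pderiv p) z * z) * Zrt V z ^ m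
          - z * cpoly p z * (of_nat m * ((z - 2 * of_real lam) / Zrt V z * Zrt V z ^ (m - Suc 0)))) / (Zrt V z ^ m * Zrt V z ^ m)) (at z)"
      using nz[OF less(2)]
      by (intro DERIV_divide DERIV_mult DERIV_ident DERIV_cpoly DERIV_power DZ less) simp
    moreover have "\<And>w. w \<in> regular_region lam V \<Longrightarrow> z * cpoly p z / Zrt V z ^ m = z * cpoly p z / Zrt V z ^ m" by simp
    ultimately have "(Fhat lam V (Suc r) has_field_derivative
        ((1 * cpoly p z + cpoly (pderiv p) z * z) * W ^ m
          - z * cpoly p z * (of_nat m * ((z - 2 * of_real lam) / W * W ^ (m - Suc 0)))) / (W ^ m * W ^ m)) (at z)"
      unfolding W_def
      by (elim has_field_derivative_transform_within_open[OF _ open_regular_region less(2)])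
        (use less(1)[of "Suc r"] 3 in \<open>auto simp: m_def p_def\<close>)
    then have "deriv (Fhat lam V (Suc r)) z =
        ((1 * cpoly p z + cpoly (pderiv p) z * z) * W ^ m
          - z * cpoly p z * (of_nat m * ((z - 2 * of_real lam) / W * W ^ (m - Suc 0)))) / (W ^ m * W ^ m)"
      by (rule DERIV_imp_deriv)
    also have "\<dots> = ((cpoly p z + z * cpoly (pderiv p) z) * W ^ 2 - of_nat m * z * (z - 2 * of_real lam) * cpoly p z) / W ^ (m + 2)"
    proof -
      have "W ^ m = W ^ Suc (m - Suc 0)" by (simp add: m_def del: power_Suc)
      then have "W ^ m = W * W ^ (m - Suc 0)" by (simp only: power_Suc)
      then show ?thesis using W(1) by (simp add: field_simps power_add power2_eq_square)
    qed
    finally have d: "deriv (Fhat lam V (Suc r)) z = \<dots>" .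
    have s: "(\<Sum>j = 1..r. Fhat lam V j z * Fhat lam V (Suc r - j) z)
        = z ^ 2 * cpoly (\<Sum>j = 1..r. P_poly lam j * P_poly lam (Suc r - j)) z / W ^ (m + 3)"
      unfolding cpoly_sum sum_distrib_left sum_divide_distrib
    proof (rule sum.cong)
      fix j assume j: "j \<in> {1..r}"
      have "Fhat lam V j z * Fhat lam V (Suc r - j) z =
        (z * cpoly (P_poly lam j) z / W ^ (3 * j + 3)) * (z * cpoly (P_poly lam (Suc r - j)) z / W ^ (3 * (Suc r - j) + 3))"
        using less(1)[of j z] less(1)[of "Suc r - j" z] less(2) 3 j by (simp add: W_def)
      also have "\<dots> = z ^ 2 * cpoly (P_poly lam j * P_poly lam (Suc r - j)) z / W ^ ((3 * j + 3) + (3 * (Suc r - j) + 3))"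
        by (simp only: cpoly_mult power_add[of W "3 * j + 3" "3 * (Suc r - j) + 3"]) (simp add: power2_eq_square mult_ac)
      also have "(3 * j + 3) + (3 * (Suc r - j) + 3) = m + 3" using j by (simp add: m_def diff_mult_distrib2)
      finally show "Fhat lam V j z * Fhat lam V (Suc r - j) z = z ^ 2 * cpoly (P_poly lam j * P_poly lam (Suc r - j)) z / W ^ (m + 3)" .
    qed simp
    have alg: "- z / W * ((X * q - B) / W ^ (m + 2)) - z ^ 2 * C / W ^ (m + 3) / 2 = z * (B - X * q - z * C / 2) / W ^ (m + 3)" for X q B C
    proof -
      have "W ^ (m + 3) = W * W ^ (m + 2)" by (simp add: eval_nat_numeral)
      then show ?thesis using W(1) by (simp add: field_simps power2_eq_square)
    qed
    have "Fhat lam V s z = - z / W * (((cpoly p z + z * cpoly (pderiv p) z) * quad lam z - of_nat m * z * (z - 2 * of_real lam) * cpoly p z) / W ^ (m + 2))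
       - z ^ 2 * cpoly (\<Sum>j = 1..r. P_poly lam j * P_poly lam (Suc r - j)) z / W ^ (m + 3) / 2"
      unfolding 3 Fhat.simps d s W_def[symmetric] W(2) ..
    also have "\<dots> = z * (of_nat m * z * (z - 2 * of_real lam) * cpoly p z - (cpoly p z + z * cpoly (pderiv p) z) * quad lam z
        - z * cpoly (\<Sum>j = 1..r. P_poly lam j * P_poly lam (Suc r - j)) z / 2) / W ^ (m + 3)"
      by (rule alg)
    also have "of_nat m * z * (z - 2 * of_real lam) * cpoly p z - (cpoly p z + z * cpoly (pderiv p) z) * quad lam z
        - z * cpoly (\<Sum>j = 1..r. P_poly lam j * P_poly lam (Suc r - j)) z / 2 = cpoly (P_poly lam s) z"
      unfolding 3 P_poly.simps p_def[symmetric] m_def[symmetric] quad_def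
      by (simp add: algebra_simps power2_eq_square)
    finally show ?thesis by (simp add: 3 m_def W_def)
  qed simp
qed


text \<open>Resolves the definite description: existence is the explicit formula, and uniqueness is
  agreement of two polynomials at infinitely many points.\<close>

lemma p_hat_eq:
  assumes tp: "turning_point_branches lam V" and lam: "\<bar>lam\<bar> < 1" and inf: "infinite (cut_plane V)"
  shows "p_hat lam V s = P_poly lam s"
  unfolding p_hat_def
proof (rule the_equality)
  note reg = cut_plane_regular[OF tp]
  show "\<forall>z\<in>cut_plane V. Fhat lam V s z = z * poly (map_poly of_real (P_poly lam s)) z / Zrt V z ^ (3 * s + 3)"
    using reg Fhat_eq[OF lam] by (auto simp: cpoly_def)
  fix p assume p: "\<forall>z\<in>cut_plane V. Fhat lam V s z = z * poly (map_poly of_real p) z / Zrt V z ^ (3 * s + 3)"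
  show "p = P_poly lam s"
  proof (rule cpoly_eqI[OF inf])
    fix z assume z: "z \<in> cut_plane V"
    then have nz: "Zrt V z \<noteq> 0" "z \<noteq> 0"
      using reg Zrt_regular(1)[OF lam] by (auto simp: cut_plane_def Cplus_iff)
    have "z * cpoly p z / Zrt V z ^ (3 * s + 3) = z * cpoly (P_poly lam s) z / Zrt V z ^ (3 * s + 3)"
      using p z reg Fhat_eq[OF lam, of z V s] by (auto simp: cpoly_def)
    then show "cpoly p z = cpoly (P_poly lam s) z" using nz by simp
  qed
qed

section \<open>Behaviour along the positive axis, and primitives of the coefficient
  integrands\<close>

lemma Zrt_of_real:
  assumes tp: "turning_point_branches lam V" and x: "0 < x" "of_real x \<in> cut_plane V"
  shows "Zrt V (of_real x) = of_real (sqrt (x ^ 2 - 4 * lam * x + 4))"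
proof -
  have r: "Zrt V (of_real x) \<in> \<real>" "Re (Zrt V (of_real x)) > 0"
    and sq: "Zrt V (of_real x) ^ 2 = of_real x ^ 2 - 4 * of_real lam * of_real x + 4"
    using tp x by (auto simp: turning_point_branches_def)
  define y where "y = Re (Zrt V (of_real x))"
  have y: "Zrt V (of_real x) = of_real y" using r by (simp add: y_def)
  have "complex_of_real (y ^ 2) = of_real (x ^ 2 - 4 * lam * x + 4)" using sq y by simp
  then have "y ^ 2 = x ^ 2 - 4 * lam * x + 4" by (simp only: of_real_eq_iff)
  then show ?thesis using y r by (metis less_imp_le real_sqrt_unique y_def)
qed

lemma Zrt_at_top:
  assumes tp: "turning_point_branches lam V" and ev: "\<forall>\<^sub>F x in at_top. of_real x \<in> cut_plane V"
    and mr: "m \<le> r"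
  shows "((\<lambda>x. (of_real x - of_real c) ^ m / Zrt V (of_real x) ^ r) \<longlongrightarrow> (if m < r then 0 else 1)) at_top"
proof -
  have "((\<lambda>x::real. (x - c) / sqrt (x ^ 2 - 4 * lam * x + 4)) \<longlongrightarrow> 1) at_top" by real_asymp
  then have 1: "((\<lambda>x::real. ((x - c) / sqrt (x ^ 2 - 4 * lam * x + 4)) ^ m) \<longlongrightarrow> 1 ^ m) at_top"
    by (rule tendsto_power)
  have "((\<lambda>x::real. 1 / sqrt (x ^ 2 - 4 * lam * x + 4)) \<longlongrightarrow> 0) at_top" by real_asymp
  then have "((\<lambda>x::real. (1 / sqrt (x ^ 2 - 4 * lam * x + 4)) ^ (r - m)) \<longlongrightarrow> 0 ^ (r - m)) at_top"
    by (rule tendsto_power)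
  with 1 have "((\<lambda>x::real. ((x - c) / sqrt (x ^ 2 - 4 * lam * x + 4)) ^ m * (1 / sqrt (x ^ 2 - 4 * lam * x + 4)) ^ (r - m)) \<longlongrightarrow> 1 ^ m * 0 ^ (r - m)) at_top"
    by (rule tendsto_mult)
  then have "((\<lambda>x::real. complex_of_real (((x - c) / sqrt (x ^ 2 - 4 * lam * x + 4)) ^ m * (1 / sqrt (x ^ 2 - 4 * lam * x + 4)) ^ (r - m)))
      \<longlongrightarrow> of_real (1 ^ m * 0 ^ (r - m))) at_top"
    by (rule tendsto_of_real)
  moreover have "complex_of_real (1 ^ m * 0 ^ (r - m)) = (if m < r then 0 else 1)" using mr by auto
  moreover have "\<forall>\<^sub>F x in at_top. complex_of_real (((x - c) / sqrt (x ^ 2 - 4 * lam * x + 4)) ^ m * (1 / sqrt (x ^ 2 - 4 * lam * x + 4)) ^ (r - m))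
     = (of_real x - of_real c) ^ m / Zrt V (of_real x) ^ r"
    using ev eventually_gt_at_top[of 0]
  proof eventually_elim
    case (elim x)
    have "r = m + (r - m)" using mr by simp
    then have "Zrt V (of_real x) ^ r = Zrt V (of_real x) ^ m * Zrt V (of_real x) ^ (r - m)" by (metis power_add)
    then show ?case using Zrt_of_real[OF tp elim(2,1)] by (simp add: power_divide)
  qed
  ultimately show ?thesis using Lim_transform_eventually by fastforce
qed

text \<open>\<open>integral_from_infinity\<close> asks for one limit over all families of paths. A
  primitive on the whole region gives independence of the path without any knowledge of the
  topology, and its limit along the positive axis gives convergence.\<close>

definition tame_primitive :: "real \<Rightarrow> branches \<Rightarrow> (complex \<Rightarrow> complex) \<Rightarrow> bool" where
  "tame_primitive lam V g \<longleftrightarrow> (\<exists>G L. (\<forall>z\<in>regular_region lam V - {0}. (G has_field_derivative g z) (at z)) \<and>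
     ((\<lambda>x. G (of_real x)) \<longlongrightarrow> L) at_top)"

lemma tame_primitive_add:
  assumes "tame_primitive lam V f" "tame_primitive lam V g"
  shows "tame_primitive lam V (\<lambda>z. f z + g z)"
proof -
  obtain F K where F: "\<And>z. z \<in> regular_region lam V - {0} \<Longrightarrow> (F has_field_derivative f z) (at z)" "((\<lambda>x. F (of_real x)) \<longlongrightarrow> K) at_top"
    using assms(1) unfolding tame_primitive_def by blast
  obtain G L where G: "\<And>z. z \<in> regular_region lam V - {0} \<Longrightarrow> (G has_field_derivative g z) (at z)" "((\<lambda>x. G (of_real x)) \<longlongrightarrow> L) at_top"
    using assms(2) unfolding tame_primitive_def by blast
  show ?thesis unfolding tame_primitive_def
    by (rule exI[of _ "\<lambda>z. F z + G z"], rule exI[of _ "K + L"]) (auto intro!: derivative_intros tendsto_intros F G)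
qed

lemma tame_primitive_scale:
  assumes "tame_primitive lam V f"
  shows "tame_primitive lam V (\<lambda>z. c * f z)"
proof -
  obtain F K where F: "\<And>z. z \<in> regular_region lam V - {0} \<Longrightarrow> (F has_field_derivative f z) (at z)" "((\<lambda>x. F (of_real x)) \<longlongrightarrow> K) at_top"
    using assms(1) unfolding tame_primitive_def by blast
  show ?thesis unfolding tame_primitive_def
    by (rule exI[of _ "\<lambda>z. c * F z"], rule exI[of _ "c * K"]) (auto intro!: DERIV_cmult tendsto_intros F)
qed

lemma tame_primitive_cong:
  assumes "tame_primitive lam V f" "\<And>z. z \<in> regular_region lam V \<Longrightarrow> z \<noteq> 0 \<Longrightarrow> f z = g z"
  shows "tame_primitive lam V g"
  using assms unfolding tame_primitive_def by (metis (no_types, lifting) DiffE insertI1)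

lemma tame_primitive_sum:
  assumes "finite I" "\<And>i. i \<in> I \<Longrightarrow> tame_primitive lam V (f i)"
  shows "tame_primitive lam V (\<lambda>z. \<Sum>i\<in>I. f i z)"
  using assms
proof (induction I rule: finite_induct)
  case empty
  show ?case unfolding tame_primitive_def by (rule exI[of _ "\<lambda>_. 0"], rule exI[of _ 0]) auto
qed (auto intro: tame_primitive_add)

text \<open>With \<open>t = z - 2 \<lambda>\<close> and \<open>Z\<^sup>2 = t\<^sup>2 + a\<close>, the derivative of \<open>t^m / Z^r\<close> is
  \<open>((m - r) t^(m+1) + a m t^(m-1)) / Z^(r+2)\<close>; this reduces \<open>t^j / Z^n\<close> to lower \<open>j\<close> or \<open>n\<close>.\<close>

lemma tame_primitive_basic:
  assumes tp: "turning_point_branches lam V" and ev: "\<forall>\<^sub>F x in at_top. of_real x \<in> cut_plane V"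
    and lam: "\<bar>lam\<bar> < 1" and mr: "m \<le> r"
  shows "tame_primitive lam V (\<lambda>z. ((of_nat m - of_nat r) * (z - 2 * of_real lam) ^ Suc m
     + of_real (4 * (1 - lam ^ 2)) * of_nat m * (z - 2 * of_real lam) ^ (m - 1)) / Zrt V z ^ (r + 2))"
  unfolding tame_primitive_def
proof (intro exI conjI ballI)
  show "((\<lambda>x. (of_real x - 2 * of_real lam) ^ m / Zrt V (of_real x) ^ r) \<longlongrightarrow> (if m < r then 0 else 1)) at_top"
    using Zrt_at_top[OF tp ev mr, of "2 * lam"] by simp
  fix z assume "z \<in> regular_region lam V - {0}"
  then have z: "z \<in> regular_region lam V" by simp
  define t where "t = z - 2 * of_real lam"
  define W where "W = Zrt V z"
  define a where "a = complex_of_real (4 * (1 - lam ^ 2))"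
  note nz = Zrt_regular(1)[OF lam z] and DZ = Zrt_regular(2)[OF lam z]
  have W: "W \<noteq> 0" "W ^ 2 = t ^ 2 + a"
    using nz regular_region_square[OF z] by (auto simp: W_def t_def a_def quad_def power2_eq_square algebra_simps)
  have "((\<lambda>z. (z - 2 * of_real lam) ^ m / Zrt V z ^ r) has_field_derivative
      ((of_nat m * ((1 - 0) * (z - 2 * of_real lam) ^ (m - Suc 0))) * Zrt V z ^ r
        - (z - 2 * of_real lam) ^ m * (of_nat r * ((z - 2 * of_real lam) / Zrt V z * Zrt V z ^ (r - Suc 0)))) / (Zrt V z ^ r * Zrt V z ^ r)) (at z)"
    using nz by (intro DERIV_divide DERIV_power DZ DERIV_diff DERIV_ident DERIV_const) simp
  moreover have "((of_nat m * ((1 - 0) * t ^ (m - Suc 0))) * W ^ r - t ^ m * (of_nat r * (t / W * W ^ (r - Suc 0)))) / (W ^ r * W ^ r)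
      = ((of_nat m - of_nat r) * t ^ Suc m + a * of_nat m * t ^ (m - 1)) / W ^ (r + 2)"
  proof -
    have 1: "of_nat r * (t / W * W ^ (r - Suc 0)) = of_nat r * t * W ^ r / W ^ 2"
      using W(1) by (cases r) (auto simp: power2_eq_square)
    have "((of_nat m * ((1 - 0) * t ^ (m - Suc 0))) * W ^ r - t ^ m * (of_nat r * t * W ^ r / W ^ 2)) / (W ^ r * W ^ r)
      = (of_nat m * t ^ (m - 1) * W ^ 2 - t ^ m * of_nat r * t) / (W ^ r * W ^ 2)"
      using W(1) by (simp add: field_simps)
    also have "of_nat m * t ^ (m - 1) * W ^ 2 - t ^ m * of_nat r * t = (of_nat m - of_nat r) * t ^ Suc m + a * of_nat m * t ^ (m - 1)"
      unfolding W(2) by (cases m) (simp_all add: algebra_simps power2_eq_square)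
    finally show ?thesis unfolding 1 by (simp only: power_add)
  qed
  ultimately show "((\<lambda>z. (z - 2 * of_real lam) ^ m / Zrt V z ^ r) has_field_derivative
     ((of_nat m - of_nat r) * (z - 2 * of_real lam) ^ Suc m
     + of_real (4 * (1 - lam ^ 2)) * of_nat m * (z - 2 * of_real lam) ^ (m - 1)) / Zrt V z ^ (r + 2)) (at z)"
    unfolding t_def W_def a_def by simp
qed

text \<open>For j \<ge> 2 the preceding formula lowers j by 2; its leading coefficient m - r is
  nonzero exactly because j \<le> 2 k + 1. The case j = 1 is a derivative outright. For j = 0 the
  exponent of Z is lowered by 2 down to 1 / Z^3, which is the derivative of t / Z up to the constant
  a = 4 (1 - \<lambda>^2).\<close>

lemma tame_primitive_monomial:
  assumes tp: "turning_point_branches lam V" and ev: "\<forall>\<^sub>F x in at_top. of_real x \<in> cut_plane V"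
    and lam: "\<bar>lam\<bar> < 1" and j: "j \<le> 2 * k + 1"
  shows "tame_primitive lam V (\<lambda>z. (z - 2 * of_real lam) ^ j / Zrt V z ^ (2 * k + 3))"
  using j
proof (induction j rule: less_induct)
  case (less j)
  note basic = tame_primitive_basic[OF tp ev lam]
  define a where "a = complex_of_real (4 * (1 - lam ^ 2))"
  have "lam ^ 2 \<noteq> 1" using lam by (simp add: abs_square_eq_1)
  then have a: "a \<noteq> 0" unfolding a_def of_real_eq_0_iff by simp
  consider "j = 0" | "j = 1" | i where "j = Suc (Suc i)" by (metis One_nat_def not0_implies_Suc)
  then show ?case
  proof cases
    case 1
    have "tame_primitive lam V (\<lambda>z. 1 / Zrt V z ^ (2 * k + 3))"
    proof (induction k)
      case 0
      show ?case
        by (rule tame_primitive_cong[OF tame_primitive_scale[OF basic[of 1 1], of "1 / a"]])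
          (use a in \<open>auto simp: a_def numeral_3_eq_3\<close>)
    next
      case (Suc k)
      let ?r = "2 * k + 3"
      have b: "tame_primitive lam V (\<lambda>z. 1 / (a * of_nat ?r) * (((of_nat 1 - of_nat ?r) * (z - 2 * of_real lam) ^ Suc 1
          + a * of_nat 1 * (z - 2 * of_real lam) ^ (1 - 1)) / Zrt V z ^ (?r + 2))
          + (of_nat ?r - 1) / (a * of_nat ?r) * (1 / Zrt V z ^ ?r))"
        unfolding a_def by (intro tame_primitive_add tame_primitive_scale basic Suc) simp
      show ?case
      proof (rule tame_primitive_cong[OF b])
        fix z assume z: "z \<in> regular_region lam V"
        define t where "t = z - 2 * of_real lam"
        define W where "W = Zrt V z"
        have W: "W \<noteq> 0" "t ^ 2 = W ^ 2 - a"
          using Zrt_regular(1)[OF lam z] regular_region_square[OF z] by (auto simp: W_def t_def a_def quad_def power2_eq_square algebra_simps)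
        define R where "R = (of_nat ?r :: complex)"
        have R: "R \<noteq> 0" unfolding R_def of_nat_eq_0_iff by simp
        have "1 / (a * R) * (((1 - R) * t ^ 2 + a) / (W ^ ?r * W ^ 2)) + (R - 1) / (a * R) * (1 / W ^ ?r) = 1 / (W ^ ?r * W ^ 2)"
          unfolding W(2) using W(1) a R by (simp add: field_simps)
        then show "1 / (a * of_nat ?r) * (((of_nat 1 - of_nat ?r) * (z - 2 * of_real lam) ^ Suc 1
          + a * of_nat 1 * (z - 2 * of_real lam) ^ (1 - 1)) / Zrt V z ^ (?r + 2))
          + (of_nat ?r - 1) / (a * of_nat ?r) * (1 / Zrt V z ^ ?r) = 1 / Zrt V z ^ (2 * Suc k + 3)"
          unfolding R_def[symmetric] t_def[symmetric] W_def[symmetric]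
          by (simp add: power2_eq_square power_add numeral_3_eq_3 mult_ac)
      qed
    qed
    then show ?thesis using 1 by simp
  next
    case 2
    have r: "2 * k + 1 + 2 = 2 * k + 3" by simp
    have R: "of_nat (2 * k + 1) \<noteq> (0::complex)" unfolding of_nat_eq_0_iff by simp
    show ?thesis
      by (rule tame_primitive_cong[OF tame_primitive_scale[OF basic[of 0 "2 * k + 1", unfolded r], of "- 1 / of_nat (2 * k + 1)"]])
        (use R 2 in \<open>simp_all add: divide_simps del: of_nat_add of_nat_mult of_nat_Suc\<close>)
  next
    case 3
    have r: "2 * k + 1 + 2 = 2 * k + 3" by simp
    define R where "R = (of_nat (Suc i) - of_nat (2 * k + 1) :: complex)"
    have R: "R \<noteq> 0" unfolding R_def using less.prems 3 by (auto simp: of_nat_diff[symmetric] simp del: of_nat_Suc of_nat_add of_nat_mult)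
    have b: "tame_primitive lam V (\<lambda>z. 1 / R * ((R * (z - 2 * of_real lam) ^ Suc (Suc i)
          + a * of_nat (Suc i) * (z - 2 * of_real lam) ^ (Suc i - 1)) / Zrt V z ^ (2 * k + 3))
        + (- a * of_nat (Suc i) / R) * ((z - 2 * of_real lam) ^ i / Zrt V z ^ (2 * k + 3)))"
      using basic[of "Suc i" "2 * k + 1", unfolded r] less 3
      by (intro tame_primitive_add tame_primitive_scale) (auto simp: a_def R_def simp del: of_nat_Suc of_nat_add of_nat_mult)
    show ?thesis
    proof (rule tame_primitive_cong[OF b])
      fix z assume z: "z \<in> regular_region lam V"
      have W: "Zrt V z \<noteq> 0" by (rule Zrt_regular(1)[OF lam z])
      have "1 / R * ((R * T + N * U) / X) + (- N / R) * (U / X) = T / X" if "X \<noteq> 0" for T N U X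
        using R that by (simp add: field_simps)
      then show "1 / R * ((R * (z - 2 * of_real lam) ^ Suc (Suc i)
          + a * of_nat (Suc i) * (z - 2 * of_real lam) ^ (Suc i - 1)) / Zrt V z ^ (2 * k + 3))
        + (- a * of_nat (Suc i) / R) * ((z - 2 * of_real lam) ^ i / Zrt V z ^ (2 * k + 3))
        = (z - 2 * of_real lam) ^ j / Zrt V z ^ (2 * k + 3)"
        using W 3 by simp
    qed
  qed
qed

text \<open>For odd s the integrand is a polynomial over Z^(3s+2) with odd exponent. Centred at 2
  \<lambda> it splits into the monomials above, whose degrees 2 s + 1 \<le> 3 s = 2 k + 1 are
  admissible.\<close>

lemma tame_primitive_odd:
  assumes tp: "turning_point_branches lam V" and ev: "\<forall>\<^sub>F x in at_top. of_real x \<in> cut_plane V"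
    and lam: "\<bar>lam\<bar> < 1" and s: "odd s"
  shows "tame_primitive lam V (\<lambda>z. Zrt V z * Fhat lam V s z / z)"
proof -
  define q where "q = pcompose (P_poly lam s) [:2 * lam, 1:]"
  have q: "cpoly q (z - 2 * of_real lam) = cpoly (P_poly lam s) z" for z
  proof -
    have "cpoly (pcompose p [:2 * lam, 1:]) (z - 2 * of_real lam) = cpoly p z" for p
      by (induction p) (simp_all add: pcompose_pCons algebra_simps)
    then show ?thesis by (simp add: q_def)
  qed
  obtain k where k: "3 * s + 2 = 2 * k + 3" using s by (auto elim!: oddE intro: that[of "3 * _ + 1"])
  have deg: "degree q \<le> 2 * k + 1"
    using degree_P_poly[of lam s] k s by (auto simp: q_def degree_pcompose elim!: oddE)
  have "tame_primitive lam V (\<lambda>z. \<Sum>i\<le>degree q. of_real (coeff q i) * ((z - 2 * of_real lam) ^ i / Zrt V z ^ (2 * k + 3)))"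
    using deg by (intro tame_primitive_sum tame_primitive_scale tame_primitive_monomial[OF tp ev lam]) auto
  then show ?thesis
  proof (rule tame_primitive_cong)
    fix z assume z: "z \<in> regular_region lam V" "z \<noteq> 0"
    have "(\<Sum>i\<le>degree q. of_real (coeff q i) * ((z - 2 * of_real lam) ^ i / Zrt V z ^ (2 * k + 3)))
        = cpoly (P_poly lam s) z / Zrt V z ^ (2 * k + 3)"
      by (subst q[symmetric]) (simp add: cpoly_altdef sum_divide_distrib)
    also have "\<dots> = Zrt V z * Fhat lam V s z / z"
      using Fhat_eq[OF lam z(1), of s] Zrt_regular(1)[OF lam z(1)] z(2)
      unfolding k[symmetric] by (simp add: eval_nat_numeral)
    finally show "(\<Sum>i\<le>degree q. of_real (coeff q i) * ((z - 2 * of_real lam) ^ i / Zrt V z ^ (2 * k + 3))) = Zrt V z * Fhat lam V s z / z" .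
  qed
qed

lemma Fhat_at_top:
  assumes tp: "turning_point_branches lam V" and ev: "\<forall>\<^sub>F x in at_top. of_real x \<in> cut_plane V"
    and lam: "\<bar>lam\<bar> < 1"
  shows "((\<lambda>x. Fhat lam V s (of_real x)) \<longlongrightarrow> 0) at_top"
proof -
  let ?p = "P_poly lam s"
  have l: "((\<lambda>x. \<Sum>i\<le>degree ?p. of_real (coeff ?p i) * ((of_real x - of_real 0) ^ Suc i / Zrt V (of_real x) ^ (3 * s + 3)))
      \<longlongrightarrow> (\<Sum>i\<le>degree ?p. of_real (coeff ?p i) * (if Suc i < 3 * s + 3 then 0 else 1))) at_top"
    using degree_P_poly[of lam s] by (intro tendsto_sum tendsto_mult tendsto_const Zrt_at_top[OF tp ev]) auto
  have e0: "(\<Sum>i\<le>degree ?p. of_real (coeff ?p i) * (if Suc i < 3 * s + 3 then 0 else 1)) = (0::complex)"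
    using degree_P_poly[of lam s] by (intro sum.neutral) auto
  have e1: "\<forall>\<^sub>F x in at_top. (\<Sum>i\<le>degree ?p. of_real (coeff ?p i) * ((of_real x - of_real 0) ^ Suc i / Zrt V (of_real x) ^ (3 * s + 3)))
      = Fhat lam V s (of_real x)"
    using ev
  proof eventually_elim
    case (elim x)
    then have "of_real x \<in> regular_region lam V" using cut_plane_regular[OF tp] by blast
    from Fhat_eq[OF lam this, of s] show ?case
      by (simp add: cpoly_altdef sum_distrib_left sum_divide_distrib mult_ac)
  qed
  show ?thesis by (rule Lim_transform_eventually[OF l[unfolded e0] e1])
qed

text \<open>Coefficients of the logarithm of a power series with constant term \<open>1\<close>.\<close>

fun log_coeff :: "(nat \<Rightarrow> complex) \<Rightarrow> nat \<Rightarrow> complex" where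
  "log_coeff h n = h n - (\<Sum>k\<in>{1..<n}. of_nat k * log_coeff h k * h (n - k)) / of_nat n"

declare log_coeff.simps [simp del]

lemma log_coeff_0: "log_coeff h 0 = h 0"
  by (subst log_coeff.simps) simp

lemma sum_split_ends:
  fixes f :: "nat \<Rightarrow> 'a::comm_monoid_add"
  assumes "1 \<le> n"
  shows "(\<Sum>k=0..n. f k) = f 0 + ((\<Sum>k\<in>{1..<n}. f k) + f n)"
proof -
  have "{0..n} = insert 0 (insert n {1..<n})" using assms by auto
  then show ?thesis using assms by (simp add: add_ac)
qed

lemma log_coeff_rec:
  assumes "h 0 = 1"
  shows "of_nat n * h n = (\<Sum>k=0..n. of_nat k * log_coeff h k * h (n - k))"
proof (cases "n = 0")
  case False
  then have "of_nat n * log_coeff h n = of_nat n * h n - (\<Sum>k\<in>{1..<n}. of_nat k * log_coeff h k * h (n - k))"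
    by (subst log_coeff.simps) (simp add: right_diff_distrib)
  then show ?thesis using False assms by (simp add: sum_split_ends)
qed simp

text \<open>As formal power series in an auxiliary variable, the hypothesis on h' says H' = E H, so
  the logarithm of H has derivative E. Since \<open>log_coeff\<close> is defined by recursion, this
  is proved coefficient by coefficient.\<close>

lemma DERIV_log_coeff:
  assumes H: "\<And>n. ((\<lambda>z. H z n) has_field_derivative h' n) (at z0)"
    and H0: "\<And>z. H z 0 = 1" and h'0: "h' 0 = 0" and \<epsilon>0: "\<epsilon> 0 = 0"
    and \<epsilon>: "\<And>n. h' n = (\<Sum>i=0..n. \<epsilon> i * H z0 (n - i))"
    and n: "1 \<le> n"
  shows "((\<lambda>z. log_coeff (H z) n) has_field_derivative \<epsilon> n) (at z0)"
  using n
proof (induction n rule: less_induct)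
  case (less n)
  define g where "g = log_coeff (H z0)"
  \<comment> \<open>Compare coefficients of G1 (E H) = E (G1 H), where G1 H is the Euler derivative
    of H in the auxiliary variable. The weights k and n - k of the two sums add up to n.\<close>
  have id: "(\<Sum>k\<in>{1..<n}. of_nat k * (\<epsilon> k * H z0 (n - k) + h' (n - k) * g k)) = of_nat n * (h' n - \<epsilon> n)"
  proof -
    define E where "E = Abs_fps \<epsilon>"
    define Hs where "Hs = Abs_fps (H z0)"
    define G1 where "G1 = Abs_fps (\<lambda>k. of_nat k * g k)"
    have T: "G1 * Hs = Abs_fps (\<lambda>n. of_nat n * H z0 n)"
      by (rule fps_ext) (simp add: fps_mult_nth G1_def Hs_def g_def log_coeff_rec[of "H z0", OF H0])
    have D: "E * Hs = Abs_fps h'"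
      by (rule fps_ext) (simp add: fps_mult_nth E_def Hs_def \<epsilon>)
    have "G1 * (E * Hs) = E * (G1 * Hs)" by (simp add: mult_ac)
    then have "(G1 * Abs_fps h') $ n = (E * Abs_fps (\<lambda>n. of_nat n * H z0 n)) $ n"
      unfolding T D by simp
    then have 1: "(\<Sum>k=0..n. of_nat k * g k * h' (n - k)) = (\<Sum>k=0..n. \<epsilon> k * (of_nat (n - k) * H z0 (n - k)))"
      by (simp add: fps_mult_nth G1_def E_def)
    have "(\<Sum>k=0..n. of_nat k * (\<epsilon> k * H z0 (n - k))) + (\<Sum>k=0..n. \<epsilon> k * (of_nat (n - k) * H z0 (n - k))) = of_nat n * h' n"
      unfolding \<epsilon>[of n] sum.distrib[symmetric] sum_distrib_left
      by (intro sum.cong) (auto simp: of_nat_diff algebra_simps)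
    then have "(\<Sum>k=0..n. of_nat k * (\<epsilon> k * H z0 (n - k))) + (\<Sum>k=0..n. of_nat k * g k * h' (n - k)) = of_nat n * h' n"
      unfolding 1 .
    then show ?thesis
      unfolding sum_split_ends[OF less.prems] using H0 h'0
      by (simp add: sum.distrib algebra_simps)
  qed
  have eq: "(\<lambda>z. log_coeff (H z) n) = (\<lambda>z. H z n - (\<Sum>k\<in>{1..<n}. of_nat k * log_coeff (H z) k * H z (n - k)) / of_nat n)"
    by (subst log_coeff.simps) simp
  have "((\<lambda>z. H z n - (\<Sum>k\<in>{1..<n}. of_nat k * log_coeff (H z) k * H z (n - k)) / of_nat n) has_field_derivative
      h' n - (\<Sum>k\<in>{1..<n}. of_nat k * (\<epsilon> k * H z0 (n - k) + h' (n - k) * g k)) / of_nat n) (at z0)"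
    unfolding g_def mult.assoc
    by (intro DERIV_diff DERIV_cdivide DERIV_sum DERIV_cmult DERIV_mult less H) auto
  then show ?case unfolding eq id using less.prems by simp
qed

lemma tendsto_log_coeff:
  assumes "\<And>n. ((\<lambda>x. H x n) \<longlongrightarrow> L n) F"
  shows "((\<lambda>x. log_coeff (H x) n) \<longlongrightarrow> log_coeff L n) F"
proof (induction n rule: less_induct)
  case (less n)
  show ?case
  proof (cases "n = 0")
    case True
    then show ?thesis using assms by (simp add: log_coeff_0)
  next
    case False
    then show ?thesis
      unfolding log_coeff.simps[of _ n]
      by (intro tendsto_diff tendsto_divide tendsto_sum tendsto_mult tendsto_const assms less) auto
  qed
qed

lemma sum_even_odd:
  fixes f :: "nat \<Rightarrow> 'a::comm_monoid_add"
  shows "(\<Sum>j<2 * k. f j) = (\<Sum>i<k. f (2 * i)) + (\<Sum>i<k. f (2 * i + 1))"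
  by (induction k) (simp_all add: add_ac)

text \<open>The even coefficients are the logarithmic derivative of \<open>1 + F_1 v + F_3 v^2 + ...\<close>.\<close>

lemma Fhat_even:
  assumes "1 \<le> k"
  shows "(\<Sum>i=0..k. Fhat lam V (2 * i) z * (if i = k then 1 else Fhat lam V (2 * (k - i) - 1) z))
    = - z / Zrt V z * deriv (Fhat lam V (2 * k - 1)) z"
proof -
  define F where "F = (\<lambda>s. Fhat lam V s z)"
  obtain r where k: "k = Suc r" using assms by (cases k) auto
  have F0: "F 0 = 0" by (simp add: F_def)
  have "F (2 * k) = - z / Zrt V z * deriv (Fhat lam V (2 * k - 1)) z - (\<Sum>j = 1..2 * r. F j * F (Suc (2 * r) - j)) / 2"
    by (simp add: k F_def)
  moreover have "(\<Sum>j = 1..2 * r. F j * F (Suc (2 * r) - j)) = (\<Sum>j<2 * k. F j * F (2 * k - 1 - j))"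
  proof -
    have e: "Suc (2 * r) = 2 * k - 1" by (simp add: k)
    show ?thesis unfolding e
    proof (rule sum.mono_neutral_left)
    show "\<forall>j\<in>{..<2 * k} - {1..2 * r}. F j * F (2 * k - 1 - j) = 0"
    proof
      fix j assume "j \<in> {..<2 * k} - {1..2 * r}"
      then have "j = 0 \<or> j = 2 * k - 1" using k by auto
      then show "F j * F (2 * k - 1 - j) = 0" using F0 by auto
    qed
    qed (auto simp: k)
  qed
  \<comment> \<open>The two indices of each product have odd sum, so exactly one is even. Reversing
    the order of summation exchanges the parity classes, and the resulting factor 2 cancels the 1/2
    in the recursion.\<close>
  moreover have "(\<Sum>j<2 * k. F j * F (2 * k - 1 - j)) = 2 * (\<Sum>i<k. F (2 * i) * F (2 * (k - i) - 1))"
  proof -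
    have 1: "(\<Sum>i<k. F (2 * i) * F (2 * k - 1 - 2 * i)) = (\<Sum>i<k. F (2 * i) * F (2 * (k - i) - 1))"
      by (intro sum.cong) (auto simp: diff_mult_distrib2 intro!: arg_cong2[where f = "(*)"] arg_cong[where f = F])
    have "(\<Sum>i<k. F (2 * i + 1) * F (2 * k - 1 - (2 * i + 1))) = (\<Sum>i<k. F (2 * (k - Suc i) + 1) * F (2 * k - 1 - (2 * (k - Suc i) + 1)))"
      by (rule sum.nat_diff_reindex[symmetric])
    also have "\<dots> = (\<Sum>i<k. F (2 * i) * F (2 * (k - i) - 1))"
    proof (rule sum.cong)
      fix i assume i: "i \<in> {..<k}"
      then have "2 * (k - Suc i) + 1 = 2 * (k - i) - 1" "2 * k - 1 - (2 * (k - Suc i) + 1) = 2 * i" by auto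
      then show "F (2 * (k - Suc i) + 1) * F (2 * k - 1 - (2 * (k - Suc i) + 1)) = F (2 * i) * F (2 * (k - i) - 1)"
        by (simp add: mult.commute)
    qed simp
    finally show ?thesis unfolding sum_even_odd 1 by simp
  qed
  ultimately have "F (2 * k) + (\<Sum>i<k. F (2 * i) * F (2 * (k - i) - 1)) = - z / Zrt V z * deriv (Fhat lam V (2 * k - 1)) z"
    by simp
  moreover have "(\<Sum>i=0..k. F (2 * i) * (if i = k then 1 else F (2 * (k - i) - 1)))
      = F (2 * k) + (\<Sum>i<k. F (2 * i) * F (2 * (k - i) - 1))"
  proof -
    have "{0..k} = insert k {..<k}" by auto
    then show ?thesis by (auto intro!: sum.cong)
  qed
  ultimately show ?thesis unfolding F_def by simp
qed

text \<open>For even index Z occurs with even exponent, so termwise integration could produce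
  logarithms. Instead the primitive is minus a coefficient of log(1 + F_1 v + F_3 v^2 + ...), a
  polynomial in the odd coefficients. These tend to 0 at infinity, so the primitive has a
  limit.\<close>

lemma tame_primitive_even:
  assumes tp: "turning_point_branches lam V" and ev: "\<forall>\<^sub>F x in at_top. of_real x \<in> cut_plane V"
    and lam: "\<bar>lam\<bar> < 1" and n: "1 \<le> n"
  shows "tame_primitive lam V (\<lambda>z. Zrt V z * Fhat lam V (2 * n) z / z)"
proof -
  define H where "H = (\<lambda>z k. if k = 0 then 1 else Fhat lam V (2 * k - 1) z)"
  have lim: "((\<lambda>x. H (of_real x) k) \<longlongrightarrow> (if k = 0 then 1 else 0)) at_top" for k
    using Fhat_at_top[OF tp ev lam] by (auto simp: H_def)
  have D: "((\<lambda>z. log_coeff (H z) n) has_field_derivative - (Zrt V z * Fhat lam V (2 * n) z / z)) (at z)"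
    if z: "z \<in> regular_region lam V" "z \<noteq> 0" for z
  proof (rule DERIV_log_coeff[where h' = "\<lambda>k. if k = 0 then 0 else deriv (Fhat lam V (2 * k - 1)) z"
        and \<epsilon> = "\<lambda>k. - (Zrt V z * Fhat lam V (2 * k) z / z)"])
    have nz: "Zrt V z \<noteq> 0" by (rule Zrt_regular(1)[OF lam z(1)])
    show "((\<lambda>z. H z k) has_field_derivative (if k = 0 then 0 else deriv (Fhat lam V (2 * k - 1)) z)) (at z)" for k
    proof (cases "k = 0")
      case False
      have "(\<lambda>z. z * cpoly (P_poly lam s) z / Zrt V z ^ (3 * s + 3)) field_differentiable at z" for s
        using nz by (intro field_differentiable_divide field_differentiable_mult field_differentiable_power field_differentiable_ident)
          (use DERIV_cpoly Zrt_regular(2)[OF lam z(1)] in \<open>auto simp: field_differentiable_def\<close>)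
      then have "Fhat lam V s field_differentiable at z" for s
        unfolding field_differentiable_def
        using has_field_derivative_transform_within_open[OF _ open_regular_region z(1), of _ _ "Fhat lam V s"] Fhat_eq[OF lam, of _ V s]
        by (metis (no_types, lifting))
      then show ?thesis using False by (simp add: H_def DERIV_deriv_iff_field_differentiable)
    qed (simp add: H_def)
    fix k
    show "(if k = 0 then 0 else deriv (Fhat lam V (2 * k - 1)) z) = (\<Sum>i=0..k. - (Zrt V z * Fhat lam V (2 * i) z / z) * H z (k - i))"
    proof (cases "k = 0")
      case False
      have "(\<Sum>i=0..k. - (Zrt V z * Fhat lam V (2 * i) z / z) * H z (k - i))
          = - (Zrt V z / z) * (\<Sum>i=0..k. Fhat lam V (2 * i) z * (if i = k then 1 else Fhat lam V (2 * (k - i) - 1) z))"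
        unfolding sum_distrib_left by (intro sum.cong) (auto simp: H_def)
      also have "\<dots> = deriv (Fhat lam V (2 * k - 1)) z"
        using False nz z(2) by (subst Fhat_even) auto
      finally show ?thesis using False by simp
    qed simp
  qed (use n in \<open>auto simp: H_def\<close>)
  show ?thesis unfolding tame_primitive_def
  proof (intro exI conjI ballI)
    show "((\<lambda>x. - log_coeff (H (of_real x)) n) \<longlongrightarrow> - log_coeff (\<lambda>k. if k = 0 then 1 else 0) n) at_top"
      by (intro tendsto_minus tendsto_log_coeff lim)
    fix z assume "z \<in> regular_region lam V - {0}"
    then show "((\<lambda>z. - log_coeff (H z) n) has_field_derivative Zrt V z * Fhat lam V (2 * n) z / z) (at z)"
      using DERIV_minus[OF D[of z]] by simp
  qed
qed

text \<open>With a primitive G having limit L along the axis, the integral from infinity to x is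
  G(x) - L, which tends to 0.\<close>

lemma Ehat_at_top:
  assumes tp: "turning_point_branches lam V" and pos: "\<And>x. 0 < x \<Longrightarrow> of_real x \<in> cut_plane V"
    and lam: "\<bar>lam\<bar> < 1" and s: "1 \<le> s"
  shows "((\<lambda>x. Ehat lam V s (of_real x)) \<longlongrightarrow> 0) at_top"
proof -
  let ?g = "\<lambda>t. Zrt V t * Fhat lam V s t / t"
  have ev: "\<forall>\<^sub>F x in at_top. of_real x \<in> cut_plane V"
    using eventually_gt_at_top[of 0] by eventually_elim (rule pos)
  have "tame_primitive lam V ?g"
  proof (cases "odd s")
    case False
    then obtain n where "s = 2 * n" "1 \<le> n" using s by (auto elim!: evenE)
    then show ?thesis using tame_primitive_even[OF tp ev lam, of n] by simp
  qed (rule tame_primitive_odd[OF tp ev lam])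
  then obtain G L where G: "\<And>z. z \<in> regular_region lam V - {0} \<Longrightarrow> (G has_field_derivative ?g z) (at z)"
    and L: "((\<lambda>x. G (of_real x)) \<longlongrightarrow> L) at_top"
    unfolding tame_primitive_def by blast
  have G': "(G has_field_derivative ?g z) (at z within cut_plane V)" if "z \<in> cut_plane V" for z
    by (rule has_field_derivative_at_within, rule G)
      (use that cut_plane_regular[OF tp] in \<open>auto simp: cut_plane_def Cplus_iff\<close>)
  have int: "integral_from_infinity (cut_plane V) ?g (of_real x) = G (of_real x) - L" if x: "0 < x" for x
    unfolding integral_from_infinity_def
  proof (rule the_equality)
    have lim: "((\<lambda>R. contour_integral (p R) ?g) \<longlongrightarrow> G (of_real x) - L) at_top"
      if p: "\<forall>R>0. valid_path (p R) \<and> path_image (p R) \<subseteq> cut_plane V \<and> pathstart (p R) = of_real R \<and> pathfinish (p R) = of_real x" for p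
    proof -
      have "((\<lambda>R. G (of_real x) - G (of_real R)) \<longlongrightarrow> G (of_real x) - L) at_top"
        by (intro tendsto_intros L)
      moreover have "\<forall>\<^sub>F R in at_top. G (of_real x) - G (of_real R) = contour_integral (p R) ?g"
        using eventually_gt_at_top[of 0]
      proof eventually_elim
        case (elim R)
        have "(?g has_contour_integral (G (pathfinish (p R)) - G (pathstart (p R)))) (p R)"
          by (rule contour_integral_primitive[OF G']) (use p elim in auto)
        then show ?case using p elim by (simp add: contour_integral_unique)
      qed
      ultimately show ?thesis by (rule Lim_transform_eventually)
    qed
    then show "\<forall>p. (\<forall>R>0. valid_path (p R) \<and> path_image (p R) \<subseteq> cut_plane V \<and> pathstart (p R) = of_real R \<and> pathfinish (p R) = of_real x) \<longrightarrow>
        ((\<lambda>R. contour_integral (p R) ?g) \<longlongrightarrow> G (of_real x) - L) at_top"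
      by blast
    fix I assume I: "\<forall>p. (\<forall>R>0. valid_path (p R) \<and> path_image (p R) \<subseteq> cut_plane V \<and> pathstart (p R) = of_real R \<and> pathfinish (p R) = of_real x) \<longrightarrow>
        ((\<lambda>R. contour_integral (p R) ?g) \<longlongrightarrow> I) at_top"
    \<comment> \<open>Uniqueness of the described limit needs at least one admissible family of
      paths; the segments of the positive axis provide it.\<close>
    have p: "\<forall>R>0. valid_path (linepath (of_real R) (of_real x)) \<and> path_image (linepath (of_real R) (of_real x)) \<subseteq> cut_plane V
        \<and> pathstart (linepath (of_real R) (of_real x)) = complex_of_real R \<and> pathfinish (linepath (of_real R) (of_real x)) = complex_of_real x"
    proof (intro allI impI conjI)
      fix R :: real assume R: "0 < R"
      have "w \<in> cut_plane V" if "w \<in> closed_segment (complex_of_real R) (of_real x)" for w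
      proof -
        have "Im w = 0" "Re w \<in> closed_segment R x" using that by (auto simp: closed_segment_same_Im)
        then have "w = of_real (Re w)" "0 < Re w" using R x by (auto simp: complex_eq_iff closed_segment_eq_real_ivl split: if_splits)
        then show ?thesis using pos by metis
      qed
      then show "path_image (linepath (of_real R) (of_real x)) \<subseteq> cut_plane V" by auto
    qed auto
    show "I = G (of_real x) - L"
      by (rule tendsto_unique[OF trivial_limit_at_top_linorder
            I[THEN spec[of _ "\<lambda>R. linepath (of_real R) (of_real x)"], THEN mp, OF p]
            lim[of "\<lambda>R. linepath (of_real R) (of_real x)", OF p]])
  qed
  have "((\<lambda>x. (G (of_real x) - L) / 2) \<longlongrightarrow> (L - L) / 2) at_top" by (intro tendsto_intros L) simp
  moreover have "\<forall>\<^sub>F x in at_top. (G (of_real x) - L) / 2 = Ehat lam V s (of_real x)"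
    using eventually_gt_at_top[of 0] by eventually_elim (simp add: Ehat_def int)
  ultimately have "((\<lambda>x. Ehat lam V s (of_real x)) \<longlongrightarrow> (L - L) / 2) at_top" by (rule Lim_transform_eventually)
  then show ?thesis by simp
qed


text \<open>For \<lambda> \<le> 1 - d one has \<open>Ztilde\<close> \<ge> 2 sqrt d, so only growth
  for large \<open>Ztilde\<close> matters. For k \<ge> 1 the degree N = 4 k + 3 stays below the
  exponent n = 6 k + 2. For k = 0 it does not, but passing to the even part removes the cubic
  term.\<close>

lemma Ehat_inf_bounded:
  assumes d: "0 < d" "d < 1"
  obtains C where "\<And>lam V. \<lbrakk>lam \<in> {0..1-d}; turning_point_branches lam V; infinite (cut_plane V)\<rbrakk> \<Longrightarrow> \<bar>Ehat_inf lam V k\<bar> \<le> C"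
proof -
  define y0 where "y0 = 2 * sqrt d"
  have y0: "0 < y0" using d by (simp add: y0_def)
  obtain C0 where C0: "0 \<le> C0" "\<And>lam i. lam \<in> {0..1} \<Longrightarrow> \<bar>coeff (P_poly lam (2 * k + 1)) i\<bar> \<le> C0"
    using P_poly_coeff_bounded by blast
  define n where "n = 6 * k + 2"
  define N where "N = 4 * k + 3"
  define B where "B = (if k = 0 then 16 / y0 ^ 2 + 3 else real (Suc N) * C0 * ((1 + 2 / y0) ^ N * (1 / y0) ^ (n - N)))"
  have B0: "0 \<le> B" using y0 C0 by (auto simp: B_def)
  have key: "\<bar>(poly (P_poly lam (2 * k + 1)) (b * y + 2 * lam) + poly (P_poly lam (2 * k + 1)) (- (b * y) + 2 * lam)) / 2 / y ^ n\<bar> \<le> B"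
    if lam: "lam \<in> {0..1}" and b: "b \<in> {0..1}" and y: "y0 \<le> y" for lam b y
  proof -
    have ypos: "0 < y" using y y0 by linarith
    show ?thesis
    proof (cases "k = 0")
      case True
      have "(poly (P_poly lam (2 * k + 1)) (b * y + 2 * lam) + poly (P_poly lam (2 * k + 1)) (- (b * y) + 2 * lam)) / 2
          = 8 * lam * (1 - lam ^ 2) - 3 * lam * b ^ 2 * y ^ 2"
        using True by (simp add: field_simps power2_eq_square power3_eq_cube)
      moreover have "\<bar>8 * lam * (1 - lam ^ 2)\<bar> \<le> 16"
      proof -
        have "lam ^ 2 \<le> 1" using lam by (simp add: power_le_one)
        then have "lam * (1 - lam ^ 2) \<le> 1 * 1" using lam by (intro mult_mono) auto
        moreover have "0 \<le> lam * (1 - lam ^ 2)" using lam \<open>lam ^ 2 \<le> 1\<close> by simp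
        ultimately show ?thesis by (simp add: abs_le_iff)
      qed
      moreover have "\<bar>3 * lam * b ^ 2 * y ^ 2\<bar> \<le> 3 * y ^ 2"
      proof -
        have "lam * b ^ 2 \<le> 1 * 1" using lam b by (intro mult_mono) (auto simp: power_le_one)
        then have "(lam * b ^ 2) * y ^ 2 \<le> 1 * y ^ 2" by (intro mult_right_mono) auto
        then show ?thesis using lam by (simp add: abs_mult mult.assoc)
      qed
      ultimately have Y: "\<bar>(poly (P_poly lam (2 * k + 1)) (b * y + 2 * lam) + poly (P_poly lam (2 * k + 1)) (- (b * y) + 2 * lam)) / 2\<bar> \<le> 16 + 3 * y ^ 2"
        by linarith
      have n2: "n = 2" using True by (simp add: n_def)
      have "\<bar>(poly (P_poly lam (2 * k + 1)) (b * y + 2 * lam) + poly (P_poly lam (2 * k + 1)) (- (b * y) + 2 * lam)) / 2 / y ^ n\<bar> \<le> (16 + 3 * y ^ 2) / y ^ 2"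
        unfolding n2 abs_divide[of _ "y ^ 2"] abs_power2 by (rule divide_right_mono[OF Y]) simp
      also have "\<dots> = 16 / y ^ 2 + 3" using ypos by (simp add: add_divide_distrib)
      also have "\<dots> \<le> B" using True y y0 by (auto simp: B_def intro!: divide_left_mono power_mono)
      finally show ?thesis .
    next
      case False
      have bound: "\<bar>poly (P_poly lam (2 * k + 1)) \<tau>\<bar> \<le> real (Suc N) * C0 * (y + 2) ^ N" if "\<bar>\<tau>\<bar> \<le> y + 2" for \<tau>
      proof -
        have deg: "degree (P_poly lam (2 * k + 1)) \<le> N" using degree_P_poly[of lam "2 * k + 1"] by (simp add: N_def)
        have "poly (P_poly lam (2 * k + 1)) \<tau> = (\<Sum>i\<le>N. coeff (P_poly lam (2 * k + 1)) i * \<tau> ^ i)"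
          unfolding poly_altdef using deg by (intro sum.mono_neutral_left) (auto intro!: coeff_eq_0)
        also have "\<bar>\<dots>\<bar> \<le> (\<Sum>i\<le>N. C0 * (y + 2) ^ N)"
        proof (rule order_trans[OF sum_abs], rule sum_mono)
          fix i assume i: "i \<in> {..N}"
          have "\<bar>\<tau>\<bar> ^ i \<le> (y + 2) ^ i" using that by (intro power_mono) auto
          also have "\<dots> \<le> (y + 2) ^ N" using i ypos by (intro power_increasing) auto
          finally show "\<bar>coeff (P_poly lam (2 * k + 1)) i * \<tau> ^ i\<bar> \<le> C0 * (y + 2) ^ N"
            unfolding abs_mult power_abs using C0 lam by (intro mult_mono) auto
        qed
        finally show ?thesis by (simp add: algebra_simps)
      qed
      have by1: "0 \<le> b * y" "b * y \<le> y" using b ypos by (auto intro: mult_left_le_one_le)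
      have "\<bar>(poly (P_poly lam (2 * k + 1)) (b * y + 2 * lam) + poly (P_poly lam (2 * k + 1)) (- (b * y) + 2 * lam)) / 2\<bar>
          \<le> real (Suc N) * C0 * (y + 2) ^ N"
      proof -
        have half: "\<bar>(u + v) / 2\<bar> \<le> c" if "\<bar>u\<bar> \<le> c" "\<bar>v\<bar> \<le> c" for u v c :: real
          using that by (simp add: abs_le_iff)
        show ?thesis by (intro half bound) (use by1 lam in \<open>auto simp: abs_le_iff\<close>)
      qed
      then have "\<bar>(poly (P_poly lam (2 * k + 1)) (b * y + 2 * lam) + poly (P_poly lam (2 * k + 1)) (- (b * y) + 2 * lam)) / 2 / y ^ n\<bar>
          \<le> real (Suc N) * C0 * (y + 2) ^ N / y ^ n"
        using ypos unfolding abs_divide[of _ "y ^ n"] by (intro divide_mono) auto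
      also have "\<dots> = real (Suc N) * C0 * (((y + 2) / y) ^ N * (1 / y) ^ (n - N))"
      proof -
        have "n = N + (n - N)" using False by (simp add: n_def N_def)
        then have "y ^ n = y ^ N * y ^ (n - N)" by (metis power_add)
        then show ?thesis by (simp add: power_divide)
      qed
      also have "\<dots> \<le> B"
      proof -
        have "(y + 2) / y = 1 + 2 / y" using ypos by (simp add: add_divide_distrib)
        also have "\<dots> \<le> 1 + 2 / y0" using y y0 by (intro add_left_mono divide_left_mono) auto
        finally have 1: "(y + 2) / y \<le> 1 + 2 / y0" .
        have 2: "1 / y \<le> 1 / y0" using y y0 by (intro divide_left_mono) auto
        have "((y + 2) / y) ^ N * (1 / y) ^ (n - N) \<le> (1 + 2 / y0) ^ N * (1 / y0) ^ (n - N)"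
          using 1 2 ypos y0 by (intro mult_mono power_mono) auto
        then show ?thesis unfolding B_def using False C0 by (simp add: mult_left_mono)
      qed
      finally show ?thesis .
    qed
  qed
  show ?thesis
  proof (rule that[of "1 / (8 * d) * B"])
    fix lam V assume lam: "lam \<in> {0..1-d}" and tp: "turning_point_branches lam V" and inf: "infinite (cut_plane V)"
    have lam1: "\<bar>lam\<bar> < 1" "lam \<in> {0..1}" using lam d by auto
    have "lam * lam \<le> (1 - d) * 1" using lam lam1 by (intro mult_mono) auto
    then have l2: "d \<le> 1 - lam ^ 2" by (simp add: power2_eq_square)
    let ?h = "\<lambda>b. p_even lam V k (b * Ztilde lam b) / Ztilde lam b ^ (6 * k + 2)"
    have h: "\<bar>?h b\<bar> \<le> B" if b: "b \<in> {0..1}" for b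
    proof (cases "b = 1")
      case True
      \<comment> \<open>At b = 1 division by zero makes \<open>Ztilde\<close> equal to 0, and with
        it the whole quotient.\<close>
      then show ?thesis using B0 by (simp add: Ztilde_def)
    next
      case False
      then have b1: "0 < 1 - b ^ 2" "1 - b ^ 2 \<le> 1" using b by (auto simp: power_less_one_iff abs_square_less_1)
      have "d * (1 - b ^ 2) \<le> (1 - lam ^ 2) * 1" using l2 b1 d by (intro mult_mono) auto
      then have "d \<le> (1 - lam ^ 2) / (1 - b ^ 2)" using b1 by (simp add: field_simps)
      then have "y0 \<le> Ztilde lam b" by (simp add: y0_def Ztilde_def)
      from key[OF lam1(2) b this] show ?thesis
        by (simp add: p_even_def p_hat_eq[OF tp lam1(1) inf] n_def)
    qed
    have "\<bar>integral {0..1} ?h\<bar> \<le> B"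
    proof (cases "?h integrable_on {0..1}")
      case True
      have "norm (integral {0..1} ?h) \<le> integral {0..1} (\<lambda>b::real. B)"
        by (rule integral_norm_bound_integral[OF True]) (use h in auto)
      then show ?thesis by simp
    \<comment> \<open>Without integrability the integral is 0 by convention, which also satisfies
      the bound.\<close>
    qed (use B0 in \<open>simp add: not_integrable_integral\<close>)
    moreover have "1 / (8 * (1 - lam ^ 2)) \<le> 1 / (8 * d)" using l2 d by (intro divide_left_mono) auto
    moreover have "0 \<le> 1 / (8 * (1 - lam ^ 2))" using l2 d by simp
    ultimately have "(1 / (8 * (1 - lam ^ 2))) * \<bar>integral {0..1} ?h\<bar> \<le> 1 / (8 * d) * B"
      using d by (intro mult_mono) auto
    then show "\<bar>Ehat_inf lam V k\<bar> \<le> 1 / (8 * d) * B"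
      unfolding Ehat_inf_def abs_mult using l2 d by simp
  qed
qed

section \<open>The branches on the positive axis\<close>

text \<open>The power jumps across the negative axis, but its real part depends only on |w| and Re w
  and is continuous everywhere. Hence Re \<xi> is continuous on all of \<open>Cplus\<close>,
  including \<open>gamma2\<close>.\<close>

lemma Re_powr_three_halves:
  "Re (w powr (3/2)) = sqrt ((cmod w + Re w) / 2) * (2 * Re w - cmod w)"
proof (cases "w = 0")
  case False
  define s where "s = csqrt w"
  have w: "w = s ^ 2" by (simp add: s_def)
  have "w powr (3/2) = exp (3 * (Ln w / 2))" using False by (simp add: powr_def)
  also have "\<dots> = exp (Ln w / 2) ^ 3" using exp_of_nat_mult[of 3 "Ln w / 2"] by simp
  also have "exp (Ln w / 2) = s" using False by (simp add: s_def csqrt_exp_Ln)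
  finally have p: "w powr (3/2) = s ^ 3" .
  have 1: "Re s = sqrt ((cmod w + Re w) / 2)" by (simp add: s_def)
  have n: "cmod w = (Re s)\<^sup>2 + (Im s)\<^sup>2" by (simp add: w norm_power cmod_power2)
  have r: "Re w = (Re s)\<^sup>2 - (Im s)\<^sup>2" by (simp add: w Re_power2)
  have "Re (s ^ 3) = Re s * ((Re s)\<^sup>2 - 3 * (Im s)\<^sup>2)"
    by (simp add: power3_eq_cube power2_eq_square algebra_simps)
  also have "(Re s)\<^sup>2 - 3 * (Im s)\<^sup>2 = 2 * Re w - cmod w" unfolding n r by simp
  finally show ?thesis unfolding p 1 .
qed simp

lemma Re_xi: "Re (xi V z) = 2/3 * (sqrt ((cmod (zeta V z) + Re (zeta V z)) / 2) * (2 * Re (zeta V z) - cmod (zeta V z)))"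
  unfolding xi_def by (simp add: Re_powr_three_halves Re_divide_numeral)

lemma continuous_on_Re_xi:
  assumes "turning_point_branches lam V"
  shows "continuous_on Cplus (\<lambda>z. Re (xi V z))"
proof -
  have "zeta V analytic_on Cplus" using assms by (simp add: turning_point_branches_def)
  then have "continuous_on Cplus (zeta V)"
    by (intro holomorphic_on_imp_continuous_on analytic_imp_holomorphic)
  then show ?thesis unfolding Re_xi by (intro continuous_intros) auto
qed

section \<open>The real form of \<xi> on the positive axis\<close>

definition Z_real :: "real \<Rightarrow> real \<Rightarrow> real" where
  "Z_real lam x = sqrt (x ^ 2 - 4 * lam * x + 4)"

definition xi_real :: "real \<Rightarrow> real \<Rightarrow> real" where
  "xi_real lam x = Z_real lam x / 2 - lam * ln ((Z_real lam x + x - 2 * lam) / 2)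
     - ln ((Z_real lam x - lam * x + 2) / x) + (1 + lam) * ln (1 - lam ^ 2) / 2"

text \<open>Both logarithms have positive arguments because Z^2 - (x - 2 \<lambda>)^2 = 4 (1 -
  \<lambda>^2) and Z^2 - (\<lambda> x - 2)^2 = (1 - \<lambda>^2) x^2 are positive.\<close>

lemma Z_real_facts:
  assumes lam: "\<bar>lam\<bar> < 1" and x: "0 < x"
  shows "Z_real lam x ^ 2 = x ^ 2 - 4 * lam * x + 4" "0 < x ^ 2 - 4 * lam * x + 4" "0 < Z_real lam x"
    "0 < Z_real lam x + x - 2 * lam" "0 < Z_real lam x - lam * x + 2"
proof -
  have l: "lam ^ 2 < 1" using lam by (simp add: abs_square_less_1)
  have e: "x ^ 2 - 4 * lam * x + 4 = (x - 2 * lam) ^ 2 + 4 * (1 - lam ^ 2)" by (simp add: power2_eq_square algebra_simps)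
  show p: "0 < x ^ 2 - 4 * lam * x + 4" unfolding e using l by (intro add_nonneg_pos) auto
  then show sq: "Z_real lam x ^ 2 = x ^ 2 - 4 * lam * x + 4" by (simp add: Z_real_def)
  show pos: "0 < Z_real lam x" using p by (simp add: Z_real_def)
  have "\<bar>x - 2 * lam\<bar> < Z_real lam x"
    by (rule power2_less_imp_less) (use l pos in \<open>auto simp: sq e\<close>)
  then show "0 < Z_real lam x + x - 2 * lam" by linarith
  have "0 < x ^ 2 * (1 - lam ^ 2)" using l x by simp
  then have "\<bar>lam * x - 2\<bar> ^ 2 < Z_real lam x ^ 2" unfolding sq by (simp add: power2_eq_square algebra_simps)
  then have "\<bar>lam * x - 2\<bar> < Z_real lam x" by (rule power2_less_imp_less) (use pos in simp)
  then show "0 < Z_real lam x - lam * x + 2" by linarith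
qed

lemma DERIV_xi_real:
  assumes lam: "\<bar>lam\<bar> < 1" and x: "0 < x"
  shows "(xi_real lam has_real_derivative Z_real lam x / (2 * x)) (at x)"
proof -
  note Z = Z_real_facts[OF lam x]
  define W where "W = Z_real lam x"
  have dZ: "(Z_real lam has_real_derivative (x - 2 * lam) / W) (at x)"
    unfolding Z_real_def[abs_def] W_def using Z(2)
    by (auto intro!: derivative_eq_intros simp: field_simps)
  have inA: "((\<lambda>x. (Z_real lam x + x - 2 * lam) / 2) has_real_derivative ((x - 2 * lam) / W + 1 - 0) / 2) (at x)"
    by (intro DERIV_cdivide DERIV_diff DERIV_add dZ DERIV_ident DERIV_const)
  have dA: "((\<lambda>x. ln ((Z_real lam x + x - 2 * lam) / 2)) has_real_derivative
      1 / ((W + x - 2 * lam) / 2) * (((x - 2 * lam) / W + 1 - 0) / 2)) (at x)"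
    unfolding W_def by (rule DERIV_chain2[OF DERIV_ln_divide inA[unfolded W_def]]) (use Z in simp)
  have inB: "((\<lambda>x. (Z_real lam x - lam * x + 2) / x) has_real_derivative
      (((x - 2 * lam) / W - lam * 1 + 0) * x - (W - lam * x + 2) * 1) / (x * x)) (at x)"
    unfolding W_def using x
    by (intro DERIV_divide DERIV_add DERIV_diff DERIV_cmult dZ[unfolded W_def] DERIV_ident DERIV_const) simp
  have dB: "((\<lambda>x. ln ((Z_real lam x - lam * x + 2) / x)) has_real_derivative
      1 / ((W - lam * x + 2) / x) * ((((x - 2 * lam) / W - lam * 1 + 0) * x - (W - lam * x + 2) * 1) / (x * x))) (at x)"
    unfolding W_def by (rule DERIV_chain2[OF DERIV_ln_divide inB[unfolded W_def]]) (use Z x in simp)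
  have "(xi_real lam has_real_derivative
      (x - 2 * lam) / W / 2 - lam * (1 / ((W + x - 2 * lam) / 2) * (((x - 2 * lam) / W + 1 - 0) / 2))
      - 1 / ((W - lam * x + 2) / x) * ((((x - 2 * lam) / W - lam * 1 + 0) * x - (W - lam * x + 2) * 1) / (x * x)) + 0) (at x)"
    unfolding xi_real_def[abs_def]
    by (intro DERIV_add DERIV_diff DERIV_cdivide DERIV_cmult dZ dA dB DERIV_const)
  moreover have "(x - 2 * lam) / W / 2 - lam * (1 / ((W + x - 2 * lam) / 2) * (((x - 2 * lam) / W + 1 - 0) / 2))
      - 1 / ((W - lam * x + 2) / x) * ((((x - 2 * lam) / W - lam * 1 + 0) * x - (W - lam * x + 2) * 1) / (x * x)) + 0 = W / (2 * x)"
  proof -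
    have W: "W \<noteq> 0" "W + x - 2 * lam \<noteq> 0" "W - lam * x + 2 \<noteq> 0" "W ^ 2 = x ^ 2 - 4 * lam * x + 4" "x \<noteq> 0"
      using Z x by (auto simp: W_def)
    define D where "D = W - lam * x + 2"
    have D: "D \<noteq> 0" using W by (simp add: D_def)
    have 1: "1 / ((W + x - 2 * lam) / 2) * (((x - 2 * lam) / W + 1 - 0) / 2) = 1 / W"
      using W(1,2) by (simp add: divide_simps)
    \<comment> \<open>The equation for W^2 makes the denominator D of the second logarithmic
      derivative a factor of its numerator, so D cancels.\<close>
    have "x * ((x - 2 * lam) - lam * W) = D * (W - 2)"
      using W(4) by (simp add: D_def power2_eq_square algebra_simps)
    then have 2: "((x - 2 * lam) / W - lam * 1 + 0) * x = D * (W - 2) / W" using W(1) by (simp add: field_simps)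
    have 3: "1 / (D / x) * ((D * (W - 2) / W - D * 1) / (x * x)) = (W - 2) / (W * x) - 1 / x"
      using D W(1,5) by (simp add: field_simps)
    have "(x - 2 * lam) / W / 2 - lam * (1 / W) - ((W - 2) / (W * x) - 1 / x) + 0 = (x ^ 2 - 4 * lam * x + 4) / (2 * x * W)"
      using W(1,5) by (simp add: field_simps power2_eq_square)
    also have "\<dots> = W / (2 * x)" unfolding W(4)[symmetric] using W(1) by (simp add: power2_eq_square)
    finally show ?thesis unfolding 1 D_def[symmetric] 2 3 .
  qed
  ultimately show ?thesis by (simp add: W_def)
qed

lemma xi_real_mono:
  assumes lam: "\<bar>lam\<bar> < 1" and "0 < x" "x < y"
  shows "xi_real lam x < xi_real lam y"
proof (rule DERIV_pos_imp_increasing[OF assms(3)])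
  fix u assume "x \<le> u" "u \<le> y"
  then have u: "0 < u" using assms by simp
  show "\<exists>D. (xi_real lam has_real_derivative D) (at u) \<and> 0 < D"
    using DERIV_xi_real[OF lam u] Z_real_facts(3)[OF lam u] u by fastforce
qed

text \<open>The constant imaginary part -(1 - \<lambda>) pi / 2 has two uses: it keeps \<xi> and
  \<zeta> away from 0 near the axis, and it produces the phase (\<mu> - \<kappa>) pi / 2 in the
  connection constants.\<close>

lemma xi_of_real:
  assumes tp: "turning_point_branches lam V" and lam: "\<bar>lam\<bar> < 1" and x: "0 < x" "of_real x \<in> cut_plane V"
  shows "xi V (of_real x) = of_real (xi_real lam x) - of_real ((1 - lam) * pi / 2) * \<i>"
proof -
  note Z = Zrt_of_real[OF tp x, folded Z_real_def]
  have A: "logA V (of_real x) \<in> \<real>" and B: "logB V (of_real x) \<in> \<real>"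
    and eA: "exp (logA V (of_real x)) = (Zrt V (of_real x) + of_real x - 2 * of_real lam) / 2"
    and eB: "exp (logB V (of_real x)) = (Zrt V (of_real x) - of_real lam * of_real x + 2) / of_real x"
    and xi: "xi V (of_real x) = Zrt V (of_real x) / 2 - of_real lam * logA V (of_real x) - logB V (of_real x)
          + of_real ((1 + lam) * ln (1 - lam ^ 2) / 2) - of_real ((1 - lam) * pi / 2) * \<i>"
    using tp x by (auto simp: turning_point_branches_def)
  obtain u where u: "logA V (of_real x) = of_real u" using A Reals_cases by blast
  obtain v where v: "logB V (of_real x) = of_real v" using B Reals_cases by blast
  have "complex_of_real (exp u) = of_real ((Z_real lam x + x - 2 * lam) / 2)"
    using eA unfolding u Z by (simp add: exp_of_real)
  then have "exp u = (Z_real lam x + x - 2 * lam) / 2" by (simp only: of_real_eq_iff)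
  then have u': "u = ln ((Z_real lam x + x - 2 * lam) / 2)" by (metis ln_exp)
  have "complex_of_real (exp v) = of_real ((Z_real lam x - lam * x + 2) / x)"
    using eB unfolding v Z by (simp add: exp_of_real)
  then have "exp v = (Z_real lam x - lam * x + 2) / x" by (simp only: of_real_eq_iff)
  then have v': "v = ln ((Z_real lam x - lam * x + 2) / x)" by (metis ln_exp)
  show ?thesis unfolding xi u v Z xi_real_def u'[symmetric] v'[symmetric] by simp
qed

lemma half_disc_convex: "convex (ball b e \<inter> {z. 0 \<le> Im z})"
  by (intro convex_Int convex_ball convex_halfspace_Im_ge)

text \<open>Used to tell S1 from S0. Outside a large disc there is no cut, since \<open>Sm1\<close>
  is bounded; following Z from x to -x along a semicircle decides its sign at -x, and then \<xi>
  behaves like -x/2 there.\<close>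

lemma left_end_negative:
  assumes tp: "turning_point_branches lam V" and lam: "0 \<le> lam" "lam < 1"
  shows "\<forall>\<^sub>F x in at_top. Re (xi V (- of_real x)) < 0"
proof -
  have an: "Zrt V analytic_on cut_plane V" and bd: "bounded (Sm1 V)"
    and cp: "\<And>z. z \<in> cut_plane V \<Longrightarrow> Zrt V z ^ 2 = z ^ 2 - 4 * of_real lam * z + 4 \<and>
        exp (logA V z) = (Zrt V z + z - 2 * of_real lam) / 2 \<and>
        exp (logB V z) = (Zrt V z - of_real lam * z + 2) / z \<and>
        xi V z = Zrt V z / 2 - of_real lam * logA V z - logB V z
          + of_real ((1 + lam) * ln (1 - lam ^ 2) / 2) - of_real ((1 - lam) * pi / 2) * \<i>"
    using tp by (auto simp: turning_point_branches_def)
  have lam1: "\<bar>lam\<bar> < 1" using lam by simp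
  obtain r where r: "\<And>z. z \<in> closure (Sm1 V) \<Longrightarrow> cmod z \<le> r"
    using bd bounded_closure[of "Sm1 V"] unfolding bounded_iff by blast
  have out: "z \<in> cut_plane V" if "z \<in> Cplus" "r < cmod z" for z
    using that r[of z] by (auto simp: cut_plane_def gamma2_def)
  have Zneg: "Zrt V (- of_real x) = - of_real (sqrt (x ^ 2 + 4 * lam * x + 4))" if x: "8 \<le> x" "r < x" for x
  proof -
    have x0: "0 < x" using x by simp
    define \<gamma> where "\<gamma> = (\<lambda>\<theta>. complex_of_real x * cis \<theta>)"
    have \<gamma>: "\<gamma> \<theta> \<in> Cplus" "cmod (\<gamma> \<theta>) = x" if "\<theta> \<in> {0..pi}" for \<theta>
      using that x0 by (auto simp: \<gamma>_def norm_mult Cplus_iff intro!: mult_nonneg_nonneg sin_ge_zero)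
    have \<gamma>cp: "\<gamma> \<theta> \<in> cut_plane V" if "\<theta> \<in> {0..pi}" for \<theta>
      using out \<gamma>[OF that] x by simp
    define q where "q = (\<lambda>\<theta>. Re (Zrt V (\<gamma> \<theta>) / \<gamma> \<theta>))"
    have cont: "continuous_on {0..pi} q"
    proof -
      have "continuous_on (cut_plane V) (Zrt V)"
        using an by (intro holomorphic_on_imp_continuous_on analytic_imp_holomorphic)
      moreover have c\<gamma>: "continuous_on {0..pi} \<gamma>" unfolding \<gamma>_def by (intro continuous_intros)
      ultimately have "continuous_on {0..pi} (\<lambda>\<theta>. Zrt V (\<gamma> \<theta>))"
        by (rule continuous_on_compose2) (use \<gamma>cp in auto)
      moreover have "\<forall>\<theta>\<in>{0..pi}. \<gamma> \<theta> \<noteq> 0" using x0 by (auto simp: \<gamma>_def)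
      ultimately show ?thesis unfolding q_def by (intro continuous_intros c\<gamma>)
    qed
    \<comment> \<open>Re (Z/z) cannot change sign on the semicircle: (Z/z)^2 has positive real part
      there, which excludes purely imaginary values. The radius 8 suffices because 4/8 + 4/64 <
      1.\<close>
    have nz: "q \<theta> \<noteq> 0" if \<theta>: "\<theta> \<in> {0..pi}" for \<theta>
    proof
      assume q0: "q \<theta> = 0"
      let ?z = "\<gamma> \<theta>" let ?w = "Zrt V ?z / ?z"
      have z0: "?z \<noteq> 0" using \<gamma>[OF \<theta>] x0 by auto
      have "?w ^ 2 = 1 - (4 * of_real lam / ?z - 4 / ?z ^ 2)"
        using cp[OF \<gamma>cp[OF \<theta>]] z0 by (simp add: power_divide power2_eq_square field_simps)
      then have "Re (?w ^ 2) = 1 - Re (4 * of_real lam / ?z - 4 / ?z ^ 2)" by simp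
      moreover have "Re (4 * of_real lam / ?z - 4 / ?z ^ 2) < 1"
      proof -
        have "Re (4 * of_real lam / ?z - 4 / ?z ^ 2) \<le> cmod (4 * of_real lam / ?z - 4 / ?z ^ 2)"
          by (rule complex_Re_le_cmod)
        also have "\<dots> \<le> cmod (4 * of_real lam / ?z) + cmod (4 / ?z ^ 2)" by (rule norm_triangle_ineq4)
        also have "\<dots> = 4 * lam / x + 4 / x ^ 2" using \<gamma>(2)[OF \<theta>] lam by (simp add: norm_divide norm_mult norm_power)
        also have "\<dots> \<le> 4 / 8 + 4 / 8 ^ 2" using x lam by (intro add_mono frac_le power_mono) auto
        finally show ?thesis by simp
      qed
      ultimately have "0 < Re (?w ^ 2)" by simp
      then show False using q0 by (simp add: q_def Re_power2)
    qed
    have "0 < q 0"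
    proof -
      have "Zrt V (of_real x) = of_real (Z_real lam x)"
        using Zrt_of_real[OF tp x0] \<gamma>cp[of 0] by (simp add: \<gamma>_def Z_real_def)
      then show ?thesis using Z_real_facts(3)[OF lam1 x0] x0 by (simp add: q_def \<gamma>_def)
    qed
    moreover have "connected (q ` {0..pi})" by (intro connected_continuous_image cont) simp
    ultimately have "0 < q pi"
      using nz connectedD_interval[of "q ` {0..pi}" "q pi" "q 0" 0]
      by (metis atLeastAtMost_iff imageE image_eqI linorder_not_less nless_le order_refl pi_ge_zero)
    then have neg: "0 < - Re (Zrt V (- of_real x))" using x0 by (simp add: q_def \<gamma>_def divide_less_0_iff)
    have "Zrt V (- of_real x) ^ 2 = of_real (x ^ 2 + 4 * lam * x + 4)"
      using cp[OF \<gamma>cp[of pi]] by (simp add: \<gamma>_def)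
    moreover have p: "0 \<le> x ^ 2 + 4 * lam * x + 4" using x0 lam by (intro add_nonneg_nonneg) auto
    then have "of_real (x ^ 2 + 4 * lam * x + 4) = complex_of_real (sqrt (x ^ 2 + 4 * lam * x + 4)) ^ 2"
      by (simp flip: of_real_power)
    ultimately have "Zrt V (- of_real x) = of_real (sqrt (x ^ 2 + 4 * lam * x + 4)) \<or>
        Zrt V (- of_real x) = - of_real (sqrt (x ^ 2 + 4 * lam * x + 4))"
      by (simp add: power2_eq_iff)
    then show ?thesis using neg p by auto
  qed
  define K where "K = (1 + lam) * ln (1 - lam ^ 2) / 2"
  have "\<forall>\<^sub>F x in at_top. - sqrt (x ^ 2 + 4 * lam * x + 4) / 2 - lam * ln ((sqrt (x ^ 2 + 4 * lam * x + 4) + x + 2 * lam) / 2)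
      - ln ((sqrt (x ^ 2 + 4 * lam * x + 4) - lam * x - 2) / x) + K < 0"
    using lam by real_asymp
  moreover have "\<forall>\<^sub>F x in at_top. 0 < (sqrt (x ^ 2 + 4 * lam * x + 4) - lam * x - 2) / x"
    using lam by real_asymp
  ultimately show ?thesis
    using eventually_ge_at_top[of 8] eventually_gt_at_top[of r]
  proof eventually_elim
    case (elim x)
    let ?s = "sqrt (x ^ 2 + 4 * lam * x + 4)"
    let ?z = "- complex_of_real x"
    have x: "0 < x" "8 \<le> x" "r < x" using elim by auto
    have z: "?z \<in> cut_plane V" using x by (intro out) (auto simp: Cplus_iff)
    note Z = Zneg[OF x(2,3)]
    have s0: "0 \<le> ?s" using x lam by (intro real_sqrt_ge_zero add_nonneg_nonneg) auto
    have A: "Re (logA V ?z) = ln ((?s + x + 2 * lam) / 2)"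
    proof -
      have "exp (logA V ?z) = - of_real ((?s + x + 2 * lam) / 2)"
      proof -
        have "exp (logA V ?z) = (Zrt V ?z + ?z - 2 * of_real lam) / 2" using cp[OF z] by blast
        then show ?thesis unfolding Z by (simp add: field_simps)
      qed
      then have "cmod (exp (logA V ?z)) = (?s + x + 2 * lam) / 2"
        using s0 x lam by (simp only: norm_minus_cancel norm_of_real) simp
      then show ?thesis by (metis ln_exp norm_exp_eq_Re)
    qed
    have B: "Re (logB V ?z) = ln ((?s - lam * x - 2) / x)"
    proof -
      have "exp (logB V ?z) = of_real ((?s - lam * x - 2) / x)"
      proof -
        have "exp (logB V ?z) = (Zrt V ?z - of_real lam * ?z + 2) / ?z" using cp[OF z] by blast
        then show ?thesis unfolding Z using x by (simp add: field_simps)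
      qed
      then have "cmod (exp (logB V ?z)) = (?s - lam * x - 2) / x"
        using elim by (simp only: norm_of_real)
      then show ?thesis by (metis ln_exp norm_exp_eq_Re)
    qed
    have "Re (xi V ?z) = - ?s / 2 - lam * Re (logA V ?z) - Re (logB V ?z) + K"
      using cp[OF z] by (simp add: Z K_def)
    then show ?case using elim unfolding A B by simp
  qed
qed


lemma components_common_point:
  assumes "X \<in> components S" "Y \<in> components S" "z \<in> X" "z \<in> Y"
  shows "X = Y"
  using components_nonoverlap[OF assms(1,2)] assms(3,4) by blast

text \<open>A positive real on \<open>\<gamma>\<^sub>2\<close> is a limit of \<open>S\<^sub>-\<^sub>1\<close> and of \<open>S\<^sub>1\<close>.  At the largest such point \<open>b\<close>
  one has \<open>Re \<xi> = 0\<close>, and \<open>Re \<xi>\<close> increases along horizontal lines near \<open>b\<close>.  Hence near \<open>b\<close> the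
  complement of the level curves has only two pieces: one is part of \<open>S\<^sub>0\<close>, so both \<open>S\<^sub>-\<^sub>1\<close> and
  \<open>S\<^sub>1\<close> would contain the other.\<close>

lemma positive_real_in_cut_plane:
  assumes tp: "turning_point_branches lam V" and lam: "0 \<le> lam" "lam < 1" and x0: "0 < x0"
  shows "of_real x0 \<in> cut_plane V"
proof (rule ccontr)
  assume not: "of_real x0 \<notin> cut_plane V"
  have lam1: "\<bar>lam\<bar> < 1" using lam by simp
  define \<rho> where "\<rho> = (\<lambda>z. Re (xi V z))"
  define A where "A = Cplus - level_curves V"
  have comps: "components A = {Sm1 V, S0 V, S1 V}" and bd: "bounded (Sm1 V)"
    and right: "\<forall>\<^sub>F x in at_top. complex_of_real x \<in> S0 V" and left: "\<forall>\<^sub>F x in at_top. - complex_of_real x \<in> S1 V"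
    and zan: "zeta V analytic_on Cplus"
    using tp by (auto simp: turning_point_branches_def A_def at_right_end_def at_left_end_def eventually_filtermap)
  have A_iff: "z \<in> A \<longleftrightarrow> z \<in> Cplus \<and> \<rho> z \<noteq> 0" for z
    by (auto simp: A_def level_curves_def \<rho>_def)
  have cS: "Sm1 V \<in> components A" "S0 V \<in> components A" "S1 V \<in> components A" using comps by auto
  note sub = cS[THEN in_components_subset]
  have cont: "continuous_on Cplus \<rho>" unfolding \<rho>_def by (rule continuous_on_Re_xi[OF tp])
  have distinct: "Sm1 V \<noteq> S0 V" "Sm1 V \<noteq> S1 V"
  proof -
    obtain B where B: "\<And>z. z \<in> Sm1 V \<Longrightarrow> cmod z \<le> B" using bd unfolding bounded_iff by blast
    have "\<forall>\<^sub>F x::real in at_top. \<bar>B\<bar> < x" by (rule eventually_gt_at_top)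
    then obtain x y :: real where xy: "\<bar>B\<bar> < x" "of_real x \<in> S0 V" "\<bar>B\<bar> < y" "- of_real y \<in> S1 V"
      using eventually_happens'[OF trivial_limit_at_top_linorder eventually_conj[OF _ right]]
        eventually_happens'[OF trivial_limit_at_top_linorder eventually_conj[OF _ left]] by blast
    show "Sm1 V \<noteq> S0 V" using B[of "of_real x"] xy by auto
    show "Sm1 V \<noteq> S1 V" using B[of "- of_real y"] xy by auto
  qed
  define D where "D = closure (Sm1 V) \<inter> closure (S1 V)"
  have inD: "of_real x \<in> D \<longleftrightarrow> of_real x \<notin> cut_plane V" if "0 < x" for x :: real
    using that by (auto simp: D_def cut_plane_def gamma2_def)
  \<comment> \<open>Cutting off at x0 keeps the set closed, so that it has a largest element. Beyond
    this element the closed form of \<xi> is available.\<close>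
  define T where "T = {x. complex_of_real x \<in> D} \<inter> {x0..}"
  have "closed T"
    unfolding T_def D_def
    by (intro closed_Int closed_atLeast continuous_closed_vimage[unfolded vimage_def, of _ complex_of_real]) auto
  moreover have "x0 \<in> T" using not inD[OF x0] by (simp add: T_def)
  moreover have "bdd_above T"
  proof -
    have "bounded D" unfolding D_def using bd by (meson bounded_Int bounded_closure)
    then obtain B where "\<And>z. z \<in> D \<Longrightarrow> cmod z \<le> B" unfolding bounded_iff by blast
    then have "x \<le> B" if "x \<in> T" for x using that x0 by (force simp: T_def)
    then show ?thesis by (rule bdd_aboveI)
  qed
  ultimately have supT: "Sup T \<in> T" and upT: "\<And>x. x \<in> T \<Longrightarrow> x \<le> Sup T"
    by (auto intro: closed_contains_Sup cSup_upper)
  define b where "b = Sup T"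
  have b: "0 < b" "of_real b \<in> D" using supT x0 by (auto simp: T_def b_def)
  have bC: "complex_of_real b \<in> Cplus" using b by simp
  have above: "of_real x \<in> cut_plane V" if "b < x" for x
  proof -
    have "x \<notin> T" using upT[of x] that by (auto simp: b_def)
    moreover have "x0 \<le> x" using upT[OF \<open>x0 \<in> T\<close>] that by (simp add: b_def)
    ultimately show ?thesis using inD[of x] x0 by (simp add: T_def)
  qed
  have \<rho>_above: "\<rho> (of_real x) = xi_real lam x" if "b < x" for x
    using xi_of_real[OF tp lam1 _ above[OF that]] that b by (simp add: \<rho>_def)
  \<comment> \<open>The point b lies on \<open>gamma2\<close>, where the closed form is not given;
    the value is reached by continuity from the right.\<close>
  have \<rho>b: "\<rho> (of_real b) = xi_real lam b"
  proof (rule tendsto_unique[OF trivial_limit_at_right_real])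
    have "continuous_on {0<..} (\<lambda>x. \<rho> (of_real x))"
      by (rule continuous_on_compose2[OF cont]) (auto intro!: continuous_intros)
    then have "isCont (\<lambda>x. \<rho> (of_real x)) b" using b by (simp add: continuous_on_eq_continuous_at)
    then show "((\<lambda>x. \<rho> (of_real x)) \<longlongrightarrow> \<rho> (of_real b)) (at_right b)"
      unfolding isCont_def by (rule tendsto_mono[rotated]) (simp add: at_le)
    have "isCont (xi_real lam) b" using DERIV_xi_real[OF lam1 b(1)] by (rule DERIV_isCont)
    then have "(xi_real lam \<longlongrightarrow> xi_real lam b) (at_right b)"
      unfolding isCont_def by (rule tendsto_mono[rotated]) (simp add: at_le)
    then show "((\<lambda>x. \<rho> (of_real x)) \<longlongrightarrow> xi_real lam b) (at_right b)"
      by (rule Lim_transform_eventually) (use \<rho>_above in \<open>auto simp: eventually_at_right_less eventually_at_filter\<close>)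
  qed
  have near: "\<exists>e>0. \<forall>z\<in>Cplus. dist z p < e \<longrightarrow> \<bar>\<rho> z - \<rho> p\<bar> < \<epsilon>" if "p \<in> Cplus" "0 < \<epsilon>" for p \<epsilon>
    using cont that unfolding continuous_on_iff by (auto simp: dist_real_def)
  have approach: "\<exists>z\<in>X. dist z (of_real b) < e" if "X = Sm1 V \<or> X = S1 V" "0 < e" for X and e :: real
    using b(2) that by (auto simp: D_def closure_approachable)
  show False
  \<comment> \<open>If Re \<xi> is nonzero at b, a whole half disc about b avoids the level curves.
    Being connected, it lies in both components, as both come arbitrarily close to b.\<close>
  proof (cases "xi_real lam b = 0")
    case False
    obtain e0 where e0: "e0 > 0" "\<And>z. z \<in> Cplus \<Longrightarrow> dist z (of_real b) < e0 \<Longrightarrow> \<bar>\<rho> z - \<rho> (of_real b)\<bar> < \<bar>\<rho> (of_real b)\<bar>"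
      using near[OF bC, of "\<bar>\<rho> (of_real b)\<bar>"] False \<rho>b by auto
    define e where "e = min e0 b"
    define H where "H = ball (complex_of_real b) e \<inter> {z. 0 \<le> Im z}"
    have e: "0 < e" using e0 b by (simp add: e_def)
    have HC: "H \<subseteq> Cplus" by (auto simp: H_def e_def Cplus_iff dist_norm)
    have HA: "H \<subseteq> A"
    proof
      fix z assume z: "z \<in> H"
      then have "z \<in> Cplus" "dist z (of_real b) < e0" using HC by (auto simp: H_def e_def dist_commute)
      then show "z \<in> A" using e0(2) by (force simp: A_iff)
    qed
    have "of_real b \<in> X" if X: "X = Sm1 V \<or> X = S1 V" for X
    proof -
      obtain z where z: "z \<in> X" "dist z (of_real b) < e" using approach[OF X e] by blast
      have "z \<in> Cplus" using z(1) X sub by (auto simp: A_iff)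
      then have "z \<in> H" using z by (auto simp: H_def dist_commute Cplus_iff)
      moreover have "X \<in> components A" using X cS by auto
      ultimately have "H \<subseteq> X"
        using components_maximal[of X A H] HA z(1) half_disc_convex[THEN convex_connected] unfolding H_def by blast
      then show ?thesis using e by (auto simp: H_def)
    qed
    then have "Sm1 V = S1 V" using components_common_point[OF cS(1,3)] by blast
    then show False using distinct by blast
  next
    case True
    have posR: "0 < xi_real lam x" if "b < x" for x using xi_real_mono[OF lam1 b(1) that] True by simp
    have rayS0: "of_real x \<in> S0 V" if x: "b < x" for x
    proof -
      have "complex_of_real ` {b<..} \<subseteq> A" using b \<rho>_above posR by (force simp: A_iff)
      moreover have "connected (complex_of_real ` {b<..})"
        by (intro connected_continuous_image continuous_intros) auto
      moreover have "S0 V \<inter> complex_of_real ` {b<..} \<noteq> {}"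
        using eventually_happens'[OF trivial_limit_at_top_linorder eventually_conj[OF right eventually_gt_at_top[of b]]] by blast
      ultimately have "complex_of_real ` {b<..} \<subseteq> S0 V" using components_maximal[OF cS(2)] by blast
      then show ?thesis using x by blast
    qed
    \<comment> \<open>Re \<xi> has no zero on a component but is negative at the left end and
      positive on the axis beyond b.\<close>
    have S10: "S1 V \<noteq> S0 V"
    proof
      assume eq: "S1 V = S0 V"
      obtain y :: real where y: "- of_real y \<in> S1 V" "\<rho> (- of_real y) < 0"
        using eventually_happens'[OF trivial_limit_at_top_linorder eventually_conj[OF left left_end_negative[OF tp lam]]]
        by (auto simp: \<rho>_def)
      have "connected (\<rho> ` S1 V)"
        using cS(3) sub(3) by (intro connected_continuous_image continuous_on_subset[OF cont]) (auto simp: A_iff intro: in_components_connected)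
      moreover have "\<rho> (- of_real y) \<in> \<rho> ` S1 V" using y by blast
      moreover have "\<rho> (of_real (b + 1)) \<in> \<rho> ` S1 V"
        unfolding eq by (intro imageI rayS0) simp
      moreover have "0 < \<rho> (of_real (b + 1))" using posR[of "b + 1"] \<rho>_above[of "b + 1"] by simp
      ultimately have "0 \<in> \<rho> ` S1 V"
        using connectedD_interval[of "\<rho> ` S1 V" "\<rho> (- of_real y)" "\<rho> (of_real (b + 1))" 0] y(2) by linarith
      then show False using sub(3) by (auto simp: A_iff)
    qed
    \<comment> \<open>The branch cut of the power is avoided at b, so \<xi> is holomorphic there.
      The constant imaginary part of \<xi> to the right of b gives \<zeta> \<noteq> 0, and Re \<xi>
      > 0 there gives 2 Re \<zeta> \<ge> |\<zeta>| in the limit.\<close>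
    have zetab: "zeta V (of_real b) \<notin> \<real>\<^sub>\<le>\<^sub>0"
    proof -
      define c where "c = (1 - lam) * pi / 2"
      have c: "0 < c" using lam by (simp add: c_def)
      have "isCont (zeta V) (of_real b)" using analytic_on_DERIV[OF zan bC] DERIV_isCont by blast
      moreover have "((\<lambda>x. complex_of_real x) \<longlongrightarrow> of_real b) (at_right b)" by (intro tendsto_intros)
      ultimately have lim: "((\<lambda>x. zeta V (of_real x)) \<longlongrightarrow> zeta V (of_real b)) (at_right b)"
        by (rule isCont_tendsto_compose)
      have ev: "\<forall>\<^sub>F x in at_right b. b < x" by (rule eventually_at_right_less)
      have "\<forall>\<^sub>F x in at_right b. c \<le> 2 / 3 * cmod (zeta V (of_real x)) powr (3 / 2)"
        using ev
      proof eventually_elim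
        case (elim x)
        have "Im (xi V (of_real x)) = - c"
          using xi_of_real[OF tp lam1 _ above[OF elim]] elim b by (simp add: c_def)
        then have "c \<le> cmod (xi V (of_real x))" using abs_Im_le_cmod[of "xi V (of_real x)"] c by simp
        also have "cmod (xi V (of_real x)) = 2 / 3 * cmod (zeta V (of_real x)) powr (3 / 2)"
          using norm_powr_real_powr'[of "3 / 2" "zeta V (of_real x)"] by (simp add: xi_def norm_mult norm_divide)
        finally show ?case .
      qed
      moreover have "((\<lambda>x. 2 / 3 * cmod (zeta V (of_real x)) powr (3 / 2)) \<longlongrightarrow> 2 / 3 * cmod (zeta V (of_real b)) powr (3 / 2)) (at_right b)"
        by (intro tendsto_mult tendsto_const tendsto_powr' tendsto_norm lim) auto
      ultimately have "c \<le> 2 / 3 * cmod (zeta V (of_real b)) powr (3 / 2)"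
        using tendsto_lowerbound trivial_limit_at_right_real by blast
      then have nz: "zeta V (of_real b) \<noteq> 0" using c by auto
      have "\<forall>\<^sub>F x in at_right b. 0 \<le> 2 * Re (zeta V (of_real x)) - cmod (zeta V (of_real x))"
        using ev
      proof eventually_elim
        case (elim x)
        have "0 < \<rho> (of_real x)" using \<rho>_above[OF elim] posR[OF elim] by simp
        then have "0 < sqrt ((cmod (zeta V (of_real x)) + Re (zeta V (of_real x))) / 2) *
            (2 * Re (zeta V (of_real x)) - cmod (zeta V (of_real x)))"
          unfolding \<rho>_def Re_xi by linarith
        moreover have "0 \<le> sqrt ((cmod (zeta V (of_real x)) + Re (zeta V (of_real x))) / 2)"
          using abs_Re_le_cmod[of "zeta V (of_real x)"] by simp
        moreover have "0 \<le> v" if "0 < u * v" "0 \<le> u" for u v :: real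
          using that mult_nonneg_nonpos[of u v] by linarith
        ultimately show ?case by blast
      qed
      moreover have "((\<lambda>x. 2 * Re (zeta V (of_real x)) - cmod (zeta V (of_real x))) \<longlongrightarrow>
          2 * Re (zeta V (of_real b)) - cmod (zeta V (of_real b))) (at_right b)"
        by (intro tendsto_intros lim)
      ultimately have "0 \<le> 2 * Re (zeta V (of_real b)) - cmod (zeta V (of_real b))"
        using tendsto_lowerbound trivial_limit_at_right_real by blast
      moreover have "0 < cmod (zeta V (of_real b))" using nz by simp
      ultimately have "0 < Re (zeta V (of_real b))" by linarith
      then show ?thesis by (auto simp: complex_nonpos_Reals_iff)
    qed
    obtain e1 where e1: "e1 > 0" "xi V holomorphic_on ball (of_real b) e1"
    proof -
      obtain r where r: "r > 0" "zeta V holomorphic_on ball (of_real b) r"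
        using zan bC unfolding analytic_on_def by blast
      have "(zeta V \<longlongrightarrow> zeta V (of_real b)) (at (of_real b))"
        using analytic_on_DERIV[OF zan bC] DERIV_isCont isCont_def by blast
      moreover have "open (- \<real>\<^sub>\<le>\<^sub>0 :: complex set)" using closed_nonpos_Reals_complex by (simp add: open_Compl)
      ultimately have "\<forall>\<^sub>F z in at (of_real b). zeta V z \<in> - \<real>\<^sub>\<le>\<^sub>0"
        by (rule topological_tendstoD) (use zetab in simp)
      then have "\<forall>\<^sub>F z in nhds (of_real b). zeta V z \<in> - \<real>\<^sub>\<le>\<^sub>0"
        using zetab by (simp add: eventually_nhds_conv_at)
      then obtain r' where r': "r' > 0" "\<And>z. dist z (of_real b) < r' \<Longrightarrow> zeta V z \<notin> \<real>\<^sub>\<le>\<^sub>0"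
        unfolding eventually_nhds_metric by auto
      show ?thesis
      proof (rule that[of "min r r'"])
        show "xi V holomorphic_on ball (of_real b) (min r r')"
          unfolding xi_def[abs_def] using r r'
          by (intro holomorphic_intros) (auto intro: holomorphic_on_subset simp: dist_commute)
      qed (use r r' in auto)
    qed
    have dxi: "(xi V has_field_derivative deriv (xi V) z) (at z)" if "z \<in> ball (of_real b) e1" for z
      using e1 that by (auto intro: holomorphic_derivI)
    \<comment> \<open>Since \<xi> is differentiable at b, its derivative can be computed from the
      right-hand quotients alone, where the closed form holds.\<close>
    have derb: "Re (deriv (xi V) (of_real b)) = Z_real lam b / (2 * b)"
    proof -
      define f where "f = (\<lambda>x. \<rho> (of_real x) - xi_real lam x)"
      have "(complex_of_real has_vector_derivative 1) (at b)" by (auto intro!: derivative_eq_intros)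
      from field_vector_diff_chain_at[OF this dxi]
      have "((\<lambda>x. xi V (of_real x)) has_vector_derivative deriv (xi V) (of_real b)) (at b)"
        using e1 by (simp add: o_def)
      then have "((\<lambda>x. \<rho> (of_real x)) has_vector_derivative Re (deriv (xi V) (of_real b))) (at b)"
        unfolding \<rho>_def by (rule bounded_linear.has_vector_derivative[OF bounded_linear_Re])
      then have "(f has_real_derivative Re (deriv (xi V) (of_real b)) - Z_real lam b / (2 * b)) (at b)"
        unfolding f_def
        by (intro DERIV_diff DERIV_xi_real lam1 b) (simp add: has_real_derivative_iff_has_vector_derivative)
      then have "((\<lambda>x. (f x - f b) / (x - b)) \<longlongrightarrow> Re (deriv (xi V) (of_real b)) - Z_real lam b / (2 * b)) (at b)"
        by (simp only: has_field_derivative_iff)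
      then have "((\<lambda>x. (f x - f b) / (x - b)) \<longlongrightarrow> Re (deriv (xi V) (of_real b)) - Z_real lam b / (2 * b)) (at_right b)"
        by (rule tendsto_mono[rotated]) (simp add: at_le)
      moreover have "((\<lambda>x. (f x - f b) / (x - b)) \<longlongrightarrow> 0) (at_right b)"
      proof (rule tendsto_eventually)
        show "\<forall>\<^sub>F x in at_right b. (f x - f b) / (x - b) = 0"
          using eventually_at_right_less[of b] by eventually_elim (simp add: f_def \<rho>_above \<rho>b)
      qed
      ultimately have "Re (deriv (xi V) (of_real b)) - Z_real lam b / (2 * b) = 0"
        by (rule tendsto_unique[OF trivial_limit_at_right_real])
      then show ?thesis by simp
    qed
    obtain e where e: "0 < e" "e \<le> e1" "e \<le> b" "\<And>z. z \<in> ball (of_real b) e \<Longrightarrow> 0 < Re (deriv (xi V) z)"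
    proof -
      have "continuous_on (ball (of_real b) e1) (\<lambda>z. Re (deriv (xi V) z))"
        using e1 by (intro continuous_intros holomorphic_on_imp_continuous_on holomorphic_deriv) auto
      then have "isCont (\<lambda>z. Re (deriv (xi V) z)) (of_real b)"
        using e1 by (simp add: continuous_on_eq_continuous_at)
      moreover have derb_pos: "0 < Re (deriv (xi V) (of_real b))" unfolding derb using Z_real_facts(3)[OF lam1 b(1)] b by simp
      ultimately have "\<forall>\<^sub>F z in at (of_real b). 0 < Re (deriv (xi V) z)"
        unfolding isCont_def by (rule order_tendstoD(1))
      then have "\<forall>\<^sub>F z in nhds (of_real b). 0 < Re (deriv (xi V) z)"
        using derb_pos by (simp add: eventually_nhds_conv_at)
      then obtain r where r: "r > 0" "\<And>z. dist z (of_real b) < r \<Longrightarrow> 0 < Re (deriv (xi V) z)"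
        unfolding eventually_nhds_metric by auto
      show ?thesis by (rule that[of "min r (min e1 b)"]) (use r e1 b in \<open>auto simp: dist_commute\<close>)
    qed
    define Bl where "Bl = ball (complex_of_real b) e"
    have mono: "\<rho> z < \<rho> z'" if z: "z \<in> Bl" "z' \<in> Bl" "Im z = Im z'" "Re z < Re z'" for z z'
    proof -
      define y where "y = Im z"
      have "\<rho> (Complex (Re z) y) < \<rho> (Complex (Re z') y)"
      proof (rule DERIV_pos_imp_increasing[OF z(4)])
        fix u assume u: "Re z \<le> u" "u \<le> Re z'"
        have "Complex u y \<in> closed_segment z z'"
          using u z(3) by (auto simp: y_def closed_segment_same_Im closed_segment_eq_real_ivl)
        then have uB: "Complex u y \<in> Bl" using z(1,2) convex_ball unfolding Bl_def by (meson closed_segment_subset subsetD)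
        have "((\<lambda>u. Complex u y) has_vector_derivative 1) (at u)"
          unfolding Complex_eq by (auto intro!: derivative_eq_intros)
        from field_vector_diff_chain_at[OF this dxi]
        have "((\<lambda>u. xi V (Complex u y)) has_vector_derivative deriv (xi V) (Complex u y)) (at u)"
          using uB e(2) by (simp add: o_def Bl_def)
        then have "((\<lambda>u. \<rho> (Complex u y)) has_vector_derivative Re (deriv (xi V) (Complex u y))) (at u)"
          unfolding \<rho>_def by (rule bounded_linear.has_vector_derivative[OF bounded_linear_Re])
        then show "\<exists>D. ((\<lambda>u. \<rho> (Complex u y)) has_real_derivative D) (at u) \<and> 0 < D"
          using e(4) uB unfolding has_real_derivative_iff_has_vector_derivative Bl_def by blast
      qed
      then show ?thesis using z(3) by (simp add: y_def complex_surj) (metis complex_surj)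
    qed
    have mono_le: "\<rho> z \<le> \<rho> z'" if z: "z \<in> Bl" "z' \<in> Bl" "Im z = Im z'" "Re z \<le> Re z'" for z z'
    proof (cases "Re z = Re z'")
      case True
      then have "z = z'" using z(3) by (simp add: complex_eq_iff)
      then show ?thesis by simp
    next
      case False
      then show ?thesis using mono[of z z'] z by simp
    qed
    define h where "h = e / 2"
    have h: "0 < h" "h < b" "h < e" using e by (auto simp: h_def)
    have pR: "0 < \<rho> (of_real (b + h))" using \<rho>_above[of "b + h"] posR[of "b + h"] h by simp
    have pL: "\<rho> (of_real (b - h)) < 0"
    proof -
      have "\<rho> (of_real (b - h)) < \<rho> (of_real b)" using e(1) h by (intro mono) (auto simp: Bl_def dist_norm)
      then show ?thesis using True \<rho>b by simp
    qed
    have CR: "complex_of_real (b + h) \<in> Cplus" "complex_of_real (b - h) \<in> Cplus"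
      using h b by (auto simp only: of_real_in_Cplus)
    obtain k1 where k1: "k1 > 0" "\<And>z. z \<in> Cplus \<Longrightarrow> dist z (of_real (b + h)) < k1 \<Longrightarrow> \<bar>\<rho> z - \<rho> (of_real (b + h))\<bar> < \<rho> (of_real (b + h))"
      using near[OF CR(1) pR] by blast
    obtain k2 where k2: "k2 > 0" "\<And>z. z \<in> Cplus \<Longrightarrow> dist z (of_real (b - h)) < k2 \<Longrightarrow> \<bar>\<rho> z - \<rho> (of_real (b - h))\<bar> < - \<rho> (of_real (b - h))"
      using near[OF CR(2), of "- \<rho> (of_real (b - h))"] pL by auto
    define k where "k = min (e / 4) (min k1 k2)"
    have k: "0 < k" "k \<le> e / 4" "k \<le> k1" "k \<le> k2" using e k1 k2 by (auto simp: k_def)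
    \<comment> \<open>A rectangle on the axis, flat enough that Re \<xi> keeps on its vertical sides
      the sign it has at their real end points, and contained in the ball where Re \<xi> increases
      to the right.\<close>
    define Q where "Q = {z. \<bar>Re z - b\<bar> \<le> h \<and> 0 \<le> Im z \<and> Im z < k}"
    have QB: "z \<in> Bl" if "z \<in> Q" for z
    proof -
      have "cmod (z - of_real b) \<le> \<bar>Re z - b\<bar> + \<bar>Im z\<bar>" using cmod_le[of "z - of_real b"] by simp
      then show ?thesis using that k e(1) by (auto simp: Q_def Bl_def dist_norm norm_minus_commute h_def)
    qed
    have QC: "z \<in> Cplus" if "z \<in> Q" for z
      using that h by (auto simp: Q_def Cplus_iff)
    have side: "0 < \<rho> (Complex (b + h) y)" "\<rho> (Complex (b - h) y) < 0" if "0 \<le> y" "y < k" for y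
    proof -
      have "Complex (b + h) y \<in> Q" "Complex (b - h) y \<in> Q" using that h by (auto simp: Q_def)
      then have C: "Complex (b + h) y \<in> Cplus" "Complex (b - h) y \<in> Cplus" using QC by auto
      have "Complex (b + h) y - of_real (b + h) = \<i> * of_real y" "Complex (b - h) y - of_real (b - h) = \<i> * of_real y"
        by (simp_all add: complex_eq_iff)
      then have d: "dist (Complex (b + h) y) (of_real (b + h)) < k" "dist (Complex (b - h) y) (of_real (b - h)) < k"
        using that unfolding dist_norm by (simp_all add: norm_mult)
      show "0 < \<rho> (Complex (b + h) y)" using k1(2)[OF C(1)] d(1) k by (auto simp: abs_less_iff)
      show "\<rho> (Complex (b - h) y) < 0" using k2(2)[OF C(2)] d(2) k by (auto simp: abs_less_iff)
    qed
    \<comment> \<open>From z go horizontally to the side Re = p and then down to the axis; a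
      component meeting this path free of zeros contains its end point.\<close>
    have join: "of_real p \<in> X" if X: "X \<in> components A" "z \<in> X" and z: "z \<in> Q" and p: "\<bar>p - b\<bar> \<le> h"
      and horiz: "\<And>w. w \<in> closed_segment z (Complex p (Im z)) \<Longrightarrow> \<rho> w \<noteq> 0"
      and vert: "\<And>w. w \<in> closed_segment (Complex p (Im z)) (of_real p) \<Longrightarrow> \<rho> w \<noteq> 0" for X z p
    proof -
      let ?T = "closed_segment z (Complex p (Im z)) \<union> closed_segment (Complex p (Im z)) (of_real p)"
      have Qc: "convex Q"
      proof -
        have "Q = {z. Re z \<le> b + h} \<inter> {z. b - h \<le> Re z} \<inter> {z. 0 \<le> Im z} \<inter> {z. Im z < k}"
          by (auto simp: Q_def abs_le_iff)
        then show ?thesis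
          by (simp add: convex_Int convex_halfspace_Re_le convex_halfspace_Re_ge convex_halfspace_Im_ge convex_halfspace_Im_lt)
      qed
      have "Complex p (Im z) \<in> Q" "of_real p \<in> Q" using z p k by (auto simp: Q_def)
      then have "?T \<subseteq> Q" using Qc z by (simp add: closed_segment_subset)
      then have "?T \<subseteq> A" using horiz vert QC by (auto simp: A_iff)
      moreover have "connected ?T" by (intro connected_Un) auto
      moreover have "X \<inter> ?T \<noteq> {}" using X(2) by auto
      ultimately have "?T \<subseteq> X" using components_maximal[OF X(1)] by blast
      then show ?thesis by auto
    qed
    \<comment> \<open>Moving right from a point with Re \<xi> > 0 keeps Re \<xi> positive, so the
      path ends on the part of the axis belonging to S0.\<close>
    have inS0: "z \<in> S0 V" if X: "X \<in> components A" "z \<in> X" and z: "z \<in> Q" "0 < \<rho> z" for X z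
    proof -
      have "of_real (b + h) \<in> X"
      proof (rule join[OF X z(1)])
        show "\<bar>b + h - b\<bar> \<le> h" using h by simp
        fix w assume w: "w \<in> closed_segment z (Complex (b + h) (Im z))"
        then have w': "Im w = Im z" "Re z \<le> Re w" "Re w \<le> b + h"
          using z(1) by (auto simp: closed_segment_same_Im closed_segment_eq_real_ivl Q_def abs_le_iff)
        then have "w \<in> Q" using z(1) by (auto simp: Q_def abs_le_iff)
        then have "\<rho> z \<le> \<rho> w" using mono_le[of z w] QB z(1) w' by simp
        then show "\<rho> w \<noteq> 0" using z(2) by simp
      next
        fix w assume "w \<in> closed_segment (Complex (b + h) (Im z)) (of_real (b + h))"
        then have "Re w = b + h" "0 \<le> Im w" "Im w \<le> Im z"
          using z(1) by (auto simp: closed_segment_same_Re closed_segment_eq_real_ivl Q_def split: if_splits)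
        then have weq: "Complex (b + h) (Im w) = w" and "0 \<le> Im w" "Im w < k"
          using z(1) by (auto simp: complex_eq_iff Q_def)
        then have "0 < \<rho> (Complex (b + h) (Im w))" by (intro side(1))
        then show "\<rho> w \<noteq> 0" unfolding weq by simp
      qed
      moreover have "of_real (b + h) \<in> S0 V" using rayS0[of "b + h"] h by simp
      ultimately have "X = S0 V" using components_common_point[OF X(1) cS(2)] by blast
      then show ?thesis using X(2) by simp
    qed
    have inL: "of_real (b - h) \<in> X" if X: "X \<in> components A" "z \<in> X" and z: "z \<in> Q" "\<rho> z < 0" for X z
    proof (rule join[OF X z(1)])
      show "\<bar>b - h - b\<bar> \<le> h" using h by simp
      fix w assume w: "w \<in> closed_segment z (Complex (b - h) (Im z))"
      then have w': "Im w = Im z" "Re w \<le> Re z" "b - h \<le> Re w"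
        using z(1) by (auto simp: closed_segment_same_Im closed_segment_eq_real_ivl Q_def abs_le_iff split: if_splits)
      then have "w \<in> Q" using z(1) by (auto simp: Q_def abs_le_iff)
      then have "\<rho> w \<le> \<rho> z" using mono_le[of w z] QB z(1) w' by simp
      then show "\<rho> w \<noteq> 0" using z(2) by simp
    next
      fix w assume "w \<in> closed_segment (Complex (b - h) (Im z)) (of_real (b - h))"
      then have "Re w = b - h" "0 \<le> Im w" "Im w \<le> Im z"
        using z(1) by (auto simp: closed_segment_same_Re closed_segment_eq_real_ivl Q_def split: if_splits)
      then have weq: "Complex (b - h) (Im w) = w" and "0 \<le> Im w" "Im w < k"
          using z(1) by (auto simp: complex_eq_iff Q_def)
        then have "\<rho> (Complex (b - h) (Im w)) < 0" by (intro side(2))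
        then show "\<rho> w \<noteq> 0" unfolding weq by simp
    qed
    have "of_real (b - h) \<in> X" if X: "X = Sm1 V \<or> X = S1 V" for X
    proof -
      obtain z where z: "z \<in> X" "dist z (of_real b) < min h k" using approach[OF X, of "min h k"] h k by auto
      have XA: "X \<in> components A" using X cS by auto
      have zA: "z \<in> A" using z(1) X sub by auto
      have "\<bar>Re z - b\<bar> < h" "\<bar>Im z\<bar> < k"
        using z(2) abs_Re_le_cmod[of "z - of_real b"] abs_Im_le_cmod[of "z - of_real b"] by (auto simp: dist_norm)
      then have zQ: "z \<in> Q" using zA by (auto simp: Q_def A_iff Cplus_iff)
      have "\<not> 0 < \<rho> z"
      proof
        assume "0 < \<rho> z"
        then have "X = S0 V" using inS0[OF XA z(1) zQ] components_common_point[OF XA cS(2) z(1)] by blast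
        then show False using X distinct S10 by blast
      qed
      then have "\<rho> z < 0" using zA by (auto simp: A_iff)
      then show ?thesis by (rule inL[OF XA z(1) zQ])
    qed
    then have "Sm1 V = S1 V" using components_common_point[OF cS(1,3)] by blast
    then show False using distinct by blast
  qed
qed

section \<open>The Airy-type solutions at infinity\<close>

lemma of_real_Re_to_infinity: "filterlim complex_of_real Re_to_infinity at_top"
  unfolding Re_to_infinity_def filterlim_inf filterlim_filtercomap_iff filterlim_principal
  by (auto simp: o_def filterlim_ident intro: eventually_at_top_linorderI[of 1])

text \<open>The constant term of this expansion is the source of the powers of 1 - \<lambda> and 1 -
  \<lambda>^2 in the theorem.\<close>

lemma xi_real_at_top:
  assumes "0 \<le> lam" "lam < 1"
  shows "((\<lambda>x. xi_real lam x - (x / 2 - lam - lam * ln x - ln (1 - lam) + (1 + lam) * ln (1 - lam ^ 2) / 2)) \<longlongrightarrow> 0) at_top"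
proof -
  define K where "K = (1 + lam) * ln (1 - lam ^ 2) / 2"
  have "((\<lambda>x. sqrt (x ^ 2 - 4 * lam * x + 4) / 2 - lam * ln ((sqrt (x ^ 2 - 4 * lam * x + 4) + x - 2 * lam) / 2)
     - ln ((sqrt (x ^ 2 - 4 * lam * x + 4) - lam * x + 2) / x) + K
     - (x / 2 - lam - lam * ln x - ln (1 - lam) + K)) \<longlongrightarrow> 0) at_top"
    using assms by real_asymp
  then show ?thesis unfolding xi_real_def Z_real_def K_def .
qed

text \<open>The angle t = (3/2) arg w lies within 3 pi/2 of 0, and a positive cosine excludes pi/2
  \<le> |t| \<le> 3 pi/2. So (3/2) Ln w is already a principal value.\<close>

lemma Ln_three_halves:
  assumes pos: "0 < Re (2/3 * w powr (3/2))" and w: "w \<noteq> 0"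
  shows "3/2 * Ln w = Ln (3/2 * (2/3 * w powr (3/2)))"
proof -
  define t where "t = 3/2 * Im (Ln w)"
  have e: "w powr (3/2) = exp (3/2 * Ln w)" using w by (simp add: powr_def)
  have "Re (2/3 * w powr (3/2)) = 2/3 * (exp (3/2 * Re (Ln w)) * cos t)"
    unfolding e by (simp add: Re_exp t_def)
  then have c: "0 < cos t" using pos by (simp add: zero_less_mult_iff)
  have "\<bar>Im (Ln w)\<bar> \<le> pi" using w by (auto simp: abs_le_iff intro: less_imp_le mpi_less_Im_Ln Im_Ln_le_pi)
      (metis less_eq_real_def minus_le_iff mpi_less_Im_Ln)
  then have t: "\<bar>t\<bar> \<le> 3/2 * pi" by (simp add: t_def abs_mult)
  have "\<bar>t\<bar> < pi / 2"
  proof (rule ccontr)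
    assume "\<not> \<bar>t\<bar> < pi / 2"
    then have "0 \<le> cos (\<bar>t\<bar> - pi)" using t by (intro cos_ge_zero) linarith+
    then have "cos \<bar>t\<bar> \<le> 0" by (simp add: cos_diff)
    then show False using c by simp
  qed
  then have "Ln (exp (3/2 * Ln w)) = 3/2 * Ln w"
    using pi_gt_zero by (intro Ln_exp) (auto simp: t_def abs_less_iff)
  then show ?thesis using e by simp
qed

lemma xi_zeta_Ln:
  assumes pos: "0 < Re (xi V z)"
  shows "zeta V z \<noteq> 0" "zeta V z = exp (2/3 * Ln (3/2 * xi V z))"
    "zeta V z powr (1/4) = exp (Ln (3/2 * xi V z) / 6)" "zeta V z powr (1/2) = exp (Ln (3/2 * xi V z) / 3)"
proof -
  show z: "zeta V z \<noteq> 0" using pos by (auto simp: xi_def)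
  have L: "3/2 * Ln (zeta V z) = Ln (3/2 * xi V z)"
    using Ln_three_halves[OF pos[unfolded xi_def] z] by (simp only: xi_def)
  show "zeta V z = exp (2/3 * Ln (3/2 * xi V z))" unfolding L[symmetric] using z by simp
  show "zeta V z powr (1/4) = exp (Ln (3/2 * xi V z) / 6)" "zeta V z powr (1/2) = exp (Ln (3/2 * xi V z) / 3)"
    unfolding L[symmetric] using z by (simp_all add: powr_def)
qed

text \<open>The imaginary part of \<xi> stays constant while its real part grows, so arg \<xi>
  \<longlongrightarrow> 0; this fixes the sector in which the Airy argument ends up.\<close>

lemma Im_Ln_tendsto_0:
  fixes r :: "'a \<Rightarrow> real"
  assumes "filterlim r at_top F"
  shows "((\<lambda>x. Im (Ln (3/2 * (of_real (r x) - of_real c * \<i>)))) \<longlongrightarrow> 0) F"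
proof -
  have "((\<lambda>y. (- c) / y) \<longlongrightarrow> 0) at_top" by real_asymp
  then have "((\<lambda>y. arctan ((- c) / y)) \<longlongrightarrow> 0) at_top" using tendsto_arctan by fastforce
  then have "((\<lambda>x. arctan ((- c) / r x)) \<longlongrightarrow> 0) F" by (rule filterlim_compose[OF _ assms])
  moreover have "\<forall>\<^sub>F x in F. 0 < r x" using assms by (simp add: filterlim_at_top_dense)
  then have "\<forall>\<^sub>F x in F. arctan ((- c) / r x) = Im (Ln (3/2 * (of_real (r x) - of_real c * \<i>)))"
  proof eventually_elim
    case (elim x)
    let ?z = "3/2 * (of_real (r x) - of_real c * \<i>)"
    have z: "0 < Re ?z" "Im ?z / Re ?z = (- c) / r x" using elim by auto
    then have "?z \<noteq> 0" by (metis less_irrefl zero_complex.sel(1))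
    from Im_Ln_eq[OF this] have "Im (Ln ?z) = arctan (Im ?z / Re ?z)" using z(1) less_imp_neq[OF z(1)] by metis
    then show ?case unfolding z(2) by (rule sym)
  qed
  ultimately show ?thesis by (rule Lim_transform_eventually)
qed

text \<open>The three solutions are treated together: with \<open>\<sigma> = - j\<close> the Airy function is evaluated at
  \<open>(c\<^sub>0 cis (\<sigma> \<pi> / 3))\<^sup>2\<close>, where \<open>c\<^sub>0\<^sup>2 = \<mu>^(2/3) \<zeta>\<close> and \<open>2/3 c\<^sub>0\<^sup>3 = \<mu> \<xi>\<close>.\<close>

lemma Ai_rot_at_top:
  fixes \<sigma> :: int and mu c :: real
  assumes r: "filterlim r at_top F" and xi: "\<forall>\<^sub>F x in F. X x = of_real (r x) - of_real c * \<i>"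
    and mu: "0 < mu" and \<sigma>: "\<sigma> \<in> {-1, 0, 1}"
  defines "\<epsilon> \<equiv> (if \<sigma> = 0 then 1 else - 1 :: real)"
  defines "s \<equiv> \<lambda>x. of_real (mu powr (1/6)) * exp (Ln (3/2 * X x) / 6)"
  defines "y \<equiv> \<lambda>x. of_real (mu powr (2/3)) * exp (2/3 * Ln (3/2 * X x))"
  shows "((\<lambda>x. s x * exp (of_real (\<epsilon> * mu) * X x) * Ai_rot (- \<sigma>) (y x)) \<longlongrightarrow>
      cis (- of_int \<sigma> * pi / 6) * of_real (1 / (2 * sqrt pi))) F"
    and "((\<lambda>x. exp (of_real (\<epsilon> * mu) * X x) * deriv (Ai_rot (- \<sigma>)) (y x) / s x) \<longlongrightarrow>
      - (of_real \<epsilon> * cis (- of_int \<sigma> * pi / 6) * of_real (1 / (2 * sqrt pi)))) F"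
proof -
  define \<eta> where "\<eta> = (\<lambda>x. Ln (3/2 * X x))"
  have s_eq: "s x = of_real (mu powr (1/6)) * exp (\<eta> x / 6)" and y_eq: "y x = of_real (mu powr (2/3)) * exp (2/3 * \<eta> x)" for x
    by (simp_all only: s_def y_def \<eta>_def)
  define C where "C = (\<lambda>x. of_real (mu powr (1/3)) * exp (\<eta> x / 3) * cis (of_int \<sigma> * pi / 3))"
  have \<sigma>': "\<bar>real_of_int \<sigma>\<bar> \<le> 1" using \<sigma> by auto
  have rpos: "\<forall>\<^sub>F x in F. 0 < r x" using r by (simp add: filterlim_at_top_dense)
  have nz: "\<forall>\<^sub>F x in F. X x \<noteq> 0" using rpos xi by eventually_elim (auto simp: complex_eq_iff)
  have "((\<lambda>x. Im (Ln (3/2 * (of_real (r x) - of_real c * \<i>)))) \<longlongrightarrow> 0) F" by (rule Im_Ln_tendsto_0[OF r])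
  then have im: "((\<lambda>x. Im (\<eta> x)) \<longlongrightarrow> 0) F"
    by (rule Lim_transform_eventually) (use xi in \<open>auto simp: \<eta>_def elim: eventually_mono\<close>)
  have inf: "filterlim C at_infinity F"
  proof -
    have g: "filterlim (\<lambda>x. r x powr (1/3)) at_top F" 
      by (rule filterlim_compose[OF _ r]) real_asymp
    have ge: "\<forall>\<^sub>F x in F. mu powr (1/3) * r x powr (1/3) \<le> cmod (C x)"
      using nz xi rpos
    proof eventually_elim
      case (elim x)
      have "r x \<le> cmod (X x)" using complex_Re_le_cmod[of "X x"] elim by simp
      also have "\<dots> \<le> 3/2 * cmod (X x)" by simp
      finally have "r x powr (1/3) \<le> (3/2 * cmod (X x)) powr (1/3)" using elim by (intro powr_mono2) auto
      also have "\<dots> = exp (Re (\<eta> x) / 3)" using elim(1) by (simp add: \<eta>_def powr_def norm_mult norm_divide)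
      finally show ?case using mu by (simp add: C_def norm_mult mult_left_mono)
    qed
    have "filterlim (\<lambda>x. mu powr (1/3) * r x powr (1/3)) at_top F"
      by (rule filterlim_tendsto_pos_mult_at_top[OF tendsto_const _ g]) (use mu in simp)
    then have "filterlim (\<lambda>x. cmod (C x)) at_top F" by (rule filterlim_at_top_mono[OF _ ge])
    then show ?thesis using filterlim_norm_at_top_imp_at_infinity by blast
  qed
  \<comment> \<open>In the limit arg C is \<sigma> pi/3, whose cosine is at least 1/2; any threshold
    below 1/2 would do, and 1/4 matches the sector of the Airy asymptotics.\<close>
  have sec: "\<forall>\<^sub>F x in F. cmod (C x) \<le> 4 * Re (C x)"
  proof -
    have "((\<lambda>x. cos (Im (\<eta> x) / 3 + of_int \<sigma> * pi / 3)) \<longlongrightarrow> cos (0 / 3 + of_int \<sigma> * pi / 3)) F"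
      by (intro isCont_tendsto_compose[OF isCont_cos] tendsto_add tendsto_divide tendsto_const im) simp
    moreover have "1 / 4 < cos (0 / 3 + of_int \<sigma> * pi / 3)" using \<sigma> by (auto simp: cos_60)
    ultimately have "\<forall>\<^sub>F x in F. 1 / 4 < cos (Im (\<eta> x) / 3 + of_int \<sigma> * pi / 3)" by (rule order_tendstoD)
    then show ?thesis
    proof eventually_elim
      case (elim x)
      have "C x = of_real (mu powr (1/3) * exp (Re (\<eta> x) / 3)) * cis (Im (\<eta> x) / 3 + of_int \<sigma> * pi / 3)"
        by (simp add: C_def exp_eq_polar cis_mult[symmetric] mult_ac)
      then have "Re (C x) = (mu powr (1/3) * exp (Re (\<eta> x) / 3)) * cos (Im (\<eta> x) / 3 + of_int \<sigma> * pi / 3)"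
        "cmod (C x) = mu powr (1/3) * exp (Re (\<eta> x) / 3)"
        by (simp_all only: Re_of_real_times cis.simps norm_mult norm_cis norm_of_real) auto
      moreover have "(mu powr (1/3) * exp (Re (\<eta> x) / 3)) * (1 / 4) \<le> (mu powr (1/3) * exp (Re (\<eta> x) / 3)) * cos (Im (\<eta> x) / 3 + of_int \<sigma> * pi / 3)"
        using elim by (intro mult_left_mono) auto
      ultimately show ?case by linarith
    qed
  qed
  have half: "complex_of_real (mu powr (1/6)) ^ 2 = of_real (mu powr (1/3))" "complex_of_real (mu powr (1/3)) ^ 2 = of_real (mu powr (2/3))"
    "complex_of_real (mu powr (1/3)) ^ 3 = of_real mu"
    using mu by (simp_all add: powr_power flip: of_real_power)
  \<comment> \<open>The candidate is the principal root because its argument is at most pi/6 + pi/6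
    in absolute value, hence below pi/2.\<close>
  have csq: "csqrt (C x) = s x * cis (of_int \<sigma> * pi / 6)" if "X x \<noteq> 0" for x
  proof (rule csqrt_unique)
    have "exp (\<eta> x / 6) ^ 2 = exp (\<eta> x / 3)" using exp_double[of "\<eta> x / 6"] by simp
    moreover have "cis (of_int \<sigma> * pi / 6) ^ 2 = cis (of_int \<sigma> * pi / 3)" by (simp add: Complex.DeMoivre mult.commute)
    ultimately show "(s x * cis (of_int \<sigma> * pi / 6))\<^sup>2 = C x"
      unfolding s_eq C_def by (simp add: power_mult_distrib half)
    have "\<bar>Im (\<eta> x)\<bar> \<le> pi"
      using that mpi_less_Im_Ln[of "3/2 * X x"] Im_Ln_le_pi[of "3/2 * X x"] by (simp add: \<eta>_def abs_le_iff)
    moreover have "\<bar>of_int \<sigma> * pi / 6\<bar> \<le> pi / 6" using \<sigma>' by (simp add: abs_mult mult_left_le_one_le)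
    ultimately have "\<bar>Im (\<eta> x) / 6 + of_int \<sigma> * pi / 6\<bar> < pi / 2" 
    proof -
      have "\<bar>u / 6 + v\<bar> < p / 2" if "\<bar>u\<bar> \<le> p" "\<bar>v\<bar> \<le> p / 6" "0 < p" for u v p :: real
        using that by linarith
      then show ?thesis using \<open>\<bar>Im (\<eta> x)\<bar> \<le> pi\<close> \<open>\<bar>of_int \<sigma> * pi / 6\<bar> \<le> pi / 6\<close> pi_gt_zero by blast
    qed
    then have "0 < cos (Im (\<eta> x) / 6 + of_int \<sigma> * pi / 6)" by (intro cos_gt_zero_pi) linarith+
    moreover have "s x * cis (of_int \<sigma> * pi / 6) = of_real (mu powr (1/6) * exp (Re (\<eta> x) / 6)) * cis (Im (\<eta> x) / 6 + of_int \<sigma> * pi / 6)"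
      by (simp add: s_eq exp_eq_polar cis_mult[symmetric] mult_ac)
    ultimately have "0 < Re (s x * cis (of_int \<sigma> * pi / 6))"
      using mu by (simp only: Re_of_real_times cis.simps) simp
    then show "0 < Re (s x * cis (of_int \<sigma> * pi / 6)) \<or> Re (s x * cis (of_int \<sigma> * pi / 6)) = 0 \<and> 0 \<le> Im (s x * cis (of_int \<sigma> * pi / 6))"
      by blast
  qed
  have C2: "C x ^ 2 = y x * exp (- 2 * of_real pi * \<i> * of_int (- \<sigma>) / 3)" for x
  proof -
    have "exp (\<eta> x / 3) ^ 2 = exp (2/3 * \<eta> x)" using exp_double[of "\<eta> x / 3"] by simp
    moreover have "cis (of_int \<sigma> * pi / 3) ^ 2 = exp (- 2 * of_real pi * \<i> * of_int (- \<sigma>) / 3)"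
      by (subst Complex.DeMoivre, subst cis_conv_exp) (simp add: mult_ac)
    ultimately show ?thesis unfolding C_def y_eq by (simp add: power_mult_distrib half)
  qed
  have C3: "\<forall>\<^sub>F x in F. exp (2/3 * C x ^ 3) = exp (of_real (\<epsilon> * mu) * X x)"
    using nz
  proof eventually_elim
    case (elim x)
    have "exp (\<eta> x / 3) ^ 3 = 3/2 * X x" using elim exp_of_nat_mult[of 3 "\<eta> x / 3"] by (simp add: \<eta>_def)
    moreover have "cis (of_int \<sigma> * pi / 3) ^ 3 = of_real \<epsilon>" using \<sigma> by (auto simp: Complex.DeMoivre \<epsilon>_def complex_eq_iff)
    ultimately have c3: "C x ^ 3 = of_real mu * (3/2 * X x) * of_real \<epsilon>" unfolding C_def by (simp add: power_mult_distrib half)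
    have "2/3 * C x ^ 3 = of_real (\<epsilon> * mu) * X x" unfolding c3 by (simp add: field_simps)
    then show ?case by (rule arg_cong)
  qed
  have der: "deriv (Ai_rot (- \<sigma>)) (y x) = cis (2 * of_int \<sigma> * pi / 3) * deriv Ai (C x ^ 2)" for x
  proof -
    define e where "e = exp (- 2 * of_real pi * \<i> * of_int (- \<sigma>) / 3)"
    have "(Ai has_field_derivative deriv Ai (y x * e)) (at (y x * e))"
      using Ai_entire holomorphic_derivI open_UNIV by blast
    from DERIV_chain2[OF this DERIV_cmult_right[OF DERIV_ident]]
    have "((\<lambda>z. Ai (z * e)) has_field_derivative deriv Ai (y x * e) * (1 * e)) (at (y x))" by simp
    then have "deriv (\<lambda>z. Ai (z * e)) (y x) = deriv Ai (y x * e) * e" by (simp add: DERIV_imp_deriv)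
    moreover have "e = cis (2 * of_int \<sigma> * pi / 3)" unfolding e_def cis_conv_exp by (simp add: mult_ac)
    ultimately show ?thesis unfolding C2 e_def[symmetric] by (simp add: Ai_rot_def[abs_def] e_def mult.commute)
  qed
  have cisn: "cis (of_int \<sigma> * pi / 6) \<noteq> 0" by simp
  note asy = Ai_asymptotics[OF inf sec]
  have "((\<lambda>x. cis (- of_int \<sigma> * pi / 6) * (csqrt (C x) * exp (2 / 3 * C x ^ 3) * Ai (C x ^ 2))) \<longlongrightarrow>
      cis (- of_int \<sigma> * pi / 6) * of_real (1 / (2 * sqrt pi))) F"
    by (intro tendsto_mult tendsto_const asy)
  moreover have "\<forall>\<^sub>F x in F. cis (- of_int \<sigma> * pi / 6) * (csqrt (C x) * exp (2 / 3 * C x ^ 3) * Ai (C x ^ 2))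
      = s x * exp (of_real (\<epsilon> * mu) * X x) * Ai_rot (- \<sigma>) (y x)"
    using C3 nz
  proof eventually_elim
    case (elim x)
    have "cis (- of_int \<sigma> * pi / 6) * cis (of_int \<sigma> * pi / 6) = 1" by (simp add: cis_mult)
    moreover have "a * (S * b * E * D) = S * E * D" if "a * b = 1" for a b S E D :: complex
    proof -
      have "a * (S * b * E * D) = (a * b) * (S * E * D)" by (simp only: mult_ac)
      then show ?thesis using that by simp
    qed
    ultimately show ?case unfolding elim(1) csq[OF elim(2)] C2 Ai_rot_def by blast
  qed
  ultimately show "((\<lambda>x. s x * exp (of_real (\<epsilon> * mu) * X x) * Ai_rot (- \<sigma>) (y x)) \<longlongrightarrow>
      cis (- of_int \<sigma> * pi / 6) * of_real (1 / (2 * sqrt pi))) F"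
    by (rule Lim_transform_eventually)
  have l: "((\<lambda>x. cis (2 * of_int \<sigma> * pi / 3) * cis (of_int \<sigma> * pi / 6) * (exp (2 / 3 * C x ^ 3) * deriv Ai (C x ^ 2) / csqrt (C x))) \<longlongrightarrow>
      cis (2 * of_int \<sigma> * pi / 3) * cis (of_int \<sigma> * pi / 6) * (- of_real (1 / (2 * sqrt pi)))) F"
    by (intro tendsto_mult tendsto_const asy)
  \<comment> \<open>The derivative of the rotated function brings cis(2 \<sigma> pi/3) and the root
    cis(\<sigma> pi/6). Their angles add to \<sigma> pi - \<sigma> pi/6, and cis(\<sigma> pi) =
    \<epsilon> is the sign that separates the recessive case from the two growing ones.\<close>
  have e0: "cis (2 * of_int \<sigma> * pi / 3) * cis (of_int \<sigma> * pi / 6) * (- of_real (1 / (2 * sqrt pi)))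
      = - (of_real \<epsilon> * cis (- of_int \<sigma> * pi / 6) * of_real (1 / (2 * sqrt pi)))"
  proof -
    have "cis (2 * of_int \<sigma> * pi / 3) * cis (of_int \<sigma> * pi / 6) = cis (of_int \<sigma> * pi) * cis (- of_int \<sigma> * pi / 6)"
      unfolding cis_mult by (simp add: field_simps)
    moreover have "cis (of_int \<sigma> * pi) = of_real \<epsilon>" using \<sigma> by (auto simp: \<epsilon>_def complex_eq_iff)
    ultimately show ?thesis by (simp only: mult_minus_right)
  qed
  have e1: "\<forall>\<^sub>F x in F. cis (2 * of_int \<sigma> * pi / 3) * cis (of_int \<sigma> * pi / 6) * (exp (2 / 3 * C x ^ 3) * deriv Ai (C x ^ 2) / csqrt (C x))
      = exp (of_real (\<epsilon> * mu) * X x) * deriv (Ai_rot (- \<sigma>)) (y x) / s x"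
    using C3 nz
  proof eventually_elim
    case (elim x)
    have "q * p * (E * D / (S * p)) = E * (q * D) / S" if "p \<noteq> 0" for q p E D S :: complex
      using that by (simp add: mult_ac)
    then show ?case unfolding elim(1) csq[OF elim(2)] der using cisn by blast
  qed
  show "((\<lambda>x. exp (of_real (\<epsilon> * mu) * X x) * deriv (Ai_rot (- \<sigma>)) (y x) / s x) \<longlongrightarrow>
      - (of_real \<epsilon> * cis (- of_int \<sigma> * pi / 6) * of_real (1 / (2 * sqrt pi)))) F"
    by (rule Lim_transform_eventually[OF l[unfolded e0] e1])
qed


lemma xi_real_filterlim:
  assumes "0 \<le> lam" "lam < 1"
  shows "filterlim (xi_real lam) at_top at_top"
proof -
  define K where "K = (1 + lam) * ln (1 - lam ^ 2) / 2"
  have "LIM x at_top. sqrt (x ^ 2 - 4 * lam * x + 4) / 2 - lam * ln ((sqrt (x ^ 2 - 4 * lam * x + 4) + x - 2 * lam) / 2)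
     - ln ((sqrt (x ^ 2 - 4 * lam * x + 4) - lam * x + 2) / x) + K :> at_top"
    using assms by real_asymp
  then show ?thesis unfolding xi_real_def[abs_def] Z_real_def K_def .
qed

lemma qrt_at_top:
  assumes tp: "turning_point_branches lam V" and lam: "0 \<le> lam" "lam < 1"
  shows "((\<lambda>x. qrt V (of_real x)) \<longlongrightarrow> 1) at_top"
proof -
  have "((\<lambda>x. sqrt (x / sqrt (x ^ 2 - 4 * lam * x + 4))) \<longlongrightarrow> 1) at_top" by real_asymp
  then have l: "((\<lambda>x. complex_of_real (sqrt (x / sqrt (x ^ 2 - 4 * lam * x + 4)))) \<longlongrightarrow> of_real 1) at_top"
    by (rule tendsto_of_real)
  have e: "\<forall>\<^sub>F x in at_top. complex_of_real (sqrt (x / sqrt (x ^ 2 - 4 * lam * x + 4))) = qrt V (of_real x)"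
    using eventually_gt_at_top[of 0]
  proof eventually_elim
    case (elim x)
    have cp: "of_real x \<in> cut_plane V" by (rule positive_real_in_cut_plane[OF tp lam elim])
    have r: "qrt V (of_real x) \<in> \<real>" "Re (qrt V (of_real x)) > 0" and sq: "qrt V (of_real x) ^ 2 = of_real x / Zrt V (of_real x)"
      using tp cp elim by (auto simp: turning_point_branches_def)
    define y where "y = Re (qrt V (of_real x))"
    have y: "qrt V (of_real x) = of_real y" "0 < y" using r by (simp_all add: y_def)
    have "complex_of_real (y ^ 2) = of_real (x / sqrt (x ^ 2 - 4 * lam * x + 4))"
      using sq y Zrt_of_real[OF tp elim cp] by simp
    then have "y ^ 2 = x / sqrt (x ^ 2 - 4 * lam * x + 4)" by (simp only: of_real_eq_iff)
    then show ?case using y by (metis less_imp_le real_sqrt_unique)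
  qed
  show ?thesis using Lim_transform_eventually[OF l e] by simp
qed

lemma Ecal_gen_at_top:
  assumes tp: "turning_point_branches lam V" and lam: "0 \<le> lam" "lam < 1" and k: "1 \<le> k"
  shows "((\<lambda>x. Ecal_gen \<beta> lam V k (of_real x)) \<longlongrightarrow> (if even k then 0 else of_real (Ehat_inf lam V (k div 2)))) at_top"
proof -
  have lam1: "\<bar>lam\<bar> < 1" using lam by simp
  note pos = positive_real_in_cut_plane[OF tp lam]
  have E: "((\<lambda>x. Ehat lam V k (of_real x)) \<longlongrightarrow> 0) at_top" by (rule Ehat_at_top[OF tp pos lam1 k])
  have P: "((\<lambda>x. Ehat_plus lam V k (of_real x)) \<longlongrightarrow> (if even k then 0 else of_real (Ehat_inf lam V (k div 2)))) at_top"
    unfolding Ehat_plus_def using tendsto_add[OF E tendsto_const[of "complex_of_real (Ehat_inf lam V (k div 2))"]] E by simp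
  have inf: "filterlim (\<lambda>x. xi V (of_real x)) at_infinity at_top"
  proof (rule filterlim_norm_at_top_imp_at_infinity, rule filterlim_at_top_mono[OF xi_real_filterlim[OF lam]])
    show "\<forall>\<^sub>F x in at_top. xi_real lam x \<le> cmod (xi V (of_real x))"
      using eventually_gt_at_top[of 0]
    proof eventually_elim
      case (elim x)
      show ?case using xi_of_real[OF tp lam1 elim pos[OF elim]] complex_Re_le_cmod[of "xi V (of_real x)"] by simp
    qed
  qed
  have "((\<lambda>x. inverse (xi V (of_real x))) \<longlongrightarrow> 0) at_top" by (rule filterlim_compose[OF tendsto_inverse_0 inf])
  then have "((\<lambda>x. (-1) ^ k * of_real (airy_coeff \<beta> k) / of_nat k * inverse (xi V (of_real x)) ^ k)
      \<longlongrightarrow> (-1) ^ k * of_real (airy_coeff \<beta> k) / of_nat k * 0 ^ k) at_top"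
    by (intro tendsto_mult tendsto_const tendsto_power)
  then have X: "((\<lambda>x. (-1) ^ k * of_real (airy_coeff \<beta> k) / (of_nat k * xi V (of_real x) ^ k)) \<longlongrightarrow> 0) at_top"
    using k by (simp add: power_inverse divide_inverse mult_ac power_0_left)
  show ?thesis unfolding Ecal_gen_def using tendsto_add[OF P X] by simp
qed

text \<open>All powers of \<zeta> cancel: \<open>phi\<close> supplies \<zeta>^(1/4), Ai decays with
  \<zeta>^(-1/4), and Ai' grows with \<zeta>^(1/4) against the \<zeta>^(-1/2) in
  \<open>B_approx\<close>. Only \<mu>^(-1/6) survives in both terms. The factor with \<epsilon>
  removes the exponential growth or decay.\<close>

lemma w_airy_at_top:
  fixes \<sigma> :: int
  assumes tp: "turning_point_branches lam V" and lam: "0 \<le> lam" "lam < 1" and mu: "0 < mu" and \<sigma>: "\<sigma> \<in> {-1, 0, 1}"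
    and A: "\<forall>\<^sub>F x in at_top. A (of_real x) = A_approx m mu lam V (of_real x) * (1 + et (of_real x))"
    and B: "\<forall>\<^sub>F x in at_top. B (of_real x) = B_approx m mu lam V (of_real x) * (1 + e (of_real x))"
    and et: "((\<lambda>x::real. et (of_real x)) \<longlongrightarrow> ti) at_top" and e: "((\<lambda>x::real. e (of_real x)) \<longlongrightarrow> ei) at_top"
  defines "\<epsilon> \<equiv> (if \<sigma> = 0 then 1 else - 1 :: real)"
  defines "S \<equiv> complex_of_real (odd_sum_inf m mu lam V)"
  shows "((\<lambda>x. w_airy mu V A B (- \<sigma>) (of_real x) * exp (of_real (\<epsilon> * mu) * xi V (of_real x))) \<longlongrightarrow>
    of_real (mu powr (-1/6)) * (cis (- of_int \<sigma> * pi / 6) * of_real (1 / (2 * sqrt pi))) *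
      (cosh S * (1 + ti) - of_real \<epsilon> * sinh S * (1 + ei))) at_top"
proof -
  have lam1: "\<bar>lam\<bar> < 1" using lam by simp
  define X where "X = (\<lambda>x. xi V (complex_of_real x))"
  define s where "s = (\<lambda>x. of_real (mu powr (1/6)) * exp (Ln (3/2 * X x) / 6))"
  define y where "y = (\<lambda>x. of_real (mu powr (2/3)) * exp (2/3 * Ln (3/2 * X x)))"
  define c where "c = cis (- of_int \<sigma> * pi / 6) * of_real (1 / (2 * sqrt pi))"
  have Xeq: "X x = of_real (xi_real lam x) - of_real ((1 - lam) * pi / 2) * \<i>" if "0 < x" for x
    unfolding X_def by (rule xi_of_real[OF tp lam1 that positive_real_in_cut_plane[OF tp lam that]])
  have Xev: "\<forall>\<^sub>F x in at_top. X x = of_real (xi_real lam x) - of_real ((1 - lam) * pi / 2) * \<i>"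
    using eventually_gt_at_top[of 0] by eventually_elim (rule Xeq)
  have airy1: "((\<lambda>x. s x * exp (of_real (\<epsilon> * mu) * X x) * Ai_rot (- \<sigma>) (y x)) \<longlongrightarrow> c) at_top"
    and airy2: "((\<lambda>x. exp (of_real (\<epsilon> * mu) * X x) * deriv (Ai_rot (- \<sigma>)) (y x) / s x) \<longlongrightarrow> - (of_real \<epsilon> * c)) at_top"
    using Ai_rot_at_top[OF xi_real_filterlim[OF lam] Xev mu \<sigma>] unfolding s_def y_def c_def \<epsilon>_def by (simp_all only: mult.assoc)
  define EA where "EA = (\<lambda>x. exp (\<Sum>s = 1..m. Ecal_tilde lam V (2 * s) (of_real x) / of_real mu ^ (2 * s)))"
  define EB where "EB = (\<lambda>x. exp (\<Sum>s = 1..m. Ecal lam V (2 * s) (of_real x) / of_real mu ^ (2 * s)))"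
  define TA where "TA = (\<lambda>x. \<Sum>s = 0..m. Ecal_tilde lam V (2 * s + 1) (of_real x) / of_real mu ^ (2 * s + 1))"
  define TB where "TB = (\<lambda>x. \<Sum>s = 0..m. Ecal lam V (2 * s + 1) (of_real x) / of_real mu ^ (2 * s + 1))"
  have ev: "((\<lambda>x. exp (\<Sum>s = 1..m. Ecal_gen \<beta> lam V (2 * s) (of_real x) / of_real mu ^ (2 * s))) \<longlongrightarrow> 1) at_top" for \<beta>
  proof -
    have "((\<lambda>x. exp (\<Sum>s = 1..m. Ecal_gen \<beta> lam V (2 * s) (of_real x) / of_real mu ^ (2 * s))) \<longlongrightarrow>
        exp (\<Sum>s = 1..m. (if even (2 * s) then 0 else of_real (Ehat_inf lam V (2 * s div 2))) / of_real mu ^ (2 * s))) at_top"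
      using mu by (intro tendsto_exp tendsto_sum tendsto_divide tendsto_const Ecal_gen_at_top tp lam) auto
    then show ?thesis by simp
  qed
  have od: "((\<lambda>x. \<Sum>s = 0..m. Ecal_gen \<beta> lam V (2 * s + 1) (of_real x) / of_real mu ^ (2 * s + 1)) \<longlongrightarrow> S) at_top" for \<beta>
  proof -
    have "((\<lambda>x. \<Sum>s = 0..m. Ecal_gen \<beta> lam V (2 * s + 1) (of_real x) / of_real mu ^ (2 * s + 1)) \<longlongrightarrow>
        (\<Sum>s = 0..m. (if even (2 * s + 1) then 0 else of_real (Ehat_inf lam V ((2 * s + 1) div 2))) / of_real mu ^ (2 * s + 1))) at_top"
      using mu by (intro tendsto_sum tendsto_divide tendsto_const Ecal_gen_at_top tp lam) auto
    then show ?thesis by (simp add: S_def odd_sum_inf_def)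
  qed
  have ch: "((\<lambda>x. cosh (TA x)) \<longlongrightarrow> cosh S) at_top" and sh: "((\<lambda>x. sinh (TB x)) \<longlongrightarrow> sinh S) at_top"
    unfolding cosh_field_def sinh_field_def TA_def TB_def by (intro tendsto_intros od; simp)+
  have EAl: "(EA \<longlongrightarrow> 1) at_top" "(EB \<longlongrightarrow> 1) at_top" unfolding EA_def EB_def by (rule ev)+
  have l: "((\<lambda>x. of_real (mu powr (-1/6)) * qrt V (of_real x) *
      ((s x * exp (of_real (\<epsilon> * mu) * X x) * Ai_rot (- \<sigma>) (y x)) * (EA x * cosh (TA x) * (1 + et (of_real x)))
       + (exp (of_real (\<epsilon> * mu) * X x) * deriv (Ai_rot (- \<sigma>)) (y x) / s x) * (EB x * sinh (TB x) * (1 + e (of_real x)))))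
     \<longlongrightarrow> of_real (mu powr (-1/6)) * 1 * (c * (1 * cosh S * (1 + ti)) + (- (of_real \<epsilon> * c)) * (1 * sinh S * (1 + ei)))) at_top"
    by (intro tendsto_mult tendsto_add tendsto_const qrt_at_top[OF tp lam] airy1 airy2 EAl ch sh et e)
  have eq: "\<forall>\<^sub>F x in at_top. of_real (mu powr (-1/6)) * qrt V (of_real x) *
      ((s x * exp (of_real (\<epsilon> * mu) * X x) * Ai_rot (- \<sigma>) (y x)) * (EA x * cosh (TA x) * (1 + et (of_real x)))
       + (exp (of_real (\<epsilon> * mu) * X x) * deriv (Ai_rot (- \<sigma>)) (y x) / s x) * (EB x * sinh (TB x) * (1 + e (of_real x))))
      = w_airy mu V A B (- \<sigma>) (of_real x) * exp (of_real (\<epsilon> * mu) * xi V (of_real x))"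
  proof -
    have "\<forall>\<^sub>F x in at_top. 0 < xi_real lam x"
      using xi_real_filterlim[OF lam] by (simp add: filterlim_at_top_dense)
    then show ?thesis using Xev A B
    proof eventually_elim
      case (elim x)
      have "0 < Re (xi V (of_real x))" using elim(1,2) by (simp add: X_def)
      note Z = xi_zeta_Ln[OF this, folded X_def[THEN fun_cong, of x, simplified]]
      \<comment> \<open>g is \<zeta>^(1/4) and M is \<mu>^(1/6); in these two quantities the
        cancellation of powers is rational algebra.\<close>
      define g where "g = exp (Ln (3/2 * X x) / 6)"
      define M where "M = complex_of_real (mu powr (1/6))"
      have g: "g \<noteq> 0" by (simp add: g_def)
      have M: "M \<noteq> 0" using mu by (simp add: M_def)
      have M': "complex_of_real (mu powr (-1/6)) = inverse M" by (simp add: M_def powr_minus[of _ "1/6", simplified])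
      have M2: "complex_of_real (mu powr (1/3)) = M * M" unfolding M_def of_real_mult[symmetric] powr_add[symmetric] by simp
      have g2: "exp (Ln (3/2 * X x) / 3) = g * g" unfolding g_def mult_exp_exp by simp
      have ph: "phi V (of_real x) = qrt V (of_real x) * g" unfolding phi_def g_def using Z(3) by (simp add: X_def)
      have zh: "zeta V (of_real x) powr (1/2) = g * g" using Z(4) g2 by (simp add: X_def)
      have yx: "of_real (mu powr (2/3)) * zeta V (of_real x) = y x" using Z(2) by (simp add: y_def X_def)
      have sx: "s x = M * g" by (simp only: s_def M_def g_def)
      have Ax: "A (of_real x) = qrt V (of_real x) * g * EA x * cosh (TA x) * (1 + et (of_real x))"
        unfolding elim(3) A_approx_def ph EA_def TA_def ..
      have Bx: "B (of_real x) = qrt V (of_real x) * g / (M * M * (g * g)) * EB x * sinh (TB x) * (1 + e (of_real x))"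
        unfolding elim(4) B_approx_def ph zh M2 EB_def TB_def ..
      have alg: "inverse M * q * ((M * g * E * a) * P + (E * b / (M * g)) * R) = (a * (q * g * P) + b * (q * g / (M * M * (g * g)) * R)) * E" for q E a b P R
        using M g by (simp add: field_simps)
      show ?case
        unfolding w_airy_def yx Ax Bx M' sx X_def[symmetric]
        using alg[of "qrt V (of_real x)" "exp (of_real (\<epsilon> * mu) * X x)" "Ai_rot (- \<sigma>) (y x)" "EA x * cosh (TA x) * (1 + et (of_real x))"
            "deriv (Ai_rot (- \<sigma>)) (y x)" "EB x * sinh (TB x) * (1 + e (of_real x))"]
        by (simp only: X_def mult.assoc)
    qed
  qed
  have eq2: "of_real (mu powr (-1/6)) * 1 * (c * (1 * cosh S * (1 + ti)) + (- (of_real \<epsilon> * c)) * (1 * sinh S * (1 + ei)))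
      = of_real (mu powr (-1/6)) * c * (cosh S * (1 + ti) - of_real \<epsilon> * sinh S * (1 + ei))"
    by (simp add: algebra_simps)
  show ?thesis unfolding c_def[symmetric] eq2[symmetric] by (rule Lim_transform_eventually[OF l eq])
qed

text \<open>The Whittaker exponent \<kappa> ln(\<mu> x) - \<mu> x/2 cancels the divergent part of
  \<mu> \<xi>, so the product converges. \<epsilon> = 1 belongs to the decaying solution and
  \<epsilon> = -1 to the growing ones.\<close>

lemma exponential_factor_at_top:
  assumes tp: "turning_point_branches lam V" and lam: "0 \<le> lam" "lam < 1" and mu: "0 < mu"
  defines "kappa \<equiv> lam * mu"
  shows "((\<lambda>x. of_real (exp (\<epsilon> * (kappa * ln (mu * x) - mu * x / 2))) * exp (of_real (\<epsilon> * mu) * xi V (of_real x))) \<longlongrightarrow>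
    exp (of_real \<epsilon> * (of_real (kappa * ln mu - kappa - mu * ln (1 - lam) + (mu + kappa) / 2 * ln (1 - lam ^ 2))
      - of_real ((mu - kappa) * pi / 2) * \<i>))) at_top"
proof -
  have lam1: "\<bar>lam\<bar> < 1" using lam by simp
  define D where "D = (\<lambda>x. xi_real lam x - (x / 2 - lam - lam * ln x - ln (1 - lam) + (1 + lam) * ln (1 - lam ^ 2) / 2))"
  define g where "g = kappa * ln mu - kappa - mu * ln (1 - lam) + (mu + kappa) / 2 * ln (1 - lam ^ 2)"
  have "((\<lambda>x. exp (of_real \<epsilon> * (of_real (mu * D x + g) - of_real ((mu - kappa) * pi / 2) * \<i>))) \<longlongrightarrow>
      exp (of_real \<epsilon> * (of_real (mu * 0 + g) - of_real ((mu - kappa) * pi / 2) * \<i>))) at_top"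
    unfolding D_def
    by (intro tendsto_exp tendsto_mult tendsto_diff tendsto_add tendsto_of_real tendsto_const xi_real_at_top lam)
  moreover have "\<forall>\<^sub>F x in at_top. exp (of_real \<epsilon> * (of_real (mu * D x + g) - of_real ((mu - kappa) * pi / 2) * \<i>))
      = of_real (exp (\<epsilon> * (kappa * ln (mu * x) - mu * x / 2))) * exp (of_real (\<epsilon> * mu) * xi V (of_real x))"
    using eventually_gt_at_top[of 0]
  proof eventually_elim
    case (elim x)
    have r: "mu * D x + g = kappa * ln (mu * x) - mu * x / 2 + mu * xi_real lam x"
      unfolding D_def g_def kappa_def using mu elim by (simp add: ln_mult field_simps)
    have i: "(mu - kappa) * pi / 2 = mu * ((1 - lam) * pi / 2)" by (simp add: kappa_def algebra_simps)
    have "of_real \<epsilon> * (of_real (mu * D x + g) - of_real ((mu - kappa) * pi / 2) * \<i>)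
      = complex_of_real (\<epsilon> * (kappa * ln (mu * x) - mu * x / 2)) + of_real (\<epsilon> * mu) * xi V (of_real x)"
      unfolding r i xi_of_real[OF tp lam1 elim positive_real_in_cut_plane[OF tp lam elim]]
      by (simp add: algebra_simps)
    then show ?case by (simp only: exp_add exp_of_real)
  qed
  ultimately show ?thesis unfolding g_def by (simp only: mult_zero_right add_0_left) (rule Lim_transform_eventually)
qed

text \<open>Whittaker functions are normalized by \<rho> and Airy-type solutions by e. As \<rho> e
  converges as well, the constant of proportionality can be compared in the limit.\<close>

lemma connection_constant:
  fixes u w e :: "real \<Rightarrow> complex" and \<rho> :: "real \<Rightarrow> real"
  assumes u: "\<forall>\<^sub>F x in at_top. u x = k * w x" and r: "((\<lambda>x. u x / of_real (\<rho> x)) \<longlongrightarrow> r) at_top"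
    and L: "((\<lambda>x. w x * e x) \<longlongrightarrow> L) at_top" and G: "((\<lambda>x. of_real (\<rho> x) * e x) \<longlongrightarrow> G) at_top"
    and \<rho>: "\<And>x. 0 < \<rho> x"
  shows "k * L = r * G"
proof (rule tendsto_unique[OF trivial_limit_at_top_linorder])
  show "((\<lambda>x. k * (w x * e x)) \<longlongrightarrow> k * L) at_top" by (intro tendsto_intros L)
  have "((\<lambda>x. u x / of_real (\<rho> x) * (of_real (\<rho> x) * e x)) \<longlongrightarrow> r * G) at_top" by (intro tendsto_intros r G)
  moreover have "\<forall>\<^sub>F x in at_top. u x / of_real (\<rho> x) * (of_real (\<rho> x) * e x) = k * (w x * e x)"
    using u
  proof eventually_elim
    case (elim x)
    then show ?case using \<rho>[of x] by simp
  qed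
  ultimately show "((\<lambda>x. k * (w x * e x)) \<longlongrightarrow> r * G) at_top" by (rule Lim_transform_eventually)
qed

section \<open>Connection constants\<close>

lemma LG_solution_diff:
  assumes "LG_solution mu lam v" "LG_solution mu lam w"
  shows "LG_solution mu lam (\<lambda>z. v z - w z)"
proof -
  have an: "v analytic_on Cplus" "w analytic_on Cplus" using assms by (auto simp: LG_solution_def)
  have "deriv (deriv (\<lambda>z. v z - w z)) z = deriv (deriv v) z - deriv (deriv w) z" if z: "z \<in> Cplus" for z
  proof -
    obtain e1 where e1: "e1 > 0" "v holomorphic_on ball z e1" using an(1) z unfolding analytic_on_def by blast
    obtain e2 where e2: "e2 > 0" "w holomorphic_on ball z e2" using an(2) z unfolding analytic_on_def by blast
    define U where "U = ball z e1 \<inter> ball z e2"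
    have U: "open U" "z \<in> U" "v holomorphic_on U" "w holomorphic_on U"
      using e1 e2 by (auto simp: U_def intro: holomorphic_on_subset)
    have 1: "deriv (\<lambda>z. v z - w z) x = deriv v x - deriv w x" if "x \<in> U" for x
      by (rule DERIV_imp_deriv, rule DERIV_diff) (use U that holomorphic_derivI in blast)+
    have "((\<lambda>z. deriv v z - deriv w z) has_field_derivative deriv (deriv v) z - deriv (deriv w) z) (at z)"
      by (rule DERIV_diff) (use U holomorphic_derivI holomorphic_deriv in blast)+
    then have "(deriv (\<lambda>z. v z - w z) has_field_derivative deriv (deriv v) z - deriv (deriv w) z) (at z)"
      by (rule has_field_derivative_transform_within_open[OF _ U(1,2)]) (simp add: 1)
    then show ?thesis by (rule DERIV_imp_deriv)
  qed
  moreover have "(\<lambda>z. v z - w z) analytic_on Cplus" by (intro analytic_intros an)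
  ultimately show ?thesis using assms by (simp add: LG_solution_def right_diff_distrib)
qed

lemma surface_log_of_real:
  assumes "0 < mu" "0 < s"
  shows "surface_log mu (of_real s) = of_real (ln (mu * s))"
    and "surface_log mu (- of_real s) = of_real (ln (mu * s)) + of_real pi * \<i>"
proof -
  have p: "0 < mu * s" using assms by simp
  have "surface_log mu (of_real s) = Ln (of_real (mu * s))" using surface_log_eq[of mu "of_real s"] assms by simp
  then show "surface_log mu (of_real s) = of_real (ln (mu * s))" using Ln_of_real[OF p] by simp
  have "- complex_of_real s \<in> Cplus" using assms by (simp add: Cplus_iff)
  then have "surface_log mu (- of_real s) = Ln (- of_real (mu * s))" using surface_log_eq[of mu "- of_real s"] assms by simp
  also have "\<dots> = Ln (of_real (mu * s)) + \<i> * of_real pi" using Ln_minus[of "of_real (mu * s)"] p assms by simp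
  also have "\<dots> = of_real (ln (mu * s)) + of_real pi * \<i>" unfolding Ln_of_real[OF p] by simp
  finally show "surface_log mu (- of_real s) = of_real (ln (mu * s)) + of_real pi * \<i>" .
qed

text \<open>The choice d = pi/2 in the definition allows |Im t| up to pi, enough for both the axis
  and its rotation by -pi.\<close>

lemma whittaker_W_along:
  assumes W: "is_whittaker_W kappa mu y" and re: "filterlim (\<lambda>x. Re (t x)) at_top F" and im: "\<And>x. \<bar>Im (t x)\<bar> \<le> pi"
  shows "((\<lambda>x. y (t x) / exp (of_real kappa * t x - exp (t x) / 2)) \<longlongrightarrow> 1) F"
proof -
  have "((\<lambda>t. y t / exp (of_real kappa * t - exp t / 2)) \<longlongrightarrow> 1)
        (inf (filtercomap Re at_top) (principal {t. \<bar>Im t\<bar> \<le> 3/2 * pi - pi / 2}))"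
    using W unfolding is_whittaker_W_def by (meson half_gt_zero pi_gt_zero)
  then show ?thesis
    by (rule filterlim_compose)
      (use re im in \<open>auto simp: filterlim_inf filterlim_filtercomap_iff o_def filterlim_principal\<close>)
qed

lemma ln_mult_at_top: "0 < mu \<Longrightarrow> LIM x at_top. ln (mu * x) :> (at_top :: real filter)"
  by real_asymp

lemma whittaker_W_real:
  assumes W: "is_whittaker_W kappa mu y" and mu: "0 < mu"
  shows "((\<lambda>x. y (of_real (ln (mu * x))) / of_real (exp (kappa * ln (mu * x) - mu * x / 2))) \<longlongrightarrow> 1) at_top"
proof -
  have "((\<lambda>x. y (of_real (ln (mu * x))) / exp (of_real kappa * of_real (ln (mu * x)) - exp (of_real (ln (mu * x))) / 2)) \<longlongrightarrow> 1) at_top"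
    by (rule whittaker_W_along[OF W]) (use ln_mult_at_top[OF mu] in simp_all)
  moreover have "\<forall>\<^sub>F x in at_top. y (of_real (ln (mu * x))) / exp (of_real kappa * of_real (ln (mu * x)) - exp (of_real (ln (mu * x))) / 2)
      = y (of_real (ln (mu * x))) / of_real (exp (kappa * ln (mu * x) - mu * x / 2))"
    using eventually_gt_at_top[of 0]
  proof eventually_elim
    case (elim x)
    have "exp (complex_of_real (ln (mu * x))) = of_real (mu * x)" using mu elim by (simp only: exp_of_real exp_ln mult_pos_pos)
    then show ?case by (simp add: exp_of_real[symmetric])
  qed
  ultimately show ?thesis by (rule Lim_transform_eventually)
qed

text \<open>At ln(\<mu> x) - pi i the exponential of t is -\<mu> x, so the recessive expansion of W
  continues to a growing one, and the power contributes exp(\<kappa> pi i).\<close>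

lemma whittaker_W_rotated:
  assumes W: "is_whittaker_W (- kappa) mu y" and mu: "0 < mu"
  shows "((\<lambda>x. y (of_real (ln (mu * x)) - of_real pi * \<i>) / of_real (exp (- 1 * (kappa * ln (mu * x) - mu * x / 2))))
    \<longlongrightarrow> exp (of_real (kappa * pi) * \<i>)) at_top"
proof -
  let ?t = "\<lambda>x. complex_of_real (ln (mu * x)) - of_real pi * \<i>"
  have "((\<lambda>x. y (?t x) / exp (of_real (- kappa) * ?t x - exp (?t x) / 2)) \<longlongrightarrow> 1) at_top"
    by (rule whittaker_W_along[OF W]) (use ln_mult_at_top[OF mu] in simp_all)
  then have "((\<lambda>x. y (?t x) / exp (of_real (- kappa) * ?t x - exp (?t x) / 2) * exp (of_real (kappa * pi) * \<i>)) \<longlongrightarrow> 1 * exp (of_real (kappa * pi) * \<i>)) at_top"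
    by (intro tendsto_mult tendsto_const)
  moreover have "\<forall>\<^sub>F x in at_top. y (?t x) / exp (of_real (- kappa) * ?t x - exp (?t x) / 2) * exp (of_real (kappa * pi) * \<i>)
      = y (?t x) / of_real (exp (- 1 * (kappa * ln (mu * x) - mu * x / 2)))"
    using eventually_gt_at_top[of 0]
  proof eventually_elim
    case (elim x)
    have "exp (complex_of_real (ln (mu * x))) = of_real (mu * x)" using mu elim by (simp only: exp_of_real exp_ln mult_pos_pos)
    moreover have "exp (of_real pi * \<i>) = - 1" using exp_pi_i by (simp add: mult.commute)
    ultimately have "exp (?t x) = - of_real (mu * x)" by (simp only: exp_diff) simp
    then have "exp (of_real (- kappa) * ?t x - exp (?t x) / 2)
        = exp (complex_of_real (- 1 * (kappa * ln (mu * x) - mu * x / 2)) + of_real (kappa * pi) * \<i>)"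
      by (intro arg_cong[where f = exp]) (simp add: algebra_simps)
    then have "exp (of_real (- kappa) * ?t x - exp (?t x) / 2)
        = of_real (exp (- 1 * (kappa * ln (mu * x) - mu * x / 2))) * exp (of_real (kappa * pi) * \<i>)"
      by (simp only: exp_add exp_of_real)
    then show ?case by simp
  qed
  ultimately show ?thesis using Lim_transform_eventually by fastforce
qed

text \<open>W decays exponentially along the positive axis, so 1 / W^2 is unbounded and the
  proportionality criterion applies with velocity 1.\<close>

lemma recessive_right:
  assumes rec: "recessive at_right_end mu lam w" and W: "is_whittaker_W (lam * mu) mu y" and mu: "0 < mu"
  obtains k where "\<And>z. z \<in> Cplus \<Longrightarrow> y (Ln (of_real mu * z)) = k * w z"
proof -
  define u where "u = (\<lambda>z. y (surface_log mu z + 0))"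
  have u: "LG_solution mu lam u"
    unfolding u_def by (rule whittaker_LG[where \<epsilon> = 1]) (use W mu in \<open>auto simp: is_whittaker_W_def\<close>)
  have "\<forall>\<^sub>F s in at_top. y (of_real (ln (mu * s))) \<noteq> 0 \<and> 1 \<le> Re (of_real 1 * 1 ^ 2 * (of_real 1 / y (of_real (ln (mu * s))) ^ 2))"
  proof (rule recessive_growth[OF whittaker_W_real[OF W mu]])
    show "LIM s at_top. 1 * 1 / (exp (lam * mu * ln (mu * s) - mu * s / 2))\<^sup>2 :> at_top" using mu by real_asymp
  qed auto
  then obtain N where N: "\<And>s. N \<le> s \<Longrightarrow> y (of_real (ln (mu * s))) \<noteq> 0 \<and> 1 \<le> Re (1 * (1 / y (of_real (ln (mu * s))) ^ 2))"
    unfolding eventually_at_top_linorder by auto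
  define s0 where "s0 = max N 1"
  have us: "u (of_real s) = y (of_real (ln (mu * s)))" if "s0 \<le> s" for s
    using surface_log_of_real(1)[OF mu, of s] that by (simp add: u_def s0_def)
  obtain k where "\<And>z. z \<in> Cplus \<Longrightarrow> u z = k * w z"
  proof (rule recessive_proportional[OF rec u, of complex_of_real s0 "\<lambda>_. 1" 1])
    show "filterlim complex_of_real at_right_end at_top" by (simp add: at_right_end_def filterlim_def)
    show "u (of_real s) \<noteq> 0" "1 \<le> Re (1 * (1 / u (of_real s) ^ 2))" if "s0 \<le> s" for s
      using N[of s] that unfolding us[OF that] by (auto simp: s0_def)
  qed (auto intro!: derivative_eq_intros inj_onI simp: s0_def)
  then show ?thesis using that[of k] surface_log_eq[OF mu] by (simp add: u_def)
qed

text \<open>At z = -s the surface logarithm is ln(\<mu> s) + pi i. The shift by -pi i returns to the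
  real line, where W with index -\<kappa> decays; the curve now has velocity -1, hence b =
  -1.\<close>

lemma recessive_left:
  assumes rec: "recessive at_left_end mu lam w" and W: "is_whittaker_W (- (lam * mu)) mu y" and mu: "0 < mu"
  obtains k where "\<And>z. z \<in> Cplus \<Longrightarrow> y (Ln (of_real mu * z) - of_real pi * \<i>) = k * w z"
proof -
  define u where "u = (\<lambda>z. y (surface_log mu z + - (of_real pi * \<i>)))"
  have "exp (- (of_real pi * \<i>)) = - 1" using exp_pi_i by (simp add: exp_minus mult.commute)
  then have u: "LG_solution mu lam u"
    unfolding u_def by (intro whittaker_LG[where \<epsilon> = "- 1"]) (use W mu in \<open>auto simp: is_whittaker_W_def\<close>)
  have "\<forall>\<^sub>F s in at_top. y (of_real (ln (mu * s))) \<noteq> 0 \<and> 1 \<le> Re (of_real (- 1) * 1 ^ 2 * (of_real (- 1) / y (of_real (ln (mu * s))) ^ 2))"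
  proof (rule recessive_growth[OF whittaker_W_real[OF W mu]])
    show "LIM s at_top. - 1 * - 1 / (exp (- (lam * mu) * ln (mu * s) - mu * s / 2))\<^sup>2 :> at_top" using mu by real_asymp
  qed auto
  then obtain N where N: "\<And>s. N \<le> s \<Longrightarrow> y (of_real (ln (mu * s))) \<noteq> 0 \<and> 1 \<le> Re (- 1 * (- 1 / y (of_real (ln (mu * s))) ^ 2))"
    unfolding eventually_at_top_linorder by auto
  define s0 where "s0 = max N 1"
  have us: "u (- of_real s) = y (of_real (ln (mu * s)))" if "s0 \<le> s" for s
    using surface_log_of_real(2)[OF mu, of s] that by (simp add: u_def s0_def)
  obtain k where "\<And>z. z \<in> Cplus \<Longrightarrow> u z = k * w z"
  proof (rule recessive_proportional[OF rec u, of "\<lambda>s. - complex_of_real s" s0 "\<lambda>_. - 1" "- 1"])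
    show "filterlim (\<lambda>s. - complex_of_real s) at_left_end at_top" by (simp add: at_left_end_def filterlim_def)
    show "u (- of_real s) \<noteq> 0" "1 \<le> Re (- 1 * (- 1 / u (- of_real s) ^ 2))" if "s0 \<le> s" for s
      using N[of s] that unfolding us[OF that] by (auto simp: s0_def)
    show "((\<lambda>s. - complex_of_real s) has_vector_derivative - 1) (at s)" for s
      by (auto intro!: derivative_eq_intros)
  qed (auto intro!: inj_onI simp: s0_def Cplus_iff)
  then show ?thesis using that[of k] surface_log_eq[OF mu] by (simp add: u_def)
qed

text \<open>M is characterized only by its behaviour at 0, whereas its constant is to be read off at
  infinity. It must therefore be identified with the explicit Kummer form: the difference of the
  two, divided by the latter, tends to 0 at the origin, which a recessive denominator permits only
  for the zero solution.\<close>

lemma whittaker_M_unique_recessive: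
  assumes rec: "recessive at_zero_end mu lam w" and M: "is_whittaker_M (lam * mu) mu y" and mu: "0 < mu"
    and lam: "0 \<le> lam" "lam < 1"
  obtains k where "\<And>z. z \<in> Cplus \<Longrightarrow> y (Ln (of_real mu * z)) = k * w z"
    and "\<And>z. z \<in> Cplus \<Longrightarrow> y (Ln (of_real mu * z)) = whittaker_M_fun (lam * mu) mu (Ln (of_real mu * z))"
proof -
  have "lam * mu \<le> 1 * mu" using lam mu by (intro mult_right_mono) auto
  then have lm: "0 \<le> lam * mu" "lam * mu < mu + 1/2" using lam mu by (simp, linarith)
  define u where "u = (\<lambda>z. y (surface_log mu z + 0))"
  define f where "f = (\<lambda>z. whittaker_M_fun (lam * mu) mu (surface_log mu z + 0))"
  have u: "LG_solution mu lam u"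
    unfolding u_def by (rule whittaker_LG[where \<epsilon> = 1]) (use M mu in \<open>auto simp: is_whittaker_M_def\<close>)
  have f: "LG_solution mu lam f"
    unfolding f_def by (rule whittaker_LG[where \<epsilon> = 1]) (use whittaker_M_fun_solution[OF lm mu] mu in auto)
  define \<gamma> where "\<gamma> = (\<lambda>s. complex_of_real (exp (- s)))"
  have slog: "surface_log mu (\<gamma> s) = of_real (ln mu - s)" for s
    using surface_log_of_real(1)[OF mu, of "exp (- s)"] mu by (simp add: \<gamma>_def ln_mult)
  define \<rho> where "\<rho> = (\<lambda>s. exp ((mu + 1/2) * (ln mu - s)))"
  have \<rho>: "exp ((of_real mu + 1/2) * complex_of_real (ln mu - s)) = of_real (\<rho> s)" for s
    by (simp add: \<rho>_def exp_of_real[symmetric])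
  have bot: "LIM s at_top. ln mu - s :> at_bot" by real_asymp
  have "((\<lambda>t. y t / exp ((of_real mu + 1/2) * t)) \<longlongrightarrow> 1) (filtercomap Re at_bot)"
    using M unfolding is_whittaker_M_def by blast
  moreover have "filterlim (\<lambda>s. complex_of_real (ln mu - s)) (filtercomap Re at_bot) at_top"
    unfolding filterlim_filtercomap_iff using bot by (simp add: o_def)
  ultimately have "((\<lambda>s. y (of_real (ln mu - s)) / exp ((of_real mu + 1/2) * of_real (ln mu - s))) \<longlongrightarrow> 1) at_top"
    by (rule filterlim_compose)
  then have ul: "((\<lambda>s. u (\<gamma> s) / of_real (\<rho> s)) \<longlongrightarrow> 1) at_top" unfolding u_def slog \<rho> by simp
  have "((\<lambda>s. whittaker_M_fun (lam * mu) mu (of_real (ln mu - s)) / exp ((of_real mu + 1/2) * of_real (ln mu - s))) \<longlongrightarrow> 1) at_top"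
    by (rule whittaker_M_fun_at_bot[OF lm mu]) (simp add: bot)
  then have fl: "((\<lambda>s. f (\<gamma> s) / of_real (\<rho> s)) \<longlongrightarrow> 1) at_top" unfolding f_def slog \<rho> by simp
  have \<rho>0: "0 < \<rho> s" for s by (simp add: \<rho>_def)
  \<comment> \<open>Along exp(-s) the velocity is -exp(-s) and \<rho>^2 decays like exp(-(2 \<mu> +
    1) s), so the quotient grows like exp(2 \<mu> s).\<close>
  have gr: "LIM s at_top. - 1 * - exp (- s) / (\<rho> s)\<^sup>2 :> at_top"
    unfolding \<rho>_def using mu by real_asymp
  have ev1: "\<forall>\<^sub>F s in at_top. f (\<gamma> s) \<noteq> 0 \<and> 1 \<le> Re (of_real (- 1) * 1 ^ 2 * (of_real (- exp (- s)) / f (\<gamma> s) ^ 2))"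
    by (rule recessive_growth[OF fl _ \<rho>0 gr]) simp
  have ev2: "\<forall>\<^sub>F s in at_top. u (\<gamma> s) \<noteq> 0 \<and> 1 \<le> Re (of_real (- 1) * 1 ^ 2 * (of_real (- exp (- s)) / u (\<gamma> s) ^ 2))"
    by (rule recessive_growth[OF ul _ \<rho>0 gr]) simp
  obtain s0 where s0: "\<And>s. s0 \<le> s \<Longrightarrow> (f (\<gamma> s) \<noteq> 0 \<and> 1 \<le> Re (of_real (- 1) * 1 ^ 2 * (of_real (- exp (- s)) / f (\<gamma> s) ^ 2)))
      \<and> (u (\<gamma> s) \<noteq> 0 \<and> 1 \<le> Re (of_real (- 1) * 1 ^ 2 * (of_real (- exp (- s)) / u (\<gamma> s) ^ 2)))"
    using eventually_conj[OF ev1 ev2] unfolding eventually_at_top_linorder by blast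
  have one: "complex_of_real (- 1) * 1 ^ 2 = - 1" by simp
  note N = s0[unfolded one]
  have \<gamma>': "(\<gamma> has_vector_derivative of_real (- exp (- s))) (at s)" for s
    unfolding \<gamma>_def by (intro has_vector_derivative_of_real) (auto intro!: derivative_eq_intros simp: has_real_derivative_iff_has_vector_derivative[symmetric])
  have inj: "inj_on \<gamma> {s0..}" by (auto simp: \<gamma>_def inj_on_def)
  have im: "\<gamma> s \<in> Cplus" for s by (simp add: \<gamma>_def)
  have fil: "filterlim \<gamma> at_zero_end at_top"
  proof -
    have "((\<lambda>s::real. exp (- s)) \<longlongrightarrow> 0) at_top" by real_asymp
    then have "(\<gamma> \<longlongrightarrow> of_real 0) at_top" unfolding \<gamma>_def by (rule tendsto_of_real)
    then show ?thesis unfolding at_zero_end_def filterlim_at using im by (auto simp: \<gamma>_def)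
  qed
  obtain k where k: "\<And>z. z \<in> Cplus \<Longrightarrow> u z = k * w z"
    by (rule recessive_proportional[OF rec u fil \<gamma>' inj im, where b = "- 1"]) (use N in auto)
  have "((\<lambda>s. (u (\<gamma> s) / of_real (\<rho> s)) / (f (\<gamma> s) / of_real (\<rho> s)) - 1) \<longlongrightarrow> 1 / 1 - 1) at_top"
    by (intro tendsto_intros ul fl) simp
  moreover have "\<forall>\<^sub>F s in at_top. (u (\<gamma> s) / of_real (\<rho> s)) / (f (\<gamma> s) / of_real (\<rho> s)) - 1 = (u (\<gamma> s) - f (\<gamma> s)) / f (\<gamma> s)"
    using eventually_ge_at_top[of s0]
  proof eventually_elim
    case (elim s)
    have "\<rho> s \<noteq> 0" using \<rho>0[of s] by simp
    then show ?case using N[OF elim] by (simp add: diff_divide_distrib)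
  qed
  ultimately have lim: "((\<lambda>s. (u (\<gamma> s) - f (\<gamma> s)) / f (\<gamma> s)) \<longlongrightarrow> 1 / 1 - 1) at_top" by (rule Lim_transform_eventually)
  have "u z - f z = 0" if "z \<in> Cplus" for z
    by (rule LG_ratio_zero[OF LG_solution_diff[OF u f] f \<gamma>' inj im, where b = "- 1" and z = z]) (use N lim that in auto)
  then show ?thesis using that[of k] k surface_log_eq[OF mu] by (simp add: u_def f_def)
qed

text \<open>\<open>T\<close> is \<open>S\<close> for \<open>delta_p\<close> and \<open>- S\<close>
  for \<open>delta_m\<close>, so that one formula serves both signs.\<close>

definition airy_delta :: "complex \<Rightarrow> complex \<Rightarrow> real \<Rightarrow> complex" where
  "airy_delta t e T = exp (- of_real T) * (t * cosh (of_real T) + e * sinh (of_real T))"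

text \<open>With q = exp(-2 T) the quantity is t (1 + q)/2 + e (1 - q)/2, of modulus at most max 1 q
  times the larger error. For q > 1 the stated bound thus requires q \<le> 1 + 1/q, which fails once
  q passes the golden ratio. Smallness of T gives 5/4 \<le> 1 + 4/5.\<close>

lemma airy_delta_bound:
  assumes "\<bar>T\<bar> \<le> 1/10"
  shows "cmod (airy_delta t e T) \<le> max (cmod t) (cmod e) * (1 + exp (2 * T))"
    and "exp (2 * T) \<le> 5/4"
proof -
  define q where "q = exp (- 2 * T)"
  define m where "m = max (cmod t) (cmod e)"
  have q: "0 < q" by (simp add: q_def)
  have lo: "4/5 \<le> exp (- u)" if "\<bar>u\<bar> \<le> 1/5" for u :: real using exp_ge_add_one_self[of "- u"] that by linarith
  have inv: "exp u = inverse (exp (- u))" for u :: real by (simp add: exp_minus)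
  have up: "exp u \<le> 5/4" if "\<bar>u\<bar> \<le> 1/5" for u :: real
    using lo[OF that] unfolding inv[of u] by (simp add: field_simps)
  show "exp (2 * T) \<le> 5/4" using assms by (intro up) simp
  have q1: "q \<le> 5/4" unfolding q_def using assms by (intro up) simp
  have q2: "4/5 \<le> exp (2 * T)" using lo[of "- (2 * T)"] assms by simp
  have e2: "exp (- complex_of_real T) * exp (- complex_of_real T) = of_real q" "exp (- complex_of_real T) * exp (complex_of_real T) = 1"
    by (simp_all add: mult_exp_exp q_def exp_of_real[symmetric])
  have "airy_delta t e T = t * ((exp (- complex_of_real T) * exp (of_real T) + exp (- complex_of_real T) * exp (- of_real T)) / 2)
      + e * ((exp (- complex_of_real T) * exp (of_real T) - exp (- complex_of_real T) * exp (- of_real T)) / 2)"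
    unfolding airy_delta_def cosh_field_def sinh_field_def by (simp add: field_simps)
  also have "\<dots> = t * of_real ((1 + q) / 2) + e * of_real ((1 - q) / 2)" unfolding e2 by simp
  finally have "cmod (airy_delta t e T) \<le> cmod t * ((1 + q) / 2) + cmod e * \<bar>(1 - q) / 2\<bar>"
    using norm_triangle_ineq[of "t * of_real ((1 + q) / 2)" "e * of_real ((1 - q) / 2)"] q
    by (simp only: norm_mult norm_of_real) simp
  also have "\<dots> \<le> m * ((1 + q) / 2) + m * \<bar>(1 - q) / 2\<bar>"
    using q by (intro add_mono mult_right_mono) (auto simp: m_def)
  also have "\<dots> = m * ((1 + q) / 2 + \<bar>(1 - q) / 2\<bar>)" by (simp add: algebra_simps)
  also have "\<dots> \<le> m * (1 + exp (2 * T))"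
  proof (rule mult_left_mono)
    show "(1 + q) / 2 + \<bar>(1 - q) / 2\<bar> \<le> 1 + exp (2 * T)"
    proof (cases "q \<le> 1")
      case True
      then have "\<bar>(1 - q) / 2\<bar> = (1 - q) / 2" by simp
      then show ?thesis using q q2 by (simp add: field_simps)
    next
      case False
      then have "\<bar>(1 - q) / 2\<bar> = (q - 1) / 2" by simp
      then show ?thesis using q1 q2 by (simp add: field_simps)
    qed
  qed (simp add: m_def le_max_iff_disj)
  finally show "cmod (airy_delta t e T) \<le> max (cmod t) (cmod e) * (1 + exp (2 * T))" by (simp add: m_def)
qed

text \<open>Since cosh S - \<epsilon> sinh S = exp(-\<epsilon> S) for \<epsilon> = 1 or -1,
  multiplying by exp(\<epsilon> S) turns the bracket into 1 + \<delta>, which can be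
  inverted.\<close>

lemma connection_solve:
  fixes S \<epsilon> \<theta> mu :: real
  assumes eq: "k * (of_real (mu powr (-1/6)) * (cis (- \<theta>) * of_real (1 / (2 * sqrt pi))) *
      (cosh (of_real S) * (1 + t) - of_real \<epsilon> * sinh (of_real S) * (1 + e))) = r * G"
    and \<epsilon>: "\<epsilon> = 1 \<or> \<epsilon> = - 1" and mu: "0 < mu" and nz: "1 + airy_delta t e (- (\<epsilon> * S)) \<noteq> 0"
  shows "k = of_real (2 * sqrt pi * mu powr (1/6) * exp (\<epsilon> * S)) * cis \<theta> * G * r * inverse (1 + airy_delta t e (- (\<epsilon> * S)))"
proof -
  define d where "d = airy_delta t e (- (\<epsilon> * S))"
  have ex: "exp (complex_of_real (\<epsilon> * S)) * (cosh (of_real S) - of_real \<epsilon> * sinh (of_real S)) = 1"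
    using \<epsilon> cosh_minus_sinh[of "complex_of_real S"] cosh_plus_sinh[of "complex_of_real S"]
    by (auto simp: mult_exp_exp)
  have dd: "d = exp (complex_of_real (\<epsilon> * S)) * (t * cosh (of_real S) - of_real \<epsilon> * e * sinh (of_real S))"
    unfolding d_def airy_delta_def using \<epsilon> by auto
  have "exp (complex_of_real (\<epsilon> * S)) * (cosh (of_real S) * (1 + t) - of_real \<epsilon> * sinh (of_real S) * (1 + e))
      = exp (complex_of_real (\<epsilon> * S)) * (cosh (of_real S) - of_real \<epsilon> * sinh (of_real S))
        + exp (complex_of_real (\<epsilon> * S)) * (t * cosh (of_real S) - of_real \<epsilon> * e * sinh (of_real S))"
    by (simp add: algebra_simps)
  then have C: "exp (complex_of_real (\<epsilon> * S)) * (cosh (of_real S) * (1 + t) - of_real \<epsilon> * sinh (of_real S) * (1 + e)) = 1 + d"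
    unfolding ex dd .
  define D where "D = cosh (of_real S) * (1 + t) - of_real \<epsilon> * sinh (of_real S) * (1 + e)"
  define p where "p = complex_of_real (mu powr (-1/6))"
  define p' where "p' = complex_of_real (mu powr (1/6))"
  define h where "h = complex_of_real (1 / (2 * sqrt pi))"
  define h' where "h' = complex_of_real (2 * sqrt pi)"
  define E where "E = exp (complex_of_real (\<epsilon> * S))"
  have pp: "p' * p = 1" unfolding p_def p'_def of_real_mult[symmetric] powr_add[symmetric] using mu by simp
  have hh: "h' * h = 1" unfolding h_def h'_def of_real_mult[symmetric] by simp
  have cc: "cis \<theta> * cis (- \<theta>) = 1" by (simp add: cis_mult)
  have "h' * p' * E * cis \<theta> * (k * (p * (cis (- \<theta>) * h) * D)) = k * ((p' * p) * (h' * h) * (cis \<theta> * cis (- \<theta>)) * (E * D))"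
    by (simp only: mult_ac)
  also have "\<dots> = k * (1 + d)" unfolding pp hh cc using C by (simp add: E_def D_def)
  finally have "k * (1 + d) = h' * p' * E * cis \<theta> * (r * G)"
    unfolding eq[folded p_def h_def D_def] by (rule sym)
  then have "k = h' * p' * E * cis \<theta> * (r * G) * inverse (1 + d)"
    using nz unfolding d_def[symmetric] by (simp add: field_simps)
  then show ?thesis unfolding d_def[symmetric] h'_def p'_def E_def exp_of_real by (simp add: mult_ac)
qed

lemma exp_polar_of_real: "exp (of_real a * \<i> + of_real b) = of_real (exp b) * cis a"
  by (simp add: exp_add exp_of_real cis_conv_exp mult.commute)

text \<open>Everything rests on ln(1 - \<lambda>^2) = ln(1 + \<lambda>) + ln(1 - \<lambda>), which
  for instance turns -\<mu> ln(1 - \<lambda>) + (\<mu>/2) ln(1 - \<lambda>^2) into (\<mu>/2) ln((1 +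
  \<lambda>)/(1 - \<lambda>)).\<close>

lemma constants_W:
  fixes lam mu kappa :: real
  assumes lam: "0 \<le> lam" "lam < 1" and mu: "0 < mu"
  shows "mu powr (1/6) * exp (kappa * ln mu - kappa - mu * ln (1 - lam) + (mu + kappa) / 2 * ln (1 - lam ^ 2))
    = mu powr (kappa + 1/6) * (1 - lam\<^sup>2) powr (kappa / 2) * ((1 + lam) / (1 - lam)) powr (mu / 2) * exp (- kappa)"
    and "mu powr (1/6) * exp (- (kappa * ln mu - kappa - mu * ln (1 - lam) + (mu + kappa) / 2 * ln (1 - lam ^ 2)))
    = (1 - lam) powr mu / (mu powr (kappa - 1/6) * (1 - lam\<^sup>2) powr ((mu + kappa) / 2)) * exp kappa"
proof -
  have f: "1 - lam ^ 2 = (1 + lam) * (1 - lam)" by (simp add: power2_eq_square algebra_simps)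
  have l: "ln (1 - lam ^ 2) = ln (1 + lam) + ln (1 - lam)" unfolding f using lam by (simp add: ln_mult)
  have q: "ln ((1 + lam) / (1 - lam)) = ln (1 + lam) - ln (1 - lam)" using lam by (simp add: ln_div)
  have nz: "mu \<noteq> 0" "1 - lam ^ 2 \<noteq> 0" "(1 + lam) / (1 - lam) \<noteq> 0" "1 - lam \<noteq> 0" unfolding f using lam mu by auto
  show "mu powr (1/6) * exp (kappa * ln mu - kappa - mu * ln (1 - lam) + (mu + kappa) / 2 * ln (1 - lam ^ 2))
    = mu powr (kappa + 1/6) * (1 - lam\<^sup>2) powr (kappa / 2) * ((1 + lam) / (1 - lam)) powr (mu / 2) * exp (- kappa)"
    unfolding powr_def using nz by (simp only: if_False mult_exp_exp l q) (simp add: field_simps)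
  have e: "exp u = exp v / (exp w * exp x) * exp y" if "u = v - (w + x) + y" for u v w x y :: real
    unfolding that by (simp only: mult_exp_exp exp_diff[symmetric])
  show "mu powr (1/6) * exp (- (kappa * ln mu - kappa - mu * ln (1 - lam) + (mu + kappa) / 2 * ln (1 - lam ^ 2)))
    = (1 - lam) powr mu / (mu powr (kappa - 1/6) * (1 - lam\<^sup>2) powr ((mu + kappa) / 2)) * exp kappa"
    unfolding powr_def using nz
    by (simp only: if_False mult_exp_exp[of "1/6 * ln mu"] l) (rule e, simp add: field_simps)
qed

text \<open>With h = (\<mu> - \<kappa>) pi / 2 the three phases are h + pi/6 for M, -h for W, and h
  - pi/6 + \<kappa> pi for the rotated W: the terms in pi/6 come from the rotation of the Airy
  function, \<kappa> pi from continuing the expansion of W.\<close>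

lemma whittaker_connection:
  fixes lam mu :: real and m :: nat and V :: branches and A B et e :: "complex \<Rightarrow> complex" and M W W' :: "complex \<Rightarrow> complex"
  assumes tp: "turning_point_branches lam V" and lam: "0 \<le> lam" "lam < 1" and mu: "0 < mu" and large: "1/2 \<le> mu - lam * mu"
    and rec: "recessive at_zero_end mu lam (w_airy mu V A B (-1))" "recessive at_right_end mu lam (w_airy mu V A B 0)"
      "recessive at_left_end mu lam (w_airy mu V A B 1)"
    and A: "\<forall>\<^sub>F x in at_top. A (of_real x) = A_approx m mu lam V (of_real x) * (1 + et (of_real x))"
    and B: "\<forall>\<^sub>F x in at_top. B (of_real x) = B_approx m mu lam V (of_real x) * (1 + e (of_real x))"
    and et: "((\<lambda>x::real. et (of_real x)) \<longlongrightarrow> ti) at_top" and e: "((\<lambda>x::real. e (of_real x)) \<longlongrightarrow> ei) at_top"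
    and M: "is_whittaker_M (lam * mu) mu M" and W: "is_whittaker_W (lam * mu) mu W" and W': "is_whittaker_W (- (lam * mu)) mu W'"
    and nz: "1 + airy_delta ti ei (odd_sum_inf m mu lam V) \<noteq> 0" "1 + airy_delta ti ei (- odd_sum_inf m mu lam V) \<noteq> 0"
    and z: "z \<in> Cplus"
  defines "kappa \<equiv> lam * mu" and "S \<equiv> odd_sum_inf m mu lam V"
  shows "M (Ln (of_real mu * z)) =
      of_real (2 * sqrt pi * (1 - lam) powr mu * Gamma (2 * mu + 1)
        / (mu powr (kappa - 1/6) * (1 - lam\<^sup>2) powr ((mu + kappa) / 2) * Gamma (mu - kappa + 1/2)))
      * exp (of_real ((mu - kappa + 1/3) / 2 * pi) * \<i> + of_real (kappa - S))
      * inverse (1 + airy_delta ti ei S) * w_airy mu V A B (-1) z"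
    and "W (Ln (of_real mu * z)) =
      of_real (2 * sqrt pi * mu powr (kappa + 1/6) * (1 - lam\<^sup>2) powr (kappa / 2) * ((1 + lam) / (1 - lam)) powr (mu / 2))
      * exp (of_real ((kappa - mu) / 2 * pi) * \<i> + of_real (- kappa + S))
      * inverse (1 + airy_delta ti ei (- S)) * w_airy mu V A B 0 z"
    and "W' (Ln (of_real mu * z) - of_real pi * \<i>) =
      of_real (2 * sqrt pi * (1 - lam) powr mu / (mu powr (kappa - 1/6) * (1 - lam\<^sup>2) powr ((mu + kappa) / 2)))
      * exp (of_real ((mu + kappa - 1/3) / 2 * pi) * \<i> + of_real (kappa - S))
      * inverse (1 + airy_delta ti ei S) * w_airy mu V A B 1 z"
proof -
  define g where "g = kappa * ln mu - kappa - mu * ln (1 - lam) + (mu + kappa) / 2 * ln (1 - lam ^ 2)"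
  define h where "h = (mu - kappa) * pi / 2"
  have Lnx: "Ln (of_real mu * of_real x) = complex_of_real (ln (mu * x))" if "0 < x" for x
    using Ln_of_real[of "mu * x"] mu that by simp
  have cp: "complex_of_real x \<in> Cplus" if "0 < x" for x using that by simp
  have Gpm: "((\<lambda>x. of_real (exp (\<epsilon> * (kappa * ln (mu * x) - mu * x / 2))) * exp (of_real (\<epsilon> * mu) * xi V (of_real x))) \<longlongrightarrow>
      of_real (exp (\<epsilon> * g)) * cis (- (\<epsilon> * h))) at_top" for \<epsilon>
  proof -
    have eq: "exp (of_real \<epsilon> * (of_real g - of_real h * \<i>)) = of_real (exp (\<epsilon> * g)) * cis (- (\<epsilon> * h))"
      unfolding exp_polar_of_real[symmetric] by (intro arg_cong[where f = exp]) (simp add: algebra_simps)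
    show ?thesis
      using exponential_factor_at_top[OF tp lam mu, of \<epsilon>] unfolding kappa_def[symmetric] g_def[symmetric] h_def[symmetric] eq .
  qed
  have kap: "0 \<le> kappa" "1/2 \<le> mu - kappa" using lam mu large by (simp_all add: kappa_def)
  show "W (Ln (of_real mu * z)) =
      of_real (2 * sqrt pi * mu powr (kappa + 1/6) * (1 - lam\<^sup>2) powr (kappa / 2) * ((1 + lam) / (1 - lam)) powr (mu / 2))
      * exp (of_real ((kappa - mu) / 2 * pi) * \<i> + of_real (- kappa + S))
      * inverse (1 + airy_delta ti ei (- S)) * w_airy mu V A B 0 z"
  proof -
    obtain k where k: "\<And>z. z \<in> Cplus \<Longrightarrow> W (Ln (of_real mu * z)) = k * w_airy mu V A B 0 z"
      using recessive_right[OF rec(2) W mu] by blast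
    have wl: "((\<lambda>x. w_airy mu V A B 0 (of_real x) * exp (of_real (1 * mu) * xi V (of_real x))) \<longlongrightarrow>
      of_real (mu powr (-1/6)) * (cis (- 0) * of_real (1 / (2 * sqrt pi))) *
      (cosh (of_real S) * (1 + ti) - of_real 1 * sinh (of_real S) * (1 + ei))) at_top"
      using w_airy_at_top[OF tp lam mu _ A B et e, of 0] by (simp add: S_def)
    have "k * (of_real (mu powr (-1/6)) * (cis (- 0) * of_real (1 / (2 * sqrt pi))) *
      (cosh (of_real S) * (1 + ti) - of_real 1 * sinh (of_real S) * (1 + ei))) = 1 * (of_real (exp (1 * g)) * cis (- (1 * h)))"
    proof (rule connection_constant[OF _ _ wl Gpm])
      show "\<forall>\<^sub>F x in at_top. W (of_real (ln (mu * x))) = k * w_airy mu V A B 0 (of_real x)"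
        using eventually_gt_at_top[of 0] by eventually_elim (metis k cp Lnx)
      show "((\<lambda>x. W (of_real (ln (mu * x))) / of_real (exp (1 * (kappa * ln (mu * x) - mu * x / 2)))) \<longlongrightarrow> 1) at_top"
        using whittaker_W_real[OF W mu] by (simp only: kappa_def mult_1)
    qed simp
    from connection_solve[OF this _ mu] nz(2)
    have "k = of_real (2 * sqrt pi * mu powr (1/6) * exp (1 * S)) * cis 0 * (of_real (exp (1 * g)) * cis (- (1 * h))) * 1 * inverse (1 + airy_delta ti ei (- S))"
      unfolding S_def by simp
    also have "\<dots> = of_real (2 * sqrt pi * (mu powr (1/6) * exp g) * exp S) * cis (- h) * inverse (1 + airy_delta ti ei (- S))"
      by (simp add: mult_ac)
    also have "\<dots> = of_real (2 * sqrt pi * (mu powr (kappa + 1/6) * (1 - lam\<^sup>2) powr (kappa / 2) * ((1 + lam) / (1 - lam)) powr (mu / 2) * exp (- kappa)) * exp S)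
        * cis (- h) * inverse (1 + airy_delta ti ei (- S))"
      unfolding g_def constants_W(1)[OF lam mu] ..
    also have "\<dots> = of_real (2 * sqrt pi * mu powr (kappa + 1/6) * (1 - lam\<^sup>2) powr (kappa / 2) * ((1 + lam) / (1 - lam)) powr (mu / 2))
      * exp (of_real ((kappa - mu) / 2 * pi) * \<i> + of_real (- kappa + S)) * inverse (1 + airy_delta ti ei (- S))"
    proof -
      have a: "- h = (kappa - mu) / 2 * pi" by (simp add: h_def field_simps)
      have b: "exp (- kappa + S) = exp (- kappa) * exp S" by (rule exp_add)
      show ?thesis unfolding exp_polar_of_real a b by (simp add: mult_ac)
    qed
    finally show ?thesis using k[OF z] by simp
  qed
  \<comment> \<open>The two solutions growing at +\<infinity> share everything except the Airy phase
    \<theta> and the modulus r and phase \<psi> of the leading Whittaker coefficient.\<close>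
  have G2: "of_real (2 * sqrt pi * mu powr (1/6) * exp (- 1 * S)) * cis \<theta> * (of_real (exp (- 1 * g)) * cis (- (- 1 * h))) * (of_real r * cis \<psi>) * D
      = of_real (2 * sqrt pi * (1 - lam) powr mu * r / (mu powr (kappa - 1/6) * (1 - lam\<^sup>2) powr ((mu + kappa) / 2)))
      * exp (of_real a * \<i> + of_real (kappa - S)) * D" if "\<theta> + h + \<psi> = a" for \<theta> \<psi> a r D
  proof -
    have "of_real (2 * sqrt pi * mu powr (1/6) * exp (- 1 * S)) * cis \<theta> * (of_real (exp (- 1 * g)) * cis (- (- 1 * h))) * (of_real r * cis \<psi>) * D
      = of_real (2 * sqrt pi * r * (mu powr (1/6) * exp (- g)) * exp (- S)) * (cis \<theta> * cis h * cis \<psi>) * D"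
      by (simp add: mult_ac)
    also have "cis \<theta> * cis h * cis \<psi> = cis a" using that by (simp add: cis_mult)
    also have "mu powr (1/6) * exp (- g) = (1 - lam) powr mu / (mu powr (kappa - 1/6) * (1 - lam\<^sup>2) powr ((mu + kappa) / 2)) * exp kappa"
      unfolding g_def by (rule constants_W(2)[OF lam mu])
    also have "2 * sqrt pi * r * ((1 - lam) powr mu / (mu powr (kappa - 1/6) * (1 - lam\<^sup>2) powr ((mu + kappa) / 2)) * exp kappa) * exp (- S)
      = (2 * sqrt pi * (1 - lam) powr mu * r / (mu powr (kappa - 1/6) * (1 - lam\<^sup>2) powr ((mu + kappa) / 2))) * exp (kappa - S)"
      by (simp add: exp_diff exp_minus field_simps)
    finally show ?thesis unfolding exp_polar_of_real by (simp only: of_real_mult mult_ac)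
  qed
  show "M (Ln (of_real mu * z)) =
      of_real (2 * sqrt pi * (1 - lam) powr mu * Gamma (2 * mu + 1)
        / (mu powr (kappa - 1/6) * (1 - lam\<^sup>2) powr ((mu + kappa) / 2) * Gamma (mu - kappa + 1/2)))
      * exp (of_real ((mu - kappa + 1/3) / 2 * pi) * \<i> + of_real (kappa - S))
      * inverse (1 + airy_delta ti ei S) * w_airy mu V A B (-1) z"
  proof -
    define r where "r = Gamma (2 * mu + 1) / Gamma (mu - kappa + 1/2)"
    obtain k where k: "\<And>z. z \<in> Cplus \<Longrightarrow> M (Ln (of_real mu * z)) = k * w_airy mu V A B (-1) z"
      and MM: "\<And>z. z \<in> Cplus \<Longrightarrow> M (Ln (of_real mu * z)) = whittaker_M_fun kappa mu (Ln (of_real mu * z))"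
      using whittaker_M_unique_recessive[OF rec(1) M mu lam] unfolding kappa_def by blast
    have wl: "((\<lambda>x. w_airy mu V A B (-1) (of_real x) * exp (of_real (- 1 * mu) * xi V (of_real x))) \<longlongrightarrow>
      of_real (mu powr (-1/6)) * (cis (- (pi / 6)) * of_real (1 / (2 * sqrt pi))) *
      (cosh (of_real S) * (1 + ti) - of_real (- 1) * sinh (of_real S) * (1 + ei))) at_top"
      using w_airy_at_top[OF tp lam mu _ A B et e, of 1] by (simp add: S_def)
    have "k * (of_real (mu powr (-1/6)) * (cis (- (pi / 6)) * of_real (1 / (2 * sqrt pi))) *
      (cosh (of_real S) * (1 + ti) - of_real (- 1) * sinh (of_real S) * (1 + ei))) = of_real r * (of_real (exp (- 1 * g)) * cis (- (- 1 * h)))"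
    proof (rule connection_constant[OF _ _ wl Gpm])
      show "\<forall>\<^sub>F x in at_top. whittaker_M_fun kappa mu (of_real (ln (mu * x))) = k * w_airy mu V A B (-1) (of_real x)"
        using eventually_gt_at_top[of 0] by eventually_elim (metis k MM cp Lnx)
      have "LIM x at_top. mu * x :> (at_top :: real filter)" using mu by real_asymp
      then have "((\<lambda>x. whittaker_M_fun kappa mu (of_real (ln (mu * x))) / of_real ((mu * x) powr (- kappa) * exp ((mu * x) / 2))) \<longlongrightarrow> of_real r) at_top"
        unfolding r_def by (rule filterlim_compose[OF whittaker_M_fun_at_top[OF kap mu]])
      moreover have "\<forall>\<^sub>F x in at_top. whittaker_M_fun kappa mu (of_real (ln (mu * x))) / of_real ((mu * x) powr (- kappa) * exp ((mu * x) / 2))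
          = whittaker_M_fun kappa mu (of_real (ln (mu * x))) / of_real (exp (- 1 * (kappa * ln (mu * x) - mu * x / 2)))"
        using eventually_gt_at_top[of 0]
      proof eventually_elim
        case (elim x)
        have "(mu * x) powr (- kappa) * exp ((mu * x) / 2) = exp (- 1 * (kappa * ln (mu * x) - mu * x / 2))"
          using mu elim by (simp add: powr_def mult_exp_exp)
        then show ?case by (simp only:)
      qed
      ultimately show "((\<lambda>x. whittaker_M_fun kappa mu (of_real (ln (mu * x))) / of_real (exp (- 1 * (kappa * ln (mu * x) - mu * x / 2)))) \<longlongrightarrow> of_real r) at_top"
        by (rule Lim_transform_eventually)
    qed simp
    from connection_solve[OF this _ mu] nz(1)
    have "k = of_real (2 * sqrt pi * mu powr (1/6) * exp (- 1 * S)) * cis (pi / 6) * (of_real (exp (- 1 * g)) * cis (- (- 1 * h))) * (of_real r * cis 0) * inverse (1 + airy_delta ti ei S)"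
      unfolding S_def by simp
    also have "\<dots> = of_real (2 * sqrt pi * (1 - lam) powr mu * r / (mu powr (kappa - 1/6) * (1 - lam\<^sup>2) powr ((mu + kappa) / 2)))
      * exp (of_real ((mu - kappa + 1/3) / 2 * pi) * \<i> + of_real (kappa - S)) * inverse (1 + airy_delta ti ei S)"
      by (rule G2) (simp add: h_def field_simps)
    finally show ?thesis using k[OF z] by (simp add: r_def)
  qed
  show "W' (Ln (of_real mu * z) - of_real pi * \<i>) =
      of_real (2 * sqrt pi * (1 - lam) powr mu / (mu powr (kappa - 1/6) * (1 - lam\<^sup>2) powr ((mu + kappa) / 2)))
      * exp (of_real ((mu + kappa - 1/3) / 2 * pi) * \<i> + of_real (kappa - S))
      * inverse (1 + airy_delta ti ei S) * w_airy mu V A B 1 z"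
  proof -
    obtain k where k: "\<And>z. z \<in> Cplus \<Longrightarrow> W' (Ln (of_real mu * z) - of_real pi * \<i>) = k * w_airy mu V A B 1 z"
      using recessive_left[OF rec(3) W' mu] by blast
    have wl: "((\<lambda>x. w_airy mu V A B 1 (of_real x) * exp (of_real (- 1 * mu) * xi V (of_real x))) \<longlongrightarrow>
      of_real (mu powr (-1/6)) * (cis (- (- pi / 6)) * of_real (1 / (2 * sqrt pi))) *
      (cosh (of_real S) * (1 + ti) - of_real (- 1) * sinh (of_real S) * (1 + ei))) at_top"
      using w_airy_at_top[OF tp lam mu _ A B et e, of "-1"] by (simp add: S_def)
    have "k * (of_real (mu powr (-1/6)) * (cis (- (- pi / 6)) * of_real (1 / (2 * sqrt pi))) *
      (cosh (of_real S) * (1 + ti) - of_real (- 1) * sinh (of_real S) * (1 + ei))) = exp (of_real (kappa * pi) * \<i>) * (of_real (exp (- 1 * g)) * cis (- (- 1 * h)))"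
    proof (rule connection_constant[OF _ _ wl Gpm])
      show "\<forall>\<^sub>F x in at_top. W' (of_real (ln (mu * x)) - of_real pi * \<i>) = k * w_airy mu V A B 1 (of_real x)"
        using eventually_gt_at_top[of 0] by eventually_elim (metis k cp Lnx)
      show "((\<lambda>x. W' (of_real (ln (mu * x)) - of_real pi * \<i>) / of_real (exp (- 1 * (kappa * ln (mu * x) - mu * x / 2)))) \<longlongrightarrow> exp (of_real (kappa * pi) * \<i>)) at_top"
        using whittaker_W_rotated[OF W' mu] unfolding kappa_def .
    qed simp
    from connection_solve[OF this _ mu] nz(1)
    have "k = of_real (2 * sqrt pi * mu powr (1/6) * exp (- 1 * S)) * cis (- pi / 6) * (of_real (exp (- 1 * g)) * cis (- (- 1 * h))) * exp (of_real (kappa * pi) * \<i>) * inverse (1 + airy_delta ti ei S)"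
      unfolding S_def by simp
    also have "exp (of_real (kappa * pi) * \<i>) = of_real 1 * cis (kappa * pi)"
      using exp_polar_of_real[of "kappa * pi" 0] by simp
    also have "of_real (2 * sqrt pi * mu powr (1/6) * exp (- 1 * S)) * cis (- pi / 6) * (of_real (exp (- 1 * g)) * cis (- (- 1 * h))) * (of_real 1 * cis (kappa * pi)) * inverse (1 + airy_delta ti ei S)
      = of_real (2 * sqrt pi * (1 - lam) powr mu * 1 / (mu powr (kappa - 1/6) * (1 - lam\<^sup>2) powr ((mu + kappa) / 2)))
      * exp (of_real ((mu + kappa - 1/3) / 2 * pi) * \<i> + of_real (kappa - S)) * inverse (1 + airy_delta ti ei S)"
      by (rule G2) (simp add: h_def field_simps)
    finally show ?thesis using k[OF z] by simp
  qed
qed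

section \<open>Uniform smallness and the choice of the threshold\<close>

lemma eventually_at_top_of_Re_to_infinity:
  assumes "\<forall>\<^sub>F z in Re_to_infinity. P z"
  shows "\<forall>\<^sub>F x in at_top. P (complex_of_real x)"
  using of_real_Re_to_infinity assms unfolding filterlim_iff by blast

lemma cmod_limit_le:
  assumes "(f \<longlongrightarrow> l) Re_to_infinity" "\<forall>\<^sub>F z in Re_to_infinity. cmod (f z) \<le> K"
  shows "cmod l \<le> K"
proof (rule tendsto_upperbound)
  show "((\<lambda>x. cmod (f (complex_of_real x))) \<longlongrightarrow> cmod l) at_top"
    by (rule tendsto_norm[OF filterlim_compose[OF assms(1) of_real_Re_to_infinity]])
  show "\<forall>\<^sub>F x in at_top. cmod (f (complex_of_real x)) \<le> K"
    by (rule eventually_at_top_of_Re_to_infinity[OF assms(2)])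
qed simp

text \<open>For \<mu> \<ge> 1 every power in the sum is at least \<mu>. The positive axis supplies
  the infinitely many points of the cut plane that identify \<open>p_hat\<close>.\<close>

lemma odd_sum_inf_bounded:
  assumes "0 < d" "d < 1"
  obtains C where "0 \<le> C" "\<And>lam V mu. \<lbrakk>lam \<in> {0..1-d}; turning_point_branches lam V; 1 \<le> mu\<rbrakk> \<Longrightarrow> \<bar>odd_sum_inf m mu lam V\<bar> \<le> C / mu"
proof -
  have "\<exists>C. \<forall>lam V. lam \<in> {0..1-d} \<and> turning_point_branches lam V \<and> infinite (cut_plane V) \<longrightarrow> \<bar>Ehat_inf lam V k\<bar> \<le> C" for k
    using Ehat_inf_bounded[OF assms, of k] by metis
  then obtain C where C: "\<And>k lam V. \<lbrakk>lam \<in> {0..1-d}; turning_point_branches lam V; infinite (cut_plane V)\<rbrakk> \<Longrightarrow> \<bar>Ehat_inf lam V k\<bar> \<le> C k"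
    by metis
  show ?thesis
  proof (rule that[of "\<Sum>s = 0..m. \<bar>C s\<bar>"])
    show "0 \<le> (\<Sum>s = 0..m. \<bar>C s\<bar>)" by (intro sum_nonneg) simp
  next
    fix lam mu :: real and V :: branches
    assume lam: "lam \<in> {0..1-d}" and tp: "turning_point_branches lam V" and mu: "1 \<le> mu"
    have "complex_of_real ` {0<..} \<subseteq> cut_plane V"
      using positive_real_in_cut_plane[OF tp] lam assms by auto
    moreover have "infinite (complex_of_real ` {0<..})"
      by (subst finite_image_iff) (auto simp: inj_on_def infinite_Ioi)
    ultimately have inf: "infinite (cut_plane V)" using finite_subset by blast
    have "\<bar>odd_sum_inf m mu lam V\<bar> \<le> (\<Sum>s = 0..m. \<bar>Ehat_inf lam V s / mu ^ (2 * s + 1)\<bar>)"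
      unfolding odd_sum_inf_def by (rule sum_abs)
    also have "\<dots> \<le> (\<Sum>s = 0..m. \<bar>C s\<bar> / mu)"
    proof (rule sum_mono)
      fix s
      have "mu ^ 1 \<le> mu ^ (2 * s + 1)" using mu by (intro power_increasing) auto
      moreover have "\<bar>Ehat_inf lam V s\<bar> \<le> \<bar>C s\<bar>" using C[OF lam tp inf, of s] by linarith
      ultimately have "\<bar>Ehat_inf lam V s\<bar> / mu ^ (2 * s + 1) \<le> \<bar>C s\<bar> / mu"
        using mu by (intro frac_le) auto
      then show "\<bar>Ehat_inf lam V s / mu ^ (2 * s + 1)\<bar> \<le> \<bar>C s\<bar> / mu"
        using mu by (simp add: abs_mult power_abs)
    qed
    also have "\<dots> = (\<Sum>s = 0..m. \<bar>C s\<bar>) / mu" by (simp add: sum_divide_distrib)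
    finally show "\<bar>odd_sum_inf m mu lam V\<bar> \<le> (\<Sum>s = 0..m. \<bar>C s\<bar>) / mu" .
  qed
qed

theorem theorem3p1:
  fixes d mu1 :: real and m :: nat
    and M W :: "real \<Rightarrow> real \<Rightarrow> complex \<Rightarrow> complex"
    and V :: "real \<Rightarrow> branches" and Dom :: "real \<Rightarrow> complex set"
    and A B eta_t eta :: "real \<Rightarrow> real \<Rightarrow> complex \<Rightarrow> complex"
    and eta_t_inf eta_inf :: "real \<Rightarrow> real \<Rightarrow> complex"
  assumes "0 < d" and "d < 1" and "1 \<le> m"
    and whittaker_M: "\<And>kappa mu. mu > 0 \<Longrightarrow> is_whittaker_M kappa mu (M kappa mu)"
    and whittaker_W: "\<And>kappa mu. mu > 0 \<Longrightarrow> is_whittaker_W kappa mu (W kappa mu)"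
    and branches: "\<And>lam. lam \<in> {0..1-d} \<Longrightarrow> turning_point_branches lam (V lam)"
    and solutions: "asymptotic_solutions d m mu1 V Dom A B eta_t eta eta_t_inf eta_inf"
  shows "\<exists>mu0\<ge>mu1. \<forall>mu\<ge>mu0. \<forall>lam\<in>{0..1-d}. \<exists>delta_p delta_m :: complex.
    let kappa = lam * mu;
        S = odd_sum_inf m mu lam (V lam);
        w = w_airy mu (V lam) (A mu lam) (B mu lam);
        eta_max = max (cmod (eta_t_inf mu lam)) (cmod (eta_inf mu lam))
    in cmod delta_p < 1 \<and> cmod delta_m < 1 \<and>
       cmod delta_p \<le> eta_max * (1 + exp (2 * S)) \<and>
       cmod delta_m \<le> eta_max * (1 + exp (- 2 * S)) \<and>
       (\<forall>z\<in>Cplus.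
          M kappa mu (Ln (of_real mu * z)) =
            of_real (2 * sqrt pi * (1 - lam) powr mu * Gamma (2 * mu + 1)
              / (mu powr (kappa - 1/6) * (1 - lam\<^sup>2) powr ((mu + kappa) / 2)
                  * Gamma (mu - kappa + 1/2)))
            * exp (of_real ((mu - kappa + 1/3) / 2 * pi) * \<i> + of_real (kappa - S))
            * inverse (1 + delta_p) * w (-1) z \<and>
          W kappa mu (Ln (of_real mu * z)) =
            of_real (2 * sqrt pi * mu powr (kappa + 1/6) * (1 - lam\<^sup>2) powr (kappa / 2)
              * ((1 + lam) / (1 - lam)) powr (mu / 2))
            * exp (of_real ((kappa - mu) / 2 * pi) * \<i> + of_real (- kappa + S))
            * inverse (1 + delta_m) * w 0 z \<and>
          W (- kappa) mu (Ln (of_real mu * z) - of_real pi * \<i>) =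
            of_real (2 * sqrt pi * (1 - lam) powr mu
              / (mu powr (kappa - 1/6) * (1 - lam\<^sup>2) powr ((mu + kappa) / 2)))
            * exp (of_real ((mu + kappa - 1/3) / 2 * pi) * \<i> + of_real (kappa - S))
            * inverse (1 + delta_p) * w 1 z)"
proof -
  note d = \<open>0 < d\<close> \<open>d < 1\<close>
  obtain C where C: "0 \<le> C" "\<And>lam V mu. \<lbrakk>lam \<in> {0..1-d}; turning_point_branches lam V; 1 \<le> mu\<rbrakk> \<Longrightarrow> \<bar>odd_sum_inf m mu lam V\<bar> \<le> C / mu"
    using odd_sum_inf_bounded[OF d, of m] by metis
  note sol = solutions[unfolded asymptotic_solutions_def]
  have Dom: "\<forall>\<^sub>F z in Re_to_infinity. z \<in> Dom lam" if "lam \<in> {0..1-d}" for lam using sol that by simp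
  obtain K mu2 where K: "\<And>mu lam z. \<lbrakk>max mu1 mu2 \<le> mu; lam \<in> {0..1-d}; z \<in> Dom lam\<rbrakk> \<Longrightarrow>
      cmod (eta_t mu lam z) \<le> K / mu ^ (2 * m + 2) \<and> cmod (eta mu lam z) \<le> K / mu ^ (2 * m + 2)"
    using sol by metis
  \<comment> \<open>1/(2 d) yields \<mu> - \<kappa> \<ge> 1/2 for all admissible \<lambda>, 10 C
    yields |S| \<le> 1/10, and 3 |K| bounds both limiting errors by 1/3. Then |\<delta>| is at most
    (1/3) (1 + 5/4) = 3/4.\<close>
  define mu0 where "mu0 = Max {mu1, mu2, 1, 1 / (2 * d), 10 * C, 3 * \<bar>K\<bar>}"
  have mu0: "mu1 \<le> mu0" "mu2 \<le> mu0" "1 \<le> mu0" "1 / (2 * d) \<le> mu0" "10 * C \<le> mu0" "3 * \<bar>K\<bar> \<le> mu0"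
    unfolding mu0_def by (intro Max_ge; simp)+
  show ?thesis
  proof (intro exI[of _ mu0] conjI allI impI ballI)
    show "mu1 \<le> mu0" by (rule mu0)
  next
    fix mu lam :: real assume mu: "mu0 \<le> mu" and lam: "lam \<in> {0..1-d}"
    define S where "S = odd_sum_inf m mu lam (V lam)"
    define ti ei where "ti = eta_t_inf mu lam" and "ei = eta_inf mu lam"
    define N where "N = max (cmod ti) (cmod ei)"
    have mus: "mu1 \<le> mu" "max mu1 mu2 \<le> mu" "1 \<le> mu" "1 / (2 * d) \<le> mu" "10 * C \<le> mu" "3 * \<bar>K\<bar> \<le> mu" "0 < mu"
      using mu0 mu by linarith+
    have tp: "turning_point_branches lam (V lam)" by (rule branches[OF lam])
    have lam': "0 \<le> lam" "lam < 1" using lam d by auto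
    have "1/2 \<le> mu * d" using mus(4) d by (simp add: field_simps)
    also have "\<dots> \<le> mu * (1 - lam)" using lam mus(7) by (intro mult_left_mono) auto
    finally have large: "1/2 \<le> mu - lam * mu" by (simp add: algebra_simps)
    have "C / mu \<le> 1/10" using mus(5,7) by (simp add: field_simps)
    then have S: "\<bar>S\<bar> \<le> 1/10" using C(2)[OF lam tp mus(3)] unfolding S_def by linarith
    have et: "(eta_t mu lam \<longlongrightarrow> ti) Re_to_infinity" and e: "(eta mu lam \<longlongrightarrow> ei) Re_to_infinity"
      using sol mus(1) lam unfolding ti_def ei_def by auto
    have "mu ^ 1 \<le> mu ^ (2 * m + 2)" using mus(3) by (intro power_increasing) auto
    then have "K / mu ^ (2 * m + 2) \<le> \<bar>K\<bar> / mu" using mus(7) by (intro frac_le) auto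
    also have "\<dots> \<le> 1/3" using mus(6,7) by (simp add: field_simps)
    finally have "K / mu ^ (2 * m + 2) \<le> 1/3" .
    then have small: "cmod (eta_t mu lam z) \<le> 1/3 \<and> cmod (eta mu lam z) \<le> 1/3" if "z \<in> Dom lam" for z
      using K[OF mus(2) lam that] by linarith
    \<comment> \<open>The bound on \<open>Dom\<close> passes to the limit at infinity because
      \<open>Dom\<close> contains all points of sufficiently large real part.\<close>
    have "cmod ti \<le> 1/3"
      by (rule cmod_limit_le[OF et]) (use Dom[OF lam] in eventually_elim, blast dest: small)
    moreover have "cmod ei \<le> 1/3"
      by (rule cmod_limit_le[OF e]) (use Dom[OF lam] in eventually_elim, blast dest: small)
    ultimately have N: "N \<le> 1/3" "0 \<le> N" unfolding N_def by (auto simp: le_max_iff_disj)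
    have lt1: "cmod (airy_delta ti ei T) < 1" if "\<bar>T\<bar> \<le> 1/10" for T
    proof -
      have "cmod (airy_delta ti ei T) \<le> N * (1 + exp (2 * T))"
        unfolding N_def by (rule airy_delta_bound(1)[OF that])
      also have "\<dots> \<le> 1/3 * (9/4)" using N airy_delta_bound(2)[OF that] by (intro mult_mono) auto
      finally show ?thesis by simp
    qed
    have nz: "1 + airy_delta ti ei T \<noteq> 0" if "\<bar>T\<bar> \<le> 1/10" for T
      using lt1[OF that] by (metis add.inverse_inverse add_eq_0_iff less_irrefl norm_minus_cancel norm_one)
    have S': "\<bar>- S\<bar> \<le> 1/10" using S by simp
    have AB: "A mu lam z = A_approx m mu lam (V lam) z * (1 + eta_t mu lam z)"
      "B mu lam z = B_approx m mu lam (V lam) z * (1 + eta mu lam z)" if "z \<in> Dom lam" for z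
      using sol mus(1) lam that by blast+
    have Dom': "\<forall>\<^sub>F x in at_top. complex_of_real x \<in> Dom lam" by (rule eventually_at_top_of_Re_to_infinity[OF Dom[OF lam]])
    have rec: "recessive at_zero_end mu lam (w_airy mu (V lam) (A mu lam) (B mu lam) (-1))"
      "recessive at_right_end mu lam (w_airy mu (V lam) (A mu lam) (B mu lam) 0)"
      "recessive at_left_end mu lam (w_airy mu (V lam) (A mu lam) (B mu lam) 1)"
      using sol mus(1) lam by blast+
    have A: "\<forall>\<^sub>F x in at_top. A mu lam (of_real x) = A_approx m mu lam (V lam) (of_real x) * (1 + eta_t mu lam (of_real x))"
      using Dom' by eventually_elim (rule AB(1))
    have B: "\<forall>\<^sub>F x in at_top. B mu lam (of_real x) = B_approx m mu lam (V lam) (of_real x) * (1 + eta mu lam (of_real x))"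
      using Dom' by eventually_elim (rule AB(2))
    note conn = whittaker_connection[OF tp lam' mus(7) large rec A B
        filterlim_compose[OF et of_real_Re_to_infinity] filterlim_compose[OF e of_real_Re_to_infinity]
        whittaker_M[OF mus(7)] whittaker_W[OF mus(7)] whittaker_W[OF mus(7)]
        nz[OF S, unfolded S_def] nz[OF S', unfolded S_def], folded S_def]
    show "\<exists>delta_p delta_m :: complex.
    let kappa = lam * mu;
        S = odd_sum_inf m mu lam (V lam);
        w = w_airy mu (V lam) (A mu lam) (B mu lam);
        eta_max = max (cmod (eta_t_inf mu lam)) (cmod (eta_inf mu lam))
    in cmod delta_p < 1 \<and> cmod delta_m < 1 \<and>
       cmod delta_p \<le> eta_max * (1 + exp (2 * S)) \<and>
       cmod delta_m \<le> eta_max * (1 + exp (- 2 * S)) \<and>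
       (\<forall>z\<in>Cplus.
          M kappa mu (Ln (of_real mu * z)) =
            of_real (2 * sqrt pi * (1 - lam) powr mu * Gamma (2 * mu + 1)
              / (mu powr (kappa - 1/6) * (1 - lam\<^sup>2) powr ((mu + kappa) / 2)
                  * Gamma (mu - kappa + 1/2)))
            * exp (of_real ((mu - kappa + 1/3) / 2 * pi) * \<i> + of_real (kappa - S))
            * inverse (1 + delta_p) * w (-1) z \<and>
          W kappa mu (Ln (of_real mu * z)) =
            of_real (2 * sqrt pi * mu powr (kappa + 1/6) * (1 - lam\<^sup>2) powr (kappa / 2)
              * ((1 + lam) / (1 - lam)) powr (mu / 2))
            * exp (of_real ((kappa - mu) / 2 * pi) * \<i> + of_real (- kappa + S))
            * inverse (1 + delta_m) * w 0 z \<and>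
          W (- kappa) mu (Ln (of_real mu * z) - of_real pi * \<i>) =
            of_real (2 * sqrt pi * (1 - lam) powr mu
              / (mu powr (kappa - 1/6) * (1 - lam\<^sup>2) powr ((mu + kappa) / 2)))
            * exp (of_real ((mu + kappa - 1/3) / 2 * pi) * \<i> + of_real (kappa - S))
            * inverse (1 + delta_p) * w 1 z)"
      unfolding Let_def S_def[symmetric] ti_def[symmetric] ei_def[symmetric]
    proof (rule exI[of _ "airy_delta ti ei S"], rule exI[of _ "airy_delta ti ei (- S)"], intro conjI ballI)
      show "cmod (airy_delta ti ei (- S)) \<le> max (cmod ti) (cmod ei) * (1 + exp (- 2 * S))"
        using airy_delta_bound(1)[OF S', of ti ei] by simp
    qed (fact lt1[OF S] lt1[OF S'] airy_delta_bound(1)[OF S] | rule conn, assumption)+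
  qed
qed

end
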